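(* Suppose that $(f,X,\mu)$ is conservative and ergodic, where $\mu$ is a $\sigma$-finite $f$-invariant measure with $\mu(X)=\infty$, and that for some $Y\subset X$ the induced system $(f_Y,Y,\mu_Y)$ with return time function $R\colon Y\to\mathbb{N}$ satisfies assumptions (A1)–(A6), with $\beta\in(0,1)$ as in (A6); put $\alpha=1/\beta$. For a monotonically decreasing function $\psi\colon[0,\infty)\to[0,\infty)$, let $\phi(x)=\psi(d(x,\tilde x))$ for some point $\tilde x\in Y$, and assume the density of $\mu$ (with respect to Lebesgue measure) exists and is positive at $\tilde x$. Let $M_n(x)=\max_{0\le k\le n-1}\phi(f^k(x))$. Then there are constants $c_1,c_2>0$ such that for $\mu$-a.e. $x\in X$ there exists $N_x$ such that for all $n\ge N_x$, $$\psi\left(\frac{(\log n)^{c_1}}{n^{1/\alpha}}\right)\le M_n(x)\le\psi\left(\frac{1}{n^{1/\alpha}(\log n)^{c_2}}\right).$$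
   Context: $d$ is the distance on $X$. $R(x)=\min\{n\ge1:f^n(x)\in Y\}$ for $x\in Y$, $f_Y(x)=f^{R(x)}(x)$, $\mu_Y=\mu|_Y$. Assumptions on the induced system ($|\cdot|$ is length; $v(n)\sim u(n)$ means $c^{-1}\le v(n)/u(n)\le c$ for some $c>0$ and all large $n$): (A1) $Y$ is an interval with a countable Markov partition $\mathcal{P}=\{Y_i:i\in\mathbb{N}\}$ into intervals such that $f_Y(Y_i)$ contains a union of elements of $\mathcal{P}$, and there is $c_0>0$ with $|f_Y(Y_i)|>c_0$ for all $i$. Let $\mathcal{P}_n=\bigvee_{i=0}^nf_Y^{-i}\mathcal{P}$. (A2) There are $\lambda>1$, $C>0$ with $|(f_Y^n)'(x)|\ge C\lambda^n$ for all $x\in Y$, $n\ge1$. (A3) There are $0<\tau<1$, $C>0$ such that for all $\omega\in\mathcal{P}_n$ and $x,y\in\omega$, $\left|\log\frac{|f_Y'(x)|}{|f_Y'(y)|}\right|\le C\tau^n$. (A4) $\mu_Y$ is the unique $f_Y$-invariant probability measure absolutely continuous with respect to Lebesgue measure. (A5) $R$ is constant on each $Y_i\in\mathcal{P}$. (A6) There is $\beta\in(0,1)$ such that $\mu_Y\{x\in Y:R(x)=n\}\sim n^{-\beta-1}$.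
   Formalization: In (A1) the interval Y is taken to be bounded; for unbounded Y the claim can fail, because long returns may occur in clusters along the orbit of f_Y. *)

theory Defs
  imports "HOL-Probability.Probability"
begin

subsection \<open>Infinite measure preserving systems\<close>

definition invariant_measure :: "'a measure \<Rightarrow> ('a \<Rightarrow> 'a) \<Rightarrow> bool" where
  "invariant_measure M f \<longleftrightarrow> f \<in> M \<rightarrow>\<^sub>M M \<and> distr M M f = M"

definition wandering :: "'a measure \<Rightarrow> ('a \<Rightarrow> 'a) \<Rightarrow> 'a set \<Rightarrow> bool" where
  "wandering M f W \<longleftrightarrow>
     W \<in> sets M \<and> disjoint_family (\<lambda>n::nat. (f ^^ n) -` W \<inter> space M)"

definition conservative :: "'a measure \<Rightarrow> ('a \<Rightarrow> 'a) \<Rightarrow> bool" where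
  "conservative M f \<longleftrightarrow> (\<forall>W. wandering M f W \<longrightarrow> W \<in> null_sets M)"

definition ergodic :: "'a measure \<Rightarrow> ('a \<Rightarrow> 'a) \<Rightarrow> bool" where
  "ergodic M f \<longleftrightarrow> (\<forall>A\<in>sets M. f -` A \<inter> space M = A \<longrightarrow>
     A \<in> null_sets M \<or> space M - A \<in> null_sets M)"

text \<open>
  The density of a measure is only determined almost everywhere, so its value at a given
  point is the derivative of the measure there: the limit of the ratio of the two measures
  over intervals shrinking to the point and containing it, not necessarily centred at it.
  At an endpoint of the space this is the one-sided derivative.
\<close>
definition has_density_at :: "real measure \<Rightarrow> real \<Rightarrow> real \<Rightarrow> bool" where
  "has_density_at M h x \<longleftrightarrow>
     ((\<lambda>(a, b). emeasure M ({a..b} \<inter> space M) / emeasure lborel ({a..b} \<inter> space M))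
        \<longlongrightarrow> ennreal h)
       (at (x, x) within {(a, b). a \<le> x \<and> x \<le> b \<and> 0 < emeasure lborel ({a..b} \<inter> space M)})"


subsection \<open>The induced system\<close>

text \<open>
  Points that never return get the dummy return time 0, so that the first return map is a
  total map of \<open>Y\<close> into itself. Almost no point is affected when the system is conservative.
\<close>
definition return_time :: "('a \<Rightarrow> 'a) \<Rightarrow> 'a set \<Rightarrow> 'a \<Rightarrow> nat" where
  "return_time f Y x =
     (if \<exists>n\<ge>1. (f ^^ n) x \<in> Y then LEAST n. 1 \<le> n \<and> (f ^^ n) x \<in> Y else 0)"

definition first_return :: "('a \<Rightarrow> 'a) \<Rightarrow> 'a set \<Rightarrow> 'a \<Rightarrow> 'a" where
  "first_return f Y x = (f ^^ return_time f Y x) x"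

text \<open>
  The intervals are nondegenerate and cover \<open>Y\<close> up to a Lebesgue null set; interiors are used
  in the last two clauses because endpoints are immaterial. The last clause but one is the
  Markov property.
\<close>
definition markov_partition :: "real set \<Rightarrow> (real \<Rightarrow> real) \<Rightarrow> (nat \<Rightarrow> real set) \<Rightarrow> bool" where
  "markov_partition Y T P \<longleftrightarrow>
     (\<forall>i. is_interval (P i) \<and> interior (P i) \<noteq> {} \<and> P i \<subseteq> Y) \<and>
     disjoint_family P \<and>
     Y - (\<Union>i. P i) \<in> null_sets lborel \<and>
     (\<forall>i j. T ` P i \<inter> interior (P j) \<noteq> {} \<longrightarrow> interior (P j) \<subseteq> T ` P i) \<and>
     (\<forall>i. \<exists>J. J \<noteq> {} \<and> (\<Union>j\<in>J. interior (P j)) \<subseteq> T ` P i)"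

definition refinement :: "(nat \<Rightarrow> real set) \<Rightarrow> (real \<Rightarrow> real) \<Rightarrow> nat \<Rightarrow> real set set" where
  "refinement P T n = {\<omega>. \<omega> \<noteq> {} \<and> (\<exists>a :: nat \<Rightarrow> nat. \<omega> = (\<Inter>i\<le>n. (T ^^ i) -` P (a i)))}"

definition A1 :: "real set \<Rightarrow> (real \<Rightarrow> real) \<Rightarrow> (nat \<Rightarrow> real set) \<Rightarrow> bool" where
  "A1 Y T P \<longleftrightarrow> is_interval Y \<and> bounded Y \<and> markov_partition Y T P \<and>
     (\<exists>c\<^sub>0>0. \<forall>i. measure lborel (T ` P i) > c\<^sub>0)"

text \<open>
  The map \<open>T ^^ n\<close> is in general discontinuous where elements of \<open>refinement P T (n - 1)\<close>
  meet, so its derivative is taken within these elements: it is one-sided at their endpoints,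
  and no condition at all on an element that consists of a single point.
\<close>
definition A2 :: "(real \<Rightarrow> real) \<Rightarrow> (nat \<Rightarrow> real set) \<Rightarrow> bool" where
  "A2 T P \<longleftrightarrow> (\<exists>\<Lambda>>1. \<exists>C>0. \<forall>n\<ge>1. \<forall>\<omega>\<in>refinement P T (n - 1). \<forall>x\<in>\<omega>.
     \<exists>D. ((T ^^ n) has_real_derivative D) (at x within \<omega>) \<and> \<bar>D\<bar> \<ge> C * \<Lambda> ^ n)"

definition A3 :: "(real \<Rightarrow> real) \<Rightarrow> (nat \<Rightarrow> real set) \<Rightarrow> bool" where
  "A3 T P \<longleftrightarrow> (\<exists>\<tau> C. 0 < \<tau> \<and> \<tau> < 1 \<and> C > 0 \<and>
     (\<forall>n. \<forall>\<omega>\<in>refinement P T n. \<forall>i. \<omega> \<subseteq> P i \<longrightarrow> (\<forall>x\<in>\<omega>. \<forall>y\<in>\<omega>.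
        \<bar>ln (\<bar>vector_derivative T (at x within P i)\<bar> / \<bar>vector_derivative T (at y within P i)\<bar>)\<bar>
          \<le> C * \<tau> ^ n)))"

definition acip :: "real set \<Rightarrow> (real \<Rightarrow> real) \<Rightarrow> real measure \<Rightarrow> bool" where
  "acip Y T \<nu> \<longleftrightarrow> sets \<nu> = sets (restrict_space borel Y) \<and> prob_space \<nu> \<and>
     invariant_measure \<nu> T \<and> absolutely_continuous (restrict_space lborel Y) \<nu>"

definition A4 :: "real set \<Rightarrow> (real \<Rightarrow> real) \<Rightarrow> real measure \<Rightarrow> bool" where
  "A4 Y T \<mu>Y \<longleftrightarrow> acip Y T \<mu>Y \<and> (\<forall>\<nu>. acip Y T \<nu> \<longrightarrow> \<nu> = \<mu>Y)"

definition A5 :: "(real \<Rightarrow> nat) \<Rightarrow> (nat \<Rightarrow> real set) \<Rightarrow> bool" where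
  "A5 R P \<longleftrightarrow> (\<forall>i. R constant_on P i)"

definition comparable :: "(nat \<Rightarrow> real) \<Rightarrow> (nat \<Rightarrow> real) \<Rightarrow> bool" where
  "comparable v u \<longleftrightarrow> (\<exists>c>0. \<forall>\<^sub>F n in sequentially. inverse c \<le> v n / u n \<and> v n / u n \<le> c)"

definition A6 :: "real set \<Rightarrow> (real \<Rightarrow> nat) \<Rightarrow> real measure \<Rightarrow> real \<Rightarrow> bool" where
  "A6 Y R \<mu>Y \<beta> \<longleftrightarrow> 0 < \<beta> \<and> \<beta> < 1 \<and>
     comparable (\<lambda>n. measure \<mu>Y {x\<in>Y. R x = n}) (\<lambda>n. real n powr (- \<beta> - 1))"

definition induced_system :: "real measure \<Rightarrow> (real \<Rightarrow> real) \<Rightarrow> real set \<Rightarrow> real \<Rightarrow> bool" where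
  "induced_system M f Y \<beta> \<longleftrightarrow>
     (let T = first_return f Y; R = return_time f Y; \<mu>Y = restrict_space M Y in
        \<exists>P. A1 Y T P \<and> A2 T P \<and> A3 T P \<and> A4 Y T \<mu>Y \<and> A5 R P \<and> A6 Y R \<mu>Y \<beta>)"

definition max_process :: "('a \<Rightarrow> 'a) \<Rightarrow> ('a \<Rightarrow> real) \<Rightarrow> nat \<Rightarrow> 'a \<Rightarrow> real" where
  "max_process f \<phi> n x = Max ((\<lambda>k. \<phi> ((f ^^ k) x)) ` {..<n})"

end

theory Submission
  imports Defs "HOL-Real_Asymp.Real_Asymp"
begin

text \<open>
  The observable decreases with the distance to \<open>xt\<close>, so its maximum along an orbit is its value at the
  closest visit to \<open>xt\<close>. What has to be shown (\<open>closest_visits\<close>) is that almost every orbit comes within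
  \<open>ln n ^ 7 / n powr \<beta>\<close> of \<open>xt\<close> before time \<open>n\<close>, and stays farther than \<open>1 / (n powr \<beta> * ln n ^ 6)\<close> away from it,
  for all large \<open>n\<close>.

  There are two clocks, the time \<open>n\<close> and the number \<open>k\<close> of returns to \<open>Y\<close>, and powers of the logarithm are
  spent generously on each step, so that the Borel-Cantelli lemma along \<open>k = 2 ^ m\<close> is enough.

  \<^item> The first \<open>k\<close> return times add up to \<open>k powr (1 / \<beta>)\<close>, up to logarithms. The upper bound is the
  first moment of the truncated return times (\<open>many_returns_upper\<close>). For the lower bound, one of the \<open>k\<close>
  return times is as large as that (\<open>many_returns_lower\<close>).

  \<^item> The closest approach to \<open>xt\<close> during \<open>k\<close> excursions is \<open>1 / k\<close>, up to logarithms. It is not smaller by a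
  union bound, because an excursion meets a set with probability at most the measure of the set
  (\<open>excursion_hits_emeasure\<close>, \<open>excursions_avoid_ball\<close>). It is not larger because one of the first \<open>k\<close> returns
  hits the ball of that radius (\<open>ball_hit\<close>).

  The lower bound on the return times and \<open>ball_hit\<close> are both instances of a quantitative recurrence
  statement for the induced map (\<open>hitting_time_tail\<close>): a set of measure \<open>b\<close> that is a union of cylinders of
  length \<open>q\<close> is hit after a time of order \<open>(q + ln (1 / b)) / b\<close>, with exponential tails. The reason is
  regeneration. By bounded distortion, whatever happened in the past, the orbit is spread nearly
  uniformly over the image of the last symbol; this image is large, so it contains one of finitely many
  partition elements, and from there a fixed base element \<open>P z\<close> is reached by a fixed word with definite
  probability. The waiting times for \<open>P z\<close> therefore decay geometrically. Since \<open>\<mu>\<close> is stationary, the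
  mass \<open>b\<close> of the target can be traced back over \<open>N\<close> steps, with \<open>N\<close> of order \<open>ln (1 / b)\<close>: orbits that
  avoid \<open>P z\<close> account for at most half of it, so for some number of steps below \<open>N\<close> the target is
  reached from \<open>P z\<close> with probability of order \<open>b\<close> (\<open>base_decomposition\<close>). Every block of \<open>q + N\<close> steps, up to a constant, is
  thus an attempt with success probability of order \<open>b\<close>.

  Three facts about \<open>\<mu>\<close> enter: its density is bounded (\<open>mu_bound\<close>), no transition leaves the symbols that it
  charges (\<open>charged_closed\<close>), and any two of these are connected (\<open>charged_path\<close>), which follows from
  ergodicity, hence from the uniqueness of the absolutely continuous invariant probability measure.
\<close>

section \<open>Cylinders of a coded map\<close>

lemma (in finite_measure) scaled_measure_UN_mono:
  assumes "countable I" "disjoint_family_on A I" "disjoint_family_on B I"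
    and A: "\<And>i. i \<in> I \<Longrightarrow> A i \<in> sets M" and B: "\<And>i. i \<in> I \<Longrightarrow> B i \<in> sets M"
    and ab: "0 \<le> a" "0 \<le> b"
    and le: "\<And>i. i \<in> I \<Longrightarrow> a * measure M (A i) \<le> b * measure M (B i)"
  shows "a * measure M (\<Union>i\<in>I. A i) \<le> b * measure M (\<Union>i\<in>I. B i)"
proof -
  have UA: "(\<Union>i\<in>I. A i) \<in> sets M" and UB: "(\<Union>i\<in>I. B i) \<in> sets M"
    using assms by (auto intro!: sets.countable_UN')
  have "ennreal (a * measure M (\<Union>i\<in>I. A i)) = ennreal a * emeasure M (\<Union>i\<in>I. A i)"
    using ab by (simp add: ennreal_mult emeasure_eq_measure)
  also have "\<dots> = (\<integral>\<^sup>+i. ennreal a * emeasure M (A i) \<partial>count_space I)"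
    using assms by (subst emeasure_UN_countable) (auto simp: nn_integral_cmult)
  also have "\<dots> \<le> (\<integral>\<^sup>+i. ennreal b * emeasure M (B i) \<partial>count_space I)"
  proof (rule nn_integral_mono)
    fix i assume "i \<in> space (count_space I)"
    then show "ennreal a * emeasure M (A i) \<le> ennreal b * emeasure M (B i)"
      using le[of i] ab
      by (simp add: emeasure_eq_measure flip: ennreal_mult)
  qed
  also have "\<dots> = ennreal b * emeasure M (\<Union>i\<in>I. B i)"
    using assms by (subst emeasure_UN_countable) (auto simp: nn_integral_cmult)
  also have "\<dots> = ennreal (b * measure M (\<Union>i\<in>I. B i))"
    using ab by (simp add: ennreal_mult emeasure_eq_measure)
  finally show ?thesis
    using ab by (simp add: ennreal_le_iff)
qed

locale markov_coding = finite_measure L for L :: "'a measure" +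
  fixes T :: "'a \<Rightarrow> 'a" and P :: "nat \<Rightarrow> 'a set"
  assumes T_meas [measurable]: "T \<in> L \<rightarrow>\<^sub>M L"
    and P_sets [measurable]: "\<And>i. P i \<in> sets L"
    and P_disj: "disjoint_family P"
    and P_cover: "space L - (\<Union>i. P i) \<in> null_sets L"
begin

abbreviation m :: "'a set \<Rightarrow> real" where "m \<equiv> measure L"

definition pre :: "nat \<Rightarrow> 'a set \<Rightarrow> 'a set" where
  "pre n A = (T ^^ n) -` A \<inter> space L"

definition cyl :: "nat list \<Rightarrow> 'a set" where
  "cyl w = {x \<in> space L. \<forall>i<length w. (T ^^ i) x \<in> P (w ! i)}"

text \<open>
  Points whose whole orbit has an itinerary; the partition covers the space only up to a null set.
\<close>

definition full :: "'a set" where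
  "full = {x \<in> space L. \<forall>i. \<exists>j. (T ^^ i) x \<in> P j}"

definition determined :: "nat \<Rightarrow> 'a set \<Rightarrow> bool" where
  "determined q B \<longleftrightarrow> B \<in> sets L \<and> (\<forall>w. length w = q \<longrightarrow> cyl w \<subseteq> B \<or> cyl w \<inter> B = {})"

definition miss :: "'a set \<Rightarrow> nat \<Rightarrow> 'a set" where
  "miss B n = {x \<in> space L. \<forall>j<n. (T ^^ j) x \<notin> B}"

lemma Tn_meas [measurable]: "(T ^^ n) \<in> L \<rightarrow>\<^sub>M L"
  by (induction n) (auto intro: measurable_comp)

lemma Tn_space: "x \<in> space L \<Longrightarrow> (T ^^ n) x \<in> space L"
  using measurable_space[OF Tn_meas] .

lemma pre_sets [measurable]: "A \<in> sets L \<Longrightarrow> pre n A \<in> sets L"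
  unfolding pre_def by measurable

lemma pre_pre: "pre n (pre k A) = pre (n + k) A"
  by (auto simp: pre_def Tn_space funpow_add add.commute[of n k])

lemma pre_0: "A \<in> sets L \<Longrightarrow> pre 0 A = A"
  using sets.sets_into_space by (auto simp: pre_def)

lemma pre_Int: "pre n (A \<inter> B) = pre n A \<inter> pre n B"
  by (auto simp: pre_def)

lemma P_space: "P i \<subseteq> space L"
  using sets.sets_into_space[OF P_sets] .

lemma cyl_eq: "cyl w = space L - (\<Union>i<length w. space L - pre i (P (w ! i)))"
  by (auto simp: cyl_def pre_def)

lemma cyl_sets [measurable]: "cyl w \<in> sets L"
  unfolding cyl_eq by (intro sets.Diff sets.top sets.finite_UN pre_sets P_sets) auto

lemma cyl_space: "cyl w \<subseteq> space L" by (auto simp: cyl_def)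

lemma cyl_single: "cyl [i] = P i"
  using P_space[of i] by (auto simp: cyl_def)

lemma cyl_append: "cyl (u @ v) = cyl u \<inter> pre (length u) (cyl v)"
proof (intro set_eqI iffI)
  fix x assume x: "x \<in> cyl (u @ v)"
  have "(T ^^ i) ((T ^^ length u) x) \<in> P (v ! i)" if "i < length v" for i
  proof -
    have "(T ^^ (i + length u)) x \<in> P ((u @ v) ! (i + length u))"
      using x that by (auto simp: cyl_def)
    then show ?thesis by (simp add: funpow_add nth_append)
  qed
  moreover have "(T ^^ i) x \<in> P (u ! i)" if "i < length u" for i
  proof -
    have "(T ^^ i) x \<in> P ((u @ v) ! i)" using x that by (auto simp: cyl_def)
    then show ?thesis using that by (simp add: nth_append)
  qed
  ultimately show "x \<in> cyl u \<inter> pre (length u) (cyl v)"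
    using x by (auto simp: cyl_def pre_def Tn_space)
next
  fix x assume x: "x \<in> cyl u \<inter> pre (length u) (cyl v)"
  have "(T ^^ i) x \<in> P ((u @ v) ! i)" if "i < length u + length v" for i
  proof (cases "i < length u")
    case True then show ?thesis using x by (auto simp: cyl_def nth_append)
  next
    case False
    then have "(T ^^ (i - length u)) ((T ^^ length u) x) \<in> P (v ! (i - length u))"
      using x that by (auto simp: cyl_def pre_def)
    also have "(T ^^ (i - length u)) ((T ^^ length u) x) = (T ^^ i) x"
      using False by (metis funpow_add le_add_diff_inverse2 not_less o_apply)
    finally show ?thesis using False by (simp add: nth_append)
  qed
  then show "x \<in> cyl (u @ v)" using x by (auto simp: cyl_def)
qed

lemma cyl_disjoint:
  assumes "length u = length v" "u \<noteq> v" shows "cyl u \<inter> cyl v = {}"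
proof -
  obtain i where "i < length u" "u ! i \<noteq> v ! i"
    using assms by (meson nth_equalityI)
  then show ?thesis
    using assms P_disj by (fastforce simp: cyl_def disjoint_family_on_def)
qed

lemma full_eq: "full = space L - (\<Union>i. space L - (\<Union>j. pre i (P j)))"
  by (auto simp: full_def pre_def)

lemma full_sets [measurable]: "full \<in> sets L"
  unfolding full_eq by (intro sets.Diff sets.top sets.countable_UN pre_sets P_sets) auto

lemma full_word:
  assumes "x \<in> full" obtains w where "length w = n" "x \<in> cyl w"
proof
  let ?w = "map (\<lambda>i. SOME j. (T ^^ i) x \<in> P j) [0..<n]"
  show "length ?w = n" by simp
  have "\<exists>j. (T ^^ i) x \<in> P j" for i
    using assms by (simp add: full_def)
  then have "(T ^^ i) x \<in> P (SOME j. (T ^^ i) x \<in> P j)" for i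
    by (rule someI_ex)
  moreover have "x \<in> space L" using assms by (simp add: full_def)
  ultimately show "x \<in> cyl ?w" unfolding cyl_def by simp
qed

lemma determined_sets: "determined q B \<Longrightarrow> B \<in> sets L"
  by (simp add: determined_def)

lemma determined_mono:
  assumes "determined q B" "q \<le> n" shows "determined n B"
  unfolding determined_def
proof (intro conjI allI impI)
  show "B \<in> sets L" using assms by (simp add: determined_def)
  fix w :: "nat list" assume w: "length w = n"
  have "cyl w = cyl (take q w @ drop q w)" by simp
  also have "\<dots> \<subseteq> cyl (take q w)" by (subst cyl_append) simp
  finally have sub: "cyl w \<subseteq> cyl (take q w)" .
  have "length (take q w) = q" using w assms(2) by simp
  then have "cyl (take q w) \<subseteq> B \<or> cyl (take q w) \<inter> B = {}"
    using assms(1) unfolding determined_def by blast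
  then show "cyl w \<subseteq> B \<or> cyl w \<inter> B = {}" using sub by blast
qed

lemma determined_Int: "determined q A \<Longrightarrow> determined q B \<Longrightarrow> determined q (A \<inter> B)"
  unfolding determined_def by blast

lemma miss_eq: "miss B n = space L - (\<Union>j<n. pre j B)"
  by (auto simp: miss_def pre_def)

lemma miss_sets [measurable]: "B \<in> sets L \<Longrightarrow> miss B n \<in> sets L"
  unfolding miss_eq by (intro sets.Diff sets.top sets.finite_UN pre_sets) auto

lemma determined_compl:
  assumes "determined q B" shows "determined q (space L - B)"
proof -
  have "cyl w \<subseteq> space L - B \<or> cyl w \<inter> (space L - B) = {}" if "length w = q" for w
    using assms that cyl_space[of w] unfolding determined_def by blast
  then show ?thesis using determined_sets[OF assms] by (simp add: determined_def)
qed

lemma determined_pre: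
  assumes "determined q B" shows "determined (j + q) (pre j B)"
  unfolding determined_def
proof (intro conjI allI impI)
  show "pre j B \<in> sets L" using determined_sets[OF assms] by (rule pre_sets)
  fix w :: "nat list" assume w: "length w = j + q"
  have "cyl w = cyl (take j w @ drop j w)" by simp
  also have "\<dots> = cyl (take j w) \<inter> pre j (cyl (drop j w))" using w by (subst cyl_append) (simp add: min_def)
  finally have *: "cyl w = \<dots>" .
  have "cyl (drop j w) \<subseteq> B \<or> cyl (drop j w) \<inter> B = {}" using assms w by (auto simp: determined_def)
  then show "cyl w \<subseteq> pre j B \<or> cyl w \<inter> pre j B = {}" using * by (auto simp: pre_def)
qed

lemma determined_miss:
  assumes B: "determined q B" and "1 \<le> q" shows "determined (n + q) (miss B n)"
proof (induction n)
  case 0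
  have "miss B 0 = space L" by (auto simp: miss_def)
  then show ?case using cyl_space by (auto simp: determined_def)
next
  case (Suc n)
  have "miss B (Suc n) = miss B n \<inter> (space L - pre n B)"
    by (auto simp: miss_def pre_def less_Suc_eq)
  moreover have "determined (Suc n + q) (miss B n)" using Suc by (rule determined_mono) simp
  moreover have "determined (Suc n + q) (space L - pre n B)"
    using determined_compl[OF determined_pre[OF B]] by (rule determined_mono) simp
  ultimately show ?case using determined_Int by metis
qed

lemma miss_add: "miss B (n + k) \<subseteq> miss B n \<inter> pre n (miss B k)"
proof -
  have "(T ^^ j) ((T ^^ n) x) = (T ^^ (n + j)) x" for j x
    by (simp add: funpow_add add.commute[of n j])
  then show ?thesis by (auto simp: miss_def pre_def Tn_space)
qed

lemma miss_antimono: "n \<le> k \<Longrightarrow> miss B k \<subseteq> miss B n"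
  by (auto simp: miss_def)

end

section \<open>Bounded distortion\<close>

text \<open>
  A long cylinder is spread by the iterate of its own length almost uniformly, up to the factor \<open>K\<close>,
  over the image \<open>G i\<close> of its last symbol: \<open>up\<close> and \<open>low\<close> express bounded distortion without mentioning
  derivatives. The finite set \<open>F\<close> replaces compactness of the state space: since all images are
  large, each of them contains one of finitely many partition elements.
\<close>

locale distorted_markov_coding = markov_coding +
  fixes G :: "nat \<Rightarrow> 'a set" and K :: real and F :: "nat set"
  assumes G_sets [measurable]: "\<And>i. G i \<in> sets L"
    and K_pos: "0 < K"
    and up: "\<And>w A. w \<noteq> [] \<Longrightarrow> A \<in> sets L \<Longrightarrow>
      m (cyl w \<inter> pre (length w) A) \<le> K * m (cyl w) * m (A \<inter> G (last w))"
    and low: "\<And>w A. w \<noteq> [] \<Longrightarrow> A \<in> sets L \<Longrightarrow>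
      m (cyl w) * m (A \<inter> G (last w)) \<le> K * m (cyl w \<inter> pre (length w) A)"
    and F_finite: "finite F"
    and F_big: "\<And>i. \<exists>j\<in>F. 0 < m (P j) \<and> m (P j - G i) = 0"
begin

lemma null_pre: assumes "N \<in> null_sets L" shows "pre n N \<in> null_sets L"
  using assms
proof (induction n)
  case 0 then show ?case by (simp add: pre_0 null_setsD2)
next
  case (Suc n)
  have N: "pre n N \<in> null_sets L" using Suc by auto
  then have Ns: "pre n N \<in> sets L" by auto
  have eq: "pre 1 (pre n N) = pre (Suc n) N" by (simp add: pre_pre)
  have "P i \<inter> pre 1 (pre n N) \<in> null_sets L" for i
  proof -
    have "m (pre n N \<inter> G i) = 0"
      using N by (metis G_sets Int_commute measure_eq_0_null_sets null_set_Int1)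
    then have "m (cyl [i] \<inter> pre (length [i]) (pre n N)) \<le> 0"
      using up[of "[i]" "pre n N"] Ns by simp
    then have "m (P i \<inter> pre 1 (pre n N)) = 0"
      by (intro antisym) (simp_all add: cyl_single)
    then show ?thesis using Ns by (auto simp: null_sets_def emeasure_eq_measure)
  qed
  then have "(\<Union>i. P i \<inter> pre 1 (pre n N)) \<union> (space L - (\<Union>i. P i)) \<in> null_sets L"
    using P_cover by (intro null_sets.Un null_sets_UN) auto
  then have "pre 1 (pre n N) \<in> null_sets L"
    using pre_sets[OF Ns, of 1] by (rule null_sets_subset) (auto simp: pre_def)
  then show ?case by (simp only: eq)
qed

lemma full_conull: "space L - full \<in> null_sets L"
proof -
  have "space L - full = (\<Union>n. pre n (space L - (\<Union>i. P i)))"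
    by (auto simp: full_def pre_def Tn_space)
  then show ?thesis using null_pre[OF P_cover] by (auto intro!: null_sets_UN)
qed

lemma m_Int_full: assumes "A \<in> sets L" shows "m (A \<inter> full) = m A"
proof -
  have "A - full \<in> null_sets L"
    using null_sets_subset[OF full_conull, of "A - full"] sets.sets_into_space[OF assms] assms
    by auto
  then have "m (A - full) = 0" by (simp add: measure_eq_0_null_sets)
  then show ?thesis using assms finite_measure_Diff'[of A full] by simp
qed

text \<open>
  Almost every point lies in some cylinder of each length, so a determined set is, up to a null set,
  a countable disjoint union of cylinders, and an inequality that holds on each cylinder can be
  summed. This is how every estimate "conditionally on the past" is turned into an estimate of
  measures below.
\<close>

lemma determined_sum_mono:
  assumes A: "determined n A" and Z: "Z1 \<in> sets L" "Z2 \<in> sets L" and ab: "0 \<le> a" "0 \<le> b"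
    and le: "\<And>w. length w = n \<Longrightarrow> cyl w \<subseteq> A \<Longrightarrow> a * m (cyl w \<inter> Z1) \<le> b * m (cyl w \<inter> Z2)"
  shows "a * m (A \<inter> Z1) \<le> b * m (A \<inter> Z2)"
proof -
  let ?I = "{w. length w = n \<and> cyl w \<subseteq> A}"
  have As: "A \<in> sets L" using A by (rule determined_sets)
  have dj: "disjoint_family_on (\<lambda>w. cyl w \<inter> Z) ?I" for Z
    unfolding disjoint_family_on_def
  proof (intro ballI impI)
    fix u v assume "u \<in> ?I" "v \<in> ?I" "u \<noteq> v"
    then have "cyl u \<inter> cyl v = {}" by (intro cyl_disjoint) simp_all
    then show "cyl u \<inter> Z \<inter> (cyl v \<inter> Z) = {}" by blast
  qed
  have eq: "A \<inter> full = (\<Union>w\<in>?I. cyl w) \<inter> full"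
  proof (intro set_eqI iffI)
    fix x assume x: "x \<in> A \<inter> full"
    then obtain w where "length w = n" "x \<in> cyl w" using full_word by blast
    moreover then have "cyl w \<subseteq> A" using A x unfolding determined_def by blast
    ultimately show "x \<in> (\<Union>w\<in>?I. cyl w) \<inter> full" using x by auto
  qed auto
  have mz: "m (A \<inter> Z) = m (\<Union>w\<in>?I. cyl w \<inter> Z)" if Z: "Z \<in> sets L" for Z
  proof -
    have s: "(\<Union>w\<in>?I. cyl w \<inter> Z) \<in> sets L"
      by (intro sets.countable_UN'' countableI_type sets.Int cyl_sets Z)
    have "m (A \<inter> Z) = m (A \<inter> Z \<inter> full)" using As Z by (intro m_Int_full[symmetric] sets.Int)
    also have "A \<inter> Z \<inter> full = (A \<inter> full) \<inter> Z" by (simp only: Int_ac)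
    also have "\<dots> = (\<Union>w\<in>?I. cyl w \<inter> Z) \<inter> full" unfolding eq by (simp only: Int_ac Int_UN_distrib)
    also have "m \<dots> = m (\<Union>w\<in>?I. cyl w \<inter> Z)" using s by (rule m_Int_full)
    finally show ?thesis .
  qed
  show ?thesis
    unfolding mz[OF Z(1)] mz[OF Z(2)]
  proof (rule scaled_measure_UN_mono)
    show "a * m (cyl w \<inter> Z1) \<le> b * m (cyl w \<inter> Z2)" if "w \<in> ?I" for w
      using that by (intro le) auto
    show "cyl w \<inter> Z1 \<in> sets L" "cyl w \<inter> Z2 \<in> sets L" for w
      using Z by (simp_all add: sets.Int)
    show "countable ?I" by (rule countableI_type)
    show "disjoint_family_on (\<lambda>w. cyl w \<inter> Z1) ?I" by (rule dj)
    show "disjoint_family_on (\<lambda>w. cyl w \<inter> Z2) ?I" by (rule dj)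
  qed (rule ab)+
qed

lemma determined_UN_cyl:
  assumes "\<And>w. w \<in> W \<Longrightarrow> length w = n"
  shows "determined n (\<Union>w\<in>W. cyl w)"
  unfolding determined_def
proof (intro conjI allI impI)
  show "(\<Union>w\<in>W. cyl w) \<in> sets L" by (intro sets.countable_UN'' countableI_type cyl_sets)
  fix v :: "nat list" assume v: "length v = n"
  show "cyl v \<subseteq> (\<Union>w\<in>W. cyl w) \<or> cyl v \<inter> (\<Union>w\<in>W. cyl w) = {}"
  proof (cases "v \<in> W")
    case False
    then have "cyl v \<inter> cyl w = {}" if "w \<in> W" for w
      using that v assms by (intro cyl_disjoint) auto
    then show ?thesis by blast
  qed auto
qed

lemma determined_cyl: "determined (length w) (cyl w)"
  using determined_UN_cyl[of "{w}" "length w"] by simp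

text \<open>
  Avoiding \<open>B\<close> up to time \<open>n\<close> is an event about the first \<open>n + q\<close> symbols. Once these are known, the
  next \<open>N\<close> iterates are a fresh attempt to hit \<open>B\<close>, which succeeds with conditional probability at
  least \<open>e\<close>. The attempts therefore take \<open>q + N\<close> steps each, and the failures multiply.
\<close>

lemma miss_decay:
  assumes B: "determined q B" "1 \<le> q" and A0: "determined 1 A0" and e: "e \<le> 1"
    and hit: "\<And>w. w \<noteq> [] \<Longrightarrow> cyl w \<subseteq> A0 \<Longrightarrow>
      m (cyl w \<inter> pre (length w) (miss B N)) \<le> (1 - e) * m (cyl w)"
  shows "m (A0 \<inter> miss B (k * (q + N))) \<le> (1 - e) ^ k * m (space L)"
proof (induction k)
  case 0
  show ?case by (simp add: bounded_measure)
next
  case (Suc k)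
  let ?n = "k * (q + N)"
  let ?A = "A0 \<inter> miss B ?n"
  have Bs: "B \<in> sets L" and A0s: "A0 \<in> sets L" using B A0 determined_sets by auto
  have det: "determined (?n + q) ?A"
    using determined_Int determined_miss[OF B] determined_mono[OF A0] B(2) by simp
  have "A0 \<inter> miss B (Suc k * (q + N)) \<subseteq> ?A \<inter> pre (?n + q) (miss B N)"
  proof -
    have "miss B (Suc k * (q + N)) \<subseteq> miss B (?n + q) \<inter> pre (?n + q) (miss B N)"
      using miss_add[of B "?n + q" N] by (simp add: algebra_simps)
    moreover have "miss B (?n + q) \<subseteq> miss B ?n" by (rule miss_antimono) simp
    ultimately show ?thesis by blast
  qed
  then have 1: "m (A0 \<inter> miss B (Suc k * (q + N))) \<le> 1 * m (?A \<inter> pre (?n + q) (miss B N))"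
    unfolding mult_1 using Bs A0s by (intro finite_measure_mono) auto
  have 2: "1 * m (?A \<inter> pre (?n + q) (miss B N)) \<le> (1 - e) * m (?A \<inter> space L)"
  proof (rule determined_sum_mono[OF det])
    fix w :: "nat list" assume w: "length w = ?n + q" "cyl w \<subseteq> ?A"
    then have "w \<noteq> []" using B(2) by auto
    then show "1 * m (cyl w \<inter> pre (?n + q) (miss B N)) \<le> (1 - e) * m (cyl w \<inter> space L)"
      using hit[of w] w by (simp add: Int_absorb2 cyl_space)
  qed (use Bs e in auto)
  have 3: "?A \<inter> space L = ?A" by (auto simp: miss_def)
  have 4: "(1 - e) * m ?A \<le> (1 - e) * ((1 - e) ^ k * m (space L))"
    using Suc e by (intro mult_left_mono) auto
  show ?case using order_trans[OF 1 2] 4 unfolding 3 power_Suc mult.assoc by (rule order_trans)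
qed

end

locale generating_markov_coding = distorted_markov_coding +
  assumes approx: "\<And>E e. E \<in> sets L \<Longrightarrow> 0 < e \<Longrightarrow> \<exists>n0. \<forall>n\<ge>n0. \<exists>W. (\<forall>w\<in>W. length w = n) \<and>
      m (E - (\<Union>w\<in>W. cyl w)) < e \<and> m ((\<Union>w\<in>W. cyl w) - E) < e"
begin

text \<open>
  For a union of cylinders this is \<open>up\<close>, summed, and an arbitrary set is approximated by such unions.
\<close>

lemma mixing_upper:
  assumes E: "E \<in> sets L" and A: "A \<in> sets L" and e: "0 < e"
  shows "\<exists>n0. \<forall>n\<ge>n0. m (E \<inter> pre n A) \<le> K * m E * m A + e"
proof -
  define d where "d = e / (K * m A + 1)"
  have KA: "0 \<le> K * m A" using K_pos by simp
  then have d: "0 < d" using e by (simp add: d_def)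
  obtain n0 where n0: "\<And>n. n \<ge> n0 \<Longrightarrow> \<exists>W. (\<forall>w\<in>W. length w = n) \<and>
      m (E - (\<Union>w\<in>W. cyl w)) < d \<and> m ((\<Union>w\<in>W. cyl w) - E) < d"
    using approx[OF E d] by blast
  have "m (E \<inter> pre n A) \<le> K * m E * m A + e" if n: "n \<ge> max 1 n0" for n
  proof -
    obtain W where W: "\<And>w. w \<in> W \<Longrightarrow> length w = n" and
      W1: "m (E - (\<Union>w\<in>W. cyl w)) < d" and W2: "m ((\<Union>w\<in>W. cyl w) - E) < d"
      using n0[of n] n by auto
    define U where "U = (\<Union>w\<in>W. cyl w)"
    have det: "determined n U" unfolding U_def using W by (rule determined_UN_cyl)
    then have Us: "U \<in> sets L" by (rule determined_sets)
    have "1 * m (U \<inter> pre n A) \<le> (K * m A) * m (U \<inter> space L)"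
    proof (rule determined_sum_mono[OF det])
      fix w :: "nat list" assume w: "length w = n"
      then have "w \<noteq> []" using n by auto
      then have "m (cyl w \<inter> pre n A) \<le> K * m (cyl w) * m (A \<inter> G (last w))"
        using up[of w A] A w by simp
      also have "\<dots> \<le> K * m (cyl w) * m A"
        using K_pos A by (intro mult_left_mono finite_measure_mono) auto
      finally show "1 * m (cyl w \<inter> pre n A) \<le> (K * m A) * m (cyl w \<inter> space L)"
        by (simp add: Int_absorb2 cyl_space mult_ac)
    qed (use A KA in auto)
    then have 1: "m (U \<inter> pre n A) \<le> (K * m A) * m U"
      using sets.sets_into_space[OF Us] by (simp add: Int_absorb2)
    have "m (E \<inter> pre n A) \<le> m ((U \<inter> pre n A) \<union> (E - U))"
      using E Us A by (intro finite_measure_mono) auto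
    also have "\<dots> \<le> m (U \<inter> pre n A) + m (E - U)"
      using E Us A by (intro measure_subadditive) auto
    finally have 2: "m (E \<inter> pre n A) \<le> m (U \<inter> pre n A) + d" using W1 U_def by simp
    have "m U \<le> m (E \<union> (U - E))" using E Us by (intro finite_measure_mono) auto
    also have "\<dots> \<le> m E + m (U - E)" using E Us by (intro measure_subadditive) auto
    finally have "m U \<le> m E + d" using W2 U_def by simp
    then have "(K * m A) * m U \<le> (K * m A) * (m E + d)" using KA by (rule mult_left_mono)
    with 1 2 have "m (E \<inter> pre n A) \<le> (K * m A) * m E + (K * m A + 1) * d"
      by (simp add: algebra_simps)
    also have "(K * m A + 1) * d = e" using KA by (simp add: d_def)
    finally show ?thesis by (simp add: mult_ac)
  qed
  then show ?thesis by blast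
qed

end

section \<open>The density and the support of the invariant measure\<close>

locale mixing_system = generating_markov_coding +
  fixes \<mu> :: "'a measure"
  assumes mu_sets: "sets \<mu> = sets L" and mu_prob: "prob_space \<mu>"
    and mu_ac: "absolutely_continuous L \<mu>"
    and mu_inv: "\<And>A. A \<in> sets L \<Longrightarrow> measure \<mu> (pre 1 A) = measure \<mu> A"
    and mu_erg: "\<And>A. A \<in> sets L \<Longrightarrow> pre 1 A \<subseteq> A \<Longrightarrow> 0 < measure \<mu> A \<Longrightarrow> measure \<mu> A = 1"
begin

abbreviation p :: "'a set \<Rightarrow> real" where "p \<equiv> measure \<mu>"

sublocale mu: prob_space \<mu> by (rule mu_prob)

lemma mu_space: "space \<mu> = space L"
  using mu_sets by (rule sets_eq_imp_space_eq)

lemma mu_pre: "A \<in> sets L \<Longrightarrow> p (pre n A) = p A"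
proof (induction n)
  case 0 then show ?case by (simp add: pre_0)
next
  case (Suc n)
  have "pre (Suc n) A = pre 1 (pre n A)" by (simp add: pre_pre)
  then show ?case using Suc mu_inv[of "pre n A"] by simp
qed

text \<open>
  The inequality is additive, homogeneous and stable under increasing limits of integrable
  functions, hence passes from indicator functions to densities.
\<close>

lemma mixing_upper_density:
  assumes h: "h \<in> borel_measurable L" and A: "A \<in> sets L"
  shows "(\<integral>\<^sup>+x. h x \<partial>L) < \<infinity> \<Longrightarrow> 0 < (e::real) \<Longrightarrow>
    \<exists>n0. \<forall>n\<ge>n0. (\<integral>\<^sup>+x. h x * indicator (pre n A) x \<partial>L) \<le>
       ennreal (K * m A) * (\<integral>\<^sup>+x. h x \<partial>L) + ennreal e"
  using h
proof (induction arbitrary: e rule: borel_measurable_induct)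
  case (cong f g)
  let ?I = "\<lambda>n u. \<integral>\<^sup>+x. u x * indicator (pre n A) x \<partial>L"
  have "?I n f = ?I n g" "integral\<^sup>N L f = integral\<^sup>N L g" for n
    using cong(3) by (auto intro!: nn_integral_cong)
  then show ?case using cong by simp
next
  case (set E)
  let ?I = "\<lambda>n u. \<integral>\<^sup>+x. u x * indicator (pre n A) x \<partial>L"
  obtain n0 where n0: "\<And>n. n \<ge> n0 \<Longrightarrow> m (E \<inter> pre n A) \<le> K * m E * m A + e"
    using mixing_upper[OF set(1) A set(3)] by blast
  have "?I n (indicator E) \<le>
       ennreal (K * m A) * (\<integral>\<^sup>+x. indicator E x \<partial>L) + ennreal e" if "n \<ge> n0" for n
  proof -
    have "?I n (indicator E) = (\<integral>\<^sup>+x. indicator (E \<inter> pre n A) x \<partial>L)"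
      by (intro nn_integral_cong) (simp add: indicator_def)
    also have "\<dots> = ennreal (m (E \<inter> pre n A))"
      using set(1) A by (simp add: emeasure_eq_measure)
    also have "\<dots> \<le> ennreal (K * m E * m A + e)" by (intro ennreal_leI n0 that)
    also have "\<dots> = ennreal (K * m A) * ennreal (m E) + ennreal e"
      using set(3) K_pos by (simp add: ennreal_plus mult_ac flip: ennreal_mult)
    finally show ?thesis using set(1) by (simp add: emeasure_eq_measure)
  qed
  then show ?case by blast
next
  case (mult u c)
  let ?I = "\<lambda>n u. \<integral>\<^sup>+x. u x * indicator (pre n A) x \<partial>L"
  show ?case
  proof (cases "c = 0")
    case False
    obtain c' where c': "c = ennreal c'" "0 < c'"
      using mult(1) False by (cases c) auto
    have "(\<integral>\<^sup>+x. c * u x \<partial>L) = c * integral\<^sup>N L u"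
      using mult(2) by (intro nn_integral_cmult)
    then have "integral\<^sup>N L u < \<infinity>"
      using mult.prems(1) False by (auto simp: ennreal_mult_less_top)
    then obtain n0 where n0: "\<And>n. n \<ge> n0 \<Longrightarrow> ?I n u \<le>
       ennreal (K * m A) * integral\<^sup>N L u + ennreal (e / c')"
      using mult.IH[of "e / c'"] mult.prems(2) c' by auto
    have "?I n (\<lambda>x. c * u x) \<le>
       ennreal (K * m A) * (\<integral>\<^sup>+x. c * u x \<partial>L) + ennreal e" if "n \<ge> n0" for n
    proof -
      have "?I n (\<lambda>x. c * u x) = c * ?I n u"
        using mult(2) A by (subst nn_integral_cmult[symmetric]) (auto simp: mult_ac)
      also have "\<dots> \<le> c * (ennreal (K * m A) * integral\<^sup>N L u + ennreal (e / c'))"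
        by (intro mult_left_mono n0 that) simp
      also have "\<dots> = ennreal (K * m A) * (\<integral>\<^sup>+x. c * u x \<partial>L) + c * ennreal (e / c')"
        using mult(2) by (simp add: nn_integral_cmult distrib_left mult_ac)
      also have "c * ennreal (e / c') = ennreal e"
        using c' mult.prems(2) by (simp flip: ennreal_mult)
      finally show ?thesis .
    qed
    then show ?thesis by blast
  qed (use mult in auto)
next
  case (add u v)
  let ?I = "\<lambda>n u. \<integral>\<^sup>+x. u x * indicator (pre n A) x \<partial>L"
  have int: "(\<integral>\<^sup>+x. v x + u x \<partial>L) = integral\<^sup>N L v + integral\<^sup>N L u"
    using add by (intro nn_integral_add) auto
  then have fin: "integral\<^sup>N L u < \<infinity>" "integral\<^sup>N L v < \<infinity>"
    using add.prems by (auto simp: less_top)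
  obtain n0 where n0: "\<And>n. n \<ge> n0 \<Longrightarrow> ?I n u \<le>
       ennreal (K * m A) * integral\<^sup>N L u + ennreal (e / 2)"
    using add.IH(1)[OF fin(1), of "e / 2"] add.prems by auto
  obtain n1 where n1: "\<And>n. n \<ge> n1 \<Longrightarrow> ?I n v \<le>
       ennreal (K * m A) * integral\<^sup>N L v + ennreal (e / 2)"
    using add.IH(2)[OF fin(2), of "e / 2"] add.prems by auto
  have "?I n (\<lambda>x. v x + u x) \<le>
       ennreal (K * m A) * (\<integral>\<^sup>+x. v x + u x \<partial>L) + ennreal e" if "n \<ge> max n0 n1" for n
  proof -
    have "?I n (\<lambda>x. v x + u x) =
      ?I n v + ?I n u"
      using add A by (subst nn_integral_add[symmetric]) (auto simp: distrib_right)
    also have "\<dots> \<le> (ennreal (K * m A) * integral\<^sup>N L v + ennreal (e / 2)) +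
      (ennreal (K * m A) * integral\<^sup>N L u + ennreal (e / 2))"
      using that by (intro add_mono n0 n1) auto
    also have "\<dots> = ennreal (K * m A) * (integral\<^sup>N L v + integral\<^sup>N L u) + (ennreal (e / 2) + ennreal (e / 2))"
      by (simp add: distrib_left add_ac)
    also have "ennreal (e / 2) + ennreal (e / 2) = ennreal e"
      using add.prems by (simp flip: ennreal_plus)
    finally show ?thesis unfolding int .
  qed
  then show ?case by blast
next
  case (seq U)
  let ?I = "\<lambda>n u. \<integral>\<^sup>+x. u x * indicator (pre n A) x \<partial>L"
  have h: "h = (SUP i. U i)" using seq by simp
  have hm[measurable]: "h \<in> borel_measurable L" using assms(1) .
  have U[measurable]: "U i \<in> borel_measurable L" for i using seq by simp
  have Uh: "U i x \<le> h x" for i x unfolding h by (auto intro: SUP_upper simp: image_image)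
  have fin: "integral\<^sup>N L h < \<infinity>" using seq.prems(1) unfolding h .
  have "h x = (SUP i. U i x)" for x unfolding h by (simp add: image_image)
  then have "integral\<^sup>N L h = (\<integral>\<^sup>+x. (SUP i. U i x) \<partial>L)" by (intro nn_integral_cong)
  also have "\<dots> = (SUP i. \<integral>\<^sup>+x. U i x \<partial>L)"
    using \<open>incseq U\<close> by (intro nn_integral_monotone_convergence_SUP) auto
  finally have sup: "integral\<^sup>N L h = (SUP i. \<integral>\<^sup>+x. U i x \<partial>L)" .
  have "\<exists>i\<in>UNIV. integral\<^sup>N L h < integral\<^sup>N L (U i) + ennreal (e / 2)"
    using seq.prems(2) fin by (intro SUP_approx_ennreal sup) auto
  then obtain i where i: "integral\<^sup>N L h \<le> integral\<^sup>N L (U i) + ennreal (e / 2)"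
    by (auto intro: less_imp_le)
  have finU: "integral\<^sup>N L (U i) < \<infinity>"
    using fin Uh by (meson le_less_trans nn_integral_mono)
  have diff: "(\<integral>\<^sup>+x. h x - U i x \<partial>L) \<le> ennreal (e / 2)"
  proof -
    have "(\<integral>\<^sup>+x. h x - U i x \<partial>L) = integral\<^sup>N L h - integral\<^sup>N L (U i)"
      using finU Uh by (intro nn_integral_diff) auto
    then show ?thesis using i fin by (auto simp: ennreal_minus_le_iff add.commute)
  qed
  obtain n0 where n0: "\<And>n. n \<ge> n0 \<Longrightarrow> ?I n (U i) \<le>
       ennreal (K * m A) * integral\<^sup>N L (U i) + ennreal (e / 2)"
    using seq.IH[OF finU, of "e / 2"] seq.prems by auto
  have "?I n h \<le>
       ennreal (K * m A) * integral\<^sup>N L h + ennreal e" if "n \<ge> n0" for n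
  proof -
    have "?I n h \<le> (\<integral>\<^sup>+x. U i x * indicator (pre n A) x + (h x - U i x) \<partial>L)"
    proof (intro nn_integral_mono)
      fix x
      have "h x = U i x + (h x - U i x)" using Uh[of i x] by (simp add: add_diff_inverse_ennreal)
      then show "h x * indicator (pre n A) x \<le> U i x * indicator (pre n A) x + (h x - U i x)"
        by (auto simp: indicator_def)
    qed
    also have "\<dots> = ?I n (U i) + (\<integral>\<^sup>+x. h x - U i x \<partial>L)"
      using A by (intro nn_integral_add) auto
    also have "\<dots> \<le> (ennreal (K * m A) * integral\<^sup>N L (U i) + ennreal (e / 2)) + ennreal (e / 2)"
      by (intro add_mono n0 that diff)
    also have "\<dots> \<le> (ennreal (K * m A) * integral\<^sup>N L h + ennreal (e / 2)) + ennreal (e / 2)"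
      using Uh by (intro add_mono mult_left_mono nn_integral_mono) auto
    also have "\<dots> = ennreal (K * m A) * integral\<^sup>N L h + (ennreal (e / 2) + ennreal (e / 2))"
      by (simp add: add_ac)
    also have "ennreal (e / 2) + ennreal (e / 2) = ennreal e"
      using seq.prems by (simp flip: ennreal_plus)
    finally show ?thesis .
  qed
  then show ?case unfolding h[symmetric] by blast
qed

lemma mu_density:
  obtains h where "h \<in> borel_measurable L" "density L h = \<mu>"
  using Radon_Nikodym[OF mu_ac mu_sets] by blast

text \<open>
  An invariant measure gives \<open>A\<close> the same mass as all its preimages. For a density that is merely
  integrable the masses of the preimages are asymptotically at most \<open>K * m A\<close>, so this bound holds for
  \<open>A\<close> itself: invariance makes the density bounded.
\<close>

lemma mu_bound:
  assumes A: "A \<in> sets L" shows "p A \<le> K * m A"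
proof (rule field_le_epsilon)
  fix e :: real assume e: "0 < e"
  obtain h where h[measurable]: "h \<in> borel_measurable L" and d: "density L h = \<mu>" by (rule mu_density)
  have "(\<integral>\<^sup>+x. h x \<partial>L) = emeasure \<mu> (space L)"
    unfolding d[symmetric] by (simp add: emeasure_density cong: nn_integral_cong)
  then have int: "(\<integral>\<^sup>+x. h x \<partial>L) = 1" using mu.emeasure_space_1 mu_space by simp
  then obtain n where "(\<integral>\<^sup>+x. h x * indicator (pre n A) x \<partial>L) \<le>
       ennreal (K * m A) * (\<integral>\<^sup>+x. h x \<partial>L) + ennreal e"
    using mixing_upper_density[OF h A _ e] by auto
  also have "(\<integral>\<^sup>+x. h x * indicator (pre n A) x \<partial>L) = emeasure \<mu> (pre n A)"
    unfolding d[symmetric] using A by (simp add: emeasure_density)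
  also have "\<dots> = ennreal (p A)" using mu_pre[OF A, of n] by (simp add: mu.emeasure_eq_measure)
  also have "ennreal (K * m A) * (\<integral>\<^sup>+x. h x \<partial>L) + ennreal e = ennreal (K * m A + e)"
    using int e K_pos by (simp add: ennreal_plus)
  finally show "p A \<le> K * m A + e" using K_pos e by (simp add: ennreal_le_iff flip: ennreal_plus)
qed


text \<open>
  The measure \<open>L\<close> may also charge transient partition elements; \<open>\<mu>\<close> does not see these, and they
  need not be reachable from a base state.
\<close>

definition charged :: "nat set" where "charged = {i. 0 < p (P i)}"
definition charged_part :: "'a set" where "charged_part = (\<Union>i\<in>charged. P i)"

lemma p_null: "N \<in> null_sets L \<Longrightarrow> p N = 0"
  using mu_ac unfolding absolutely_continuous_def by (auto simp: measure_eq_0_null_sets)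

lemma charged_part_sets [measurable]: "charged_part \<in> sets L"
  unfolding charged_part_def by (intro sets.countable_UN'' countableI_type P_sets)

lemma charged_part_space: "charged_part \<subseteq> space L"
  using sets.sets_into_space[OF charged_part_sets] .

lemma p_charged_part: "p charged_part = 1"
proof -
  have "p (\<Union>i\<in>-charged. P i) = 0"
  proof -
    have "P i \<in> null_sets \<mu>" if "i \<in> -charged" for i
    proof -
      have "p (P i) = 0" using that unfolding charged_def by (simp add: zero_less_measure_iff)
      then show ?thesis using mu_sets by (simp add: null_sets_def mu.emeasure_eq_measure)
    qed
    then have "(\<Union>i\<in>-charged. P i) \<in> null_sets \<mu>" by (intro null_sets_UN') auto
    then show ?thesis by (simp add: measure_eq_0_null_sets)
  qed
  moreover have "p (space L - (\<Union>i. P i)) = 0" by (rule p_null[OF P_cover])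
  moreover have "(\<Union>i\<in>-charged. P i) \<in> sets L" "space L - (\<Union>i. P i) \<in> sets L"
    by (intro sets.countable_UN'' countableI_type P_sets) (intro sets.Diff sets.top sets.countable_UN'' countableI_type P_sets)
  moreover have "space \<mu> = charged_part \<union> (\<Union>i\<in>-charged. P i) \<union> (space L - (\<Union>i. P i))"
    using P_space charged_part_space by (auto simp: mu_space charged_part_def)
  ultimately have "p (space \<mu>) \<le> p charged_part + 0 + 0"
    using measure_Un_le[of "charged_part \<union> (\<Union>i\<in>-charged. P i)" \<mu> "space L - (\<Union>i. P i)"]
      measure_Un_le[of charged_part \<mu> "\<Union>i\<in>-charged. P i"] charged_part_sets mu_sets by simp
  then show ?thesis using mu.prob_space mu.prob_le_1[of charged_part] by simp
qed

lemma charged_nonempty: "charged \<noteq> {}"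
  using p_charged_part by (auto simp: charged_part_def)

lemma determined_charged_part: "determined 1 charged_part"
  unfolding determined_def
proof (intro conjI allI impI)
  fix w :: "nat list" assume "length w = 1"
  then obtain i where w: "w = [i]" by (cases w) auto
  show "cyl w \<subseteq> charged_part \<or> cyl w \<inter> charged_part = {}"
  proof (cases "i \<in> charged")
    case False
    then have "P i \<inter> P j = {}" if "j \<in> charged" for j
      using that disjoint_family_onD[OF P_disj, of i j] by auto
    then show ?thesis unfolding w cyl_single charged_part_def by blast
  qed (auto simp: w cyl_single charged_part_def)
qed (rule charged_part_sets)

lemma determined_P: "determined 1 (P i)"
  using determined_cyl[of "[i]"] by (simp add: cyl_single)

lemma last_word:
  assumes "x \<in> cyl w" "length w = Suc n" "(T ^^ n) x \<in> P i" shows "last w = i"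
proof -
  have "(T ^^ n) x \<in> P (w ! n)" using assms by (simp add: cyl_def)
  then have "w ! n = i" using assms(3) P_disj unfolding disjoint_family_on_def by blast
  moreover have "last w = w ! n" using assms(2) last_conv_nth[of w] by (cases w) auto
  ultimately show ?thesis by simp
qed

text \<open>
  A transition from a charged \<open>i\<close> to \<open>j\<close> carries mass of \<open>\<mu>\<close>, although \<open>\<mu>\<close> may be concentrated on a small
  part of \<open>P i\<close>. Let \<open>E\<close> be the set where the density is positive. At time \<open>n\<close> a fixed portion of \<open>E\<close>
  sits in \<open>P i\<close>; for large \<open>n\<close> it nearly fills the cylinders of length \<open>n + 1\<close> that it meets, and a fixed
  proportion of each of these moves on to \<open>P j\<close>. So a positive part of \<open>E\<close> visits \<open>P j\<close>.
\<close>

lemma charged_closed: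
  assumes i: "i \<in> charged" and j: "0 < m (P j \<inter> G i)" shows "j \<in> charged"
proof (rule ccontr)
  assume "j \<notin> charged"
  then have pj: "p (P j) = 0" by (simp add: charged_def zero_less_measure_iff)
  obtain h where h[measurable]: "h \<in> borel_measurable L" and d: "density L h = \<mu>" by (rule mu_density)
  define E where "E = {x \<in> space L. 0 < h x}"
  have E[measurable]: "E \<in> sets L" unfolding E_def by measurable
  have null: "m (E \<inter> Z) = 0" if "p Z = 0" and Z: "Z \<in> sets L" for Z
  proof -
    have "Z \<in> null_sets (density L h)"
      unfolding d using that mu_sets by (simp add: null_sets_def mu.emeasure_eq_measure)
    then have "AE x in L. x \<in> Z \<longrightarrow> h x = 0" using Z by (simp add: null_sets_density_iff)
    then have "AE x in L. x \<notin> E \<inter> Z" by eventually_elim (auto simp: E_def)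
    then have "E \<inter> Z \<in> null_sets L" using Z by (subst (asm) AE_iff_null_sets[symmetric]) auto
    then show ?thesis by (simp add: measure_eq_0_null_sets)
  qed
  have pE: "p (A \<inter> E) = p A" if A: "A \<in> sets L" for A
  proof -
    have "A - E \<in> null_sets (density L h)"
      using A sets.sets_into_space[OF A] by (subst null_sets_density_iff) (auto simp: E_def)
    then have "p (A - E) = 0" unfolding d by (simp add: measure_eq_0_null_sets)
    then show ?thesis using A mu.finite_measure_Diff'[of A E] by (simp add: mu_sets)
  qed
  define a where "a = m (P j \<inter> G i)"
  define c where "c = a / K"
  define d where "d = p (P i) / K"
  have pos: "0 < a" "0 < c" "0 < d" using i j K_pos by (auto simp: a_def c_def d_def charged_def)
  \<comment> \<open>solves \<open>c * (d - e) = e\<close>, where the two estimates below collide\<close>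
  define e where "e = c * d / (1 + c)"
  have e: "0 < e" using pos by (simp add: e_def)
  have ce: "c * (d - e) = e" using pos by (simp add: e_def field_simps)
  obtain n0 where n0: "\<And>n. n \<ge> n0 \<Longrightarrow> \<exists>W. (\<forall>w\<in>W. length w = n) \<and>
      m (E - (\<Union>w\<in>W. cyl w)) < e \<and> m ((\<Union>w\<in>W. cyl w) - E) < e"
    using approx[OF E e] by blast
  define n where "n = n0"
  obtain W where W: "\<And>w. w \<in> W \<Longrightarrow> length w = Suc n" and
      W1: "m (E - (\<Union>w\<in>W. cyl w)) < e" and W2: "m ((\<Union>w\<in>W. cyl w) - E) < e"
    using n0[of "Suc n"] by (auto simp: n_def)
  define U where "U = (\<Union>w\<in>W. cyl w)"
  have detU: "determined (Suc n) U" unfolding U_def using W by (rule determined_UN_cyl)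
  then have Us[measurable]: "U \<in> sets L" by (rule determined_sets)
  have detV: "determined (Suc n) (U \<inter> pre n (P i))"
    using determined_Int[OF detU] determined_pre[OF determined_P, of n i] by simp
  have "a * m ((U \<inter> pre n (P i)) \<inter> space L) \<le> K * m ((U \<inter> pre n (P i)) \<inter> pre (Suc n) (P j))"
  proof (rule determined_sum_mono[OF detV])
    fix w :: "nat list" assume w: "length w = Suc n" "cyl w \<subseteq> U \<inter> pre n (P i)"
    show "a * m (cyl w \<inter> space L) \<le> K * m (cyl w \<inter> pre (Suc n) (P j))"
    proof (cases "cyl w = {}")
      case False
      then obtain x where "x \<in> cyl w" by blast
      then have "last w = i" using w by (intro last_word[of x w n i]) (auto simp: pre_def)
      moreover have "w \<noteq> []" using w by auto
      ultimately show ?thesis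
        using low[of w "P j"] w cyl_space[of w] by (simp add: a_def Int_absorb2 mult.commute)
    qed simp
  qed (use pos K_pos in auto)
  also have "m ((U \<inter> pre n (P i)) \<inter> pre (Suc n) (P j)) \<le> m ((U - E) \<union> (E \<inter> pre (Suc n) (P j)))"
    by (intro finite_measure_mono) auto
  also have "\<dots> \<le> m (U - E) + m (E \<inter> pre (Suc n) (P j))"
    by (intro measure_subadditive) auto
  also have "m (E \<inter> pre (Suc n) (P j)) = 0"
    using mu_pre[of "P j" "Suc n"] pj by (intro null) auto
  also have "m (U - E) + 0 < e" using W2 by (simp add: U_def)
  finally have 1: "a * m ((U \<inter> pre n (P i)) \<inter> space L) < K * e" using K_pos by simp
  have "p (P i) = p (pre n (P i) \<inter> E)" using pE[of "pre n (P i)"] mu_pre[of "P i" n] by simp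
  also have "\<dots> \<le> K * m (pre n (P i) \<inter> E)" by (intro mu_bound) auto
  finally have "d \<le> m (pre n (P i) \<inter> E)" using K_pos by (simp add: d_def field_simps)
  also have "\<dots> \<le> m (((U \<inter> pre n (P i)) \<inter> space L) \<union> (E - U))"
    by (intro finite_measure_mono) (auto simp: pre_def)
  also have "\<dots> \<le> m ((U \<inter> pre n (P i)) \<inter> space L) + m (E - U)"
    by (intro measure_subadditive) auto
  finally have "d - e < m ((U \<inter> pre n (P i)) \<inter> space L)" using W1 by (simp add: U_def)
  then have "a * (d - e) < K * e" using 1 pos by (smt (verit) mult_strict_left_mono)
  then have "c * (d - e) < e" using K_pos by (simp add: c_def field_simps)
  then show False using ce by simp
qed

lemma last_charged:
  "w \<noteq> [] \<Longrightarrow> cyl w \<subseteq> charged_part \<Longrightarrow> 0 < m (cyl w) \<Longrightarrow> last w \<in> charged"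
proof (induction w rule: rev_induct)
  case (snoc j u)
  show ?case
  proof (cases "u = []")
    case True
    then have sub: "P j \<subseteq> charged_part" "P j \<noteq> {}" using snoc.prems by (auto simp: cyl_single)
    then obtain i where "i \<in> charged" "P j \<inter> P i \<noteq> {}" by (auto simp: charged_part_def)
    then have "i = j" using P_disj by (auto simp: disjoint_family_on_def)
    then show ?thesis using \<open>i \<in> charged\<close> by simp
  next
    case False
    have u: "determined 1 charged_part" by (rule determined_charged_part)
    have eq: "cyl (u @ [j]) = cyl u \<inter> pre (length u) (P j)" by (simp add: cyl_append cyl_single)
    then have "m (cyl (u @ [j])) \<le> m (cyl u)" by (intro finite_measure_mono) auto
    then have pos: "0 < m (cyl u)" using snoc.prems by simp
    have "determined (length u) charged_part" using False by (intro determined_mono[OF u]) (cases u, auto)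
    then have "cyl u \<subseteq> charged_part \<or> cyl u \<inter> charged_part = {}" by (auto simp: determined_def)
    moreover have "cyl (u @ [j]) \<noteq> {}" using snoc.prems by auto
    ultimately have "cyl u \<subseteq> charged_part" using snoc.prems(2) eq by blast
    then have i: "last u \<in> charged" using snoc.IH False pos by simp
    have "m (cyl (u @ [j])) \<le> K * m (cyl u) * m (P j \<inter> G (last u))"
      unfolding eq using False by (rule up) simp
    then have "m (P j \<inter> G (last u)) \<noteq> 0" using snoc.prems by auto
    then have "0 < m (P j \<inter> G (last u))" by (simp add: zero_less_measure_iff)
    then show ?thesis using charged_closed[OF i] by simp
  qed
qed simp

text \<open>
  By ergodicity almost every point, in particular some point of \<open>P i\<close>, visits \<open>P j\<close>.
\<close>

lemma charged_path:
  assumes "i \<in> charged" "j \<in> charged" obtains v where "v \<noteq> []" "cyl v \<subseteq> P i" "last v = j" "0 < m (cyl v)"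
proof -
  define H where "H = (\<Union>n. pre n (P j))"
  have Hs: "H \<in> sets L" unfolding H_def by (intro sets.countable_UN'' countableI_type pre_sets P_sets)
  have "pre 1 H \<subseteq> H"
  proof
    fix x assume "x \<in> pre 1 H"
    then obtain n where "x \<in> pre 1 (pre n (P j))" by (auto simp: H_def pre_def)
    then show "x \<in> H" unfolding pre_pre H_def by blast
  qed
  moreover have "0 < p H"
  proof -
    have "p (P j) \<le> p H" using Hs mu_sets pre_0[OF P_sets, of j]
      by (intro mu.finite_measure_mono) (auto simp: H_def)
    then show ?thesis using assms by (simp add: charged_def)
  qed
  ultimately have "p H = 1" using mu_erg Hs by blast
  then have "p (P i \<inter> H) = p (P i)"
    using mu.prob_space Hs mu_sets by (intro mu.measure_space_inter) auto
  then have pos: "0 < p (P i \<inter> H)" using assms by (simp add: charged_def)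
  have "\<exists>n. 0 < p (P i \<inter> pre n (P j))"
  proof (rule ccontr)
    assume "\<not> ?thesis"
    then have "p (P i \<inter> pre n (P j)) = 0" for n by (simp add: zero_less_measure_iff)
    then have "P i \<inter> pre n (P j) \<in> null_sets \<mu>" for n
      using mu_sets by (simp add: null_sets_def mu.emeasure_eq_measure)
    then have "(\<Union>n. P i \<inter> pre n (P j)) \<in> null_sets \<mu>" by (intro null_sets_UN)
    moreover have "(\<Union>n. P i \<inter> pre n (P j)) = P i \<inter> H" by (auto simp: H_def)
    ultimately have "p (P i \<inter> H) = 0" by (simp add: measure_eq_0_null_sets)
    then show False using pos by simp
  qed
  then obtain n where n: "0 < p (P i \<inter> pre n (P j))" ..
  let ?A = "P i \<inter> pre n (P j)"
  have "p ?A \<le> K * m ?A" by (intro mu_bound) auto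
  then have mpos: "0 < m ?A" using n by (cases "m ?A = 0") (simp_all add: zero_less_measure_iff)
  have det: "determined (Suc n) ?A"
    using determined_Int determined_mono[OF determined_P] determined_pre[OF determined_P, of n j] by simp
  have "\<exists>v. length v = Suc n \<and> cyl v \<subseteq> ?A \<and> 0 < m (cyl v)"
  proof (rule ccontr)
    assume neg: "\<not> ?thesis"
    have "1 * m (?A \<inter> space L) \<le> 0 * m (?A \<inter> space L)"
    proof (rule determined_sum_mono[OF det])
      fix w :: "nat list" assume "length w = Suc n" "cyl w \<subseteq> ?A"
      then have "m (cyl w) = 0" using neg by (auto simp: zero_less_measure_iff)
      then show "1 * m (cyl w \<inter> space L) \<le> 0 * m (cyl w \<inter> space L)" using cyl_space[of w]
        by (simp add: Int_absorb2)
    qed auto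
    moreover have "?A \<inter> space L = ?A" by (auto simp: pre_def)
    ultimately show False using mpos by simp
  qed
  then obtain v where v: "length v = Suc n" "cyl v \<subseteq> ?A" "0 < m (cyl v)" by blast
  then obtain x where x: "x \<in> cyl v" by fastforce
  then have "last v = j" using v by (intro last_word[of x v n]) (auto simp: pre_def)
  moreover have "v \<noteq> []" using v(1) by auto
  ultimately show ?thesis using v that by blast
qed

section \<open>Hitting times\<close>

text \<open>
  After any charged cylinder the orbit is distributed over an image \<open>G (last w)\<close>, which contains some
  \<open>P j\<close> with \<open>j \<in> F\<close>. So it is enough to find, in these finitely many elements, a set \<open>A\<close> of points
  that hit \<open>B\<close> within \<open>N\<close> steps.
\<close>

lemma miss_word:
  assumes a: "0 \<le> a" and Bs: "B \<in> sets L" and w: "w \<noteq> []" "cyl w \<subseteq> charged_part"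
    and A: "\<And>j. j \<in> F \<inter> charged \<Longrightarrow> \<exists>A\<in>sets L. A \<subseteq> P j \<and> A \<inter> miss B N = {} \<and> K * a \<le> m A"
  shows "m (cyl w \<inter> pre (length w) (miss B N)) \<le> (1 - a) * m (cyl w)"
proof (cases "m (cyl w) = 0")
  case True
  have "m (cyl w \<inter> pre (length w) (miss B N)) \<le> m (cyl w)" by (intro finite_measure_mono) auto
  then show ?thesis using True by simp
next
  case False
  then have i: "last w \<in> charged" using last_charged[OF w] by (simp add: zero_less_measure_iff)
  obtain j where j: "j \<in> F" "0 < m (P j)" "m (P j - G (last w)) = 0" using F_big by blast
  have "m (P j \<inter> G (last w)) = m (P j)"
    using j(3) finite_measure_Diff'[of "P j" "G (last w)"] by simp
  then have "j \<in> charged" using charged_closed[OF i, of j] j(2) by simp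
  then obtain A where As: "A \<in> sets L" and A': "A \<subseteq> P j" "A \<inter> miss B N = {}" "K * a \<le> m A"
    using A j(1) by blast
  have "m (A - G (last w)) \<le> m (P j - G (last w))" using A' by (intro finite_measure_mono) auto
  then have "m (A \<inter> G (last w)) = m A"
    using j(3) finite_measure_Diff'[of A "G (last w)"] As measure_nonneg[of L "A - G (last w)"] by simp
  then have "m (cyl w) * m A \<le> K * m (cyl w \<inter> pre (length w) A)"
    using low[OF w(1) As] by simp
  moreover have "m (cyl w) * (K * a) \<le> m (cyl w) * m A" using A'(3) by (intro mult_left_mono) auto
  ultimately have "K * (m (cyl w) * a) \<le> K * m (cyl w \<inter> pre (length w) A)" by (simp add: mult_ac)
  then have 1: "m (cyl w) * a \<le> m (cyl w \<inter> pre (length w) A)" using K_pos by simp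
  have "m (cyl w \<inter> pre (length w) (miss B N)) \<le> m (cyl w - (cyl w \<inter> pre (length w) A))"
    using A' As by (intro finite_measure_mono) (auto simp: pre_def)
  also have "\<dots> = m (cyl w) - m (cyl w \<inter> pre (length w) A)"
    using As by (intro finite_measure_Diff) auto
  finally show ?thesis using 1 by (simp add: algebra_simps)
qed


text \<open>
  A charged symbol \<open>z\<close> is fixed as base state. Since \<open>F\<close> is finite, one bound on the length and one on the
  measure serve for all the words that lead from \<open>F\<close> to \<open>z\<close>.
\<close>

lemma base_state:
  obtains z a N where "z \<in> charged" "0 < a"
    "\<forall>j\<in>F \<inter> charged. \<exists>v. v \<noteq> [] \<and> cyl v \<subseteq> P j \<and> last v = z \<and> a \<le> m (cyl v) \<and> length v \<le> N"
proof -
  obtain z where z: "z \<in> charged" using charged_nonempty by blast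
  have "\<forall>j\<in>F \<inter> charged. \<exists>v. v \<noteq> [] \<and> cyl v \<subseteq> P j \<and> last v = z \<and> 0 < m (cyl v)"
    using charged_path[OF _ z] by (metis IntD2)
  then obtain v where v: "\<And>j. j \<in> F \<inter> charged \<Longrightarrow> v j \<noteq> [] \<and> cyl (v j) \<subseteq> P j \<and> last (v j) = z \<and> 0 < m (cyl (v j))"
    by metis
  define a where "a = Min (insert 1 ((\<lambda>j. m (cyl (v j))) ` (F \<inter> charged)))"
  define N where "N = Max (insert 0 ((\<lambda>j. length (v j)) ` (F \<inter> charged)))"
  have "0 < a" unfolding a_def using v F_finite by (subst Min_gr_iff) auto
  moreover have "a \<le> m (cyl (v j))" "length (v j) \<le> N" if "j \<in> F \<inter> charged" for j
    using that F_finite by (auto simp: a_def N_def)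
  ultimately show ?thesis using that[OF z, of a N] v by meson
qed

text \<open>
  The \<open>N\<close>-th preimage of \<open>B\<close> is split according to the first visit to the base state. After such a visit
  at time \<open>n\<close> the past is forgotten up to the factor \<open>K\<close>, and there remain \<open>N - n - 1\<close> steps from \<open>G z\<close>
  to \<open>B\<close>. Read backwards, this turns the stationary mass \<open>p B\<close> into a lower bound for the
  probability to reach \<open>B\<close> from the base state in one suitable number of steps. That number may
  depend on \<open>B\<close>, so that periodic systems are covered as well.
\<close>

lemma base_decomposition:
  assumes B: "B \<in> sets L" and X0: "0 \<le> X" and X: "\<And>k. k < N \<Longrightarrow> m (pre k B \<inter> G z) \<le> X"
  shows "p B \<le> K * (m (charged_part \<inter> miss (P z) N) + K * X * m (space L))"
proof -
  define V where "V n = miss (P z) n \<inter> pre n (P z)" for n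
  have Vs [measurable]: "V n \<in> sets L" for n unfolding V_def by measurable
  have V_disj: "disjoint_family V"
    unfolding disjoint_family_on_def
  proof (intro ballI impI)
    fix k n :: nat assume "k \<noteq> n"
    then consider "k < n" | "n < k" by linarith
    then show "V k \<inter> V n = {}" by cases (auto simp: V_def miss_def pre_def)
  qed
  have detV: "determined (Suc n) (V n)" for n
    using determined_Int[OF determined_miss[OF determined_P order_refl, of n z] determined_pre[OF determined_P, of n z]]
    by (simp add: V_def)
  have Vn: "m (V n \<inter> pre N B) \<le> K * X * m (V n)" if n: "n < N" for n
  proof -
    have "1 * m (V n \<inter> pre N B) \<le> (K * X) * m (V n \<inter> space L)"
    proof (rule determined_sum_mono[OF detV])
      fix w :: "nat list" assume w: "length w = Suc n" "cyl w \<subseteq> V n"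
      show "1 * m (cyl w \<inter> pre N B) \<le> (K * X) * m (cyl w \<inter> space L)"
      proof (cases "cyl w = {}")
        case False
        then obtain x where "x \<in> cyl w" by blast
        then have last: "last w = z" using w by (intro last_word[of x w n z]) (auto simp: V_def pre_def)
        have "w \<noteq> []" using w by auto
        then have "m (cyl w \<inter> pre (length w) (pre (N - Suc n) B)) \<le> K * m (cyl w) * m (pre (N - Suc n) B \<inter> G (last w))"
          using B by (intro up) auto
        also have "pre (length w) (pre (N - Suc n) B) = pre N B" using w n by (simp add: pre_pre)
        also have "K * m (cyl w) * m (pre (N - Suc n) B \<inter> G (last w)) \<le> K * m (cyl w) * X"
          unfolding last using K_pos n by (intro mult_left_mono X) auto
        finally show ?thesis using cyl_space[of w] by (simp add: Int_absorb2 mult_ac)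
      qed simp
    qed (use B X0 K_pos in auto)
    moreover have "V n \<inter> space L = V n" by (auto simp: V_def miss_def)
    ultimately show ?thesis by simp
  qed
  have sumV: "(\<Sum>n<N. m (V n)) \<le> m (space L)"
  proof -
    have "(\<Sum>n<N. m (V n)) = m (\<Union>n<N. V n)"
      using V_disj by (intro finite_measure_finite_Union[symmetric]) (auto simp: disjoint_family_on_def)
    then show ?thesis by (simp add: bounded_measure)
  qed
  have "p B = p (pre N B)" using mu_pre[OF B] by simp
  also have "\<dots> = p (pre N B \<inter> charged_part)"
    using B p_charged_part mu_sets mu.prob_space by (intro mu.measure_space_inter[symmetric]) auto
  also have "\<dots> \<le> K * m (pre N B \<inter> charged_part)" using B by (intro mu_bound) auto
  also have "m (pre N B \<inter> charged_part) \<le> m ((charged_part \<inter> miss (P z) N) \<union> (\<Union>n<N. V n \<inter> pre N B))"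
  proof (intro finite_measure_mono)
    show "pre N B \<inter> charged_part \<subseteq> (charged_part \<inter> miss (P z) N) \<union> (\<Union>n<N. V n \<inter> pre N B)"
    proof
      fix x assume x: "x \<in> pre N B \<inter> charged_part"
      then have xs: "x \<in> space L" by (auto simp: pre_def)
      show "x \<in> (charged_part \<inter> miss (P z) N) \<union> (\<Union>n<N. V n \<inter> pre N B)"
      proof (cases "x \<in> miss (P z) N")
        case False
        then have ex: "\<exists>n. n < N \<and> (T ^^ n) x \<in> P z" using xs by (auto simp: miss_def)
        define n where "n = (LEAST n. n < N \<and> (T ^^ n) x \<in> P z)"
        have n: "n < N \<and> (T ^^ n) x \<in> P z" unfolding n_def using ex by (rule LeastI_ex)
        have "(T ^^ k) x \<notin> P z" if "k < n" for k
          using not_less_Least[of k "\<lambda>n. n < N \<and> (T ^^ n) x \<in> P z"] that n unfolding n_def by auto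
        then have "x \<in> V n" using n xs by (auto simp: V_def miss_def pre_def)
        then show ?thesis using n x by blast
      qed (use x in auto)
    qed
  qed (use B in auto)
  also have "\<dots> \<le> m (charged_part \<inter> miss (P z) N) + m (\<Union>n<N. V n \<inter> pre N B)"
    using B by (intro measure_Un_le) auto
  also have "m (\<Union>n<N. V n \<inter> pre N B) \<le> (\<Sum>n<N. m (V n \<inter> pre N B))"
    using B by (intro measure_UNION_le) auto
  also have "\<dots> \<le> (\<Sum>n<N. K * X * m (V n))" by (intro sum_mono Vn) auto
  also have "\<dots> = K * X * (\<Sum>n<N. m (V n))" by (simp add: sum_distrib_left)
  also have "\<dots> \<le> K * X * m (space L)" using K_pos X0 sumV by (intro mult_left_mono) auto
  finally show ?thesis using K_pos by simp
qed

lemma space_pos: "0 < m (space L)"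
proof -
  have "1 \<le> K * m (space L)" using mu_bound[of "space L"] mu.prob_space mu_space by simp
  then show ?thesis using K_pos by (smt (verit) mult_nonneg_nonpos)
qed

text \<open>
  Visits to the base state have geometrically decaying waiting times. Hence, by
  \<open>base_decomposition\<close> with \<open>N\<close> of order \<open>ln (1 / b)\<close>, the set \<open>B\<close> is reached from the base state within
  \<open>N\<close> steps with probability at least a constant times \<open>b\<close>. Combined with the bounded time needed to
  get to the base state, every block of about \<open>q + ln (1 / b)\<close> steps is an attempt to hit \<open>B\<close> with success
  probability at least a constant times \<open>b\<close>.
\<close>

theorem hitting_time_tail:
  obtains C c where "0 < C" "0 < c"
    "\<And>B q b k. determined q B \<Longrightarrow> 1 \<le> q \<Longrightarrow> 0 < b \<Longrightarrow> b \<le> p B \<Longrightarrow>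
       p (miss B k) \<le> C * exp (- (c * b * real k / (real q + 1 + ln (1 / b))))"
proof -
  obtain z a1 N1 where z: "z \<in> charged" and a1: "0 < a1" and v:
    "\<forall>j\<in>F \<inter> charged. \<exists>v. v \<noteq> [] \<and> cyl v \<subseteq> P j \<and> last v = z \<and> a1 \<le> m (cyl v) \<and> length v \<le> N1"
    by (rule base_state)
  define M where "M = m (space L)"
  have M: "0 < M" using space_pos by (simp add: M_def)
  define e0 where "e0 = min 1 (a1 / K)"
  have e0: "0 < e0" "e0 \<le> 1" "K * e0 \<le> a1" using a1 K_pos by (auto simp: e0_def min_def field_simps)
  define L0 where "L0 = 1 + N1"
  have decay0: "m (charged_part \<inter> miss (P z) (k * L0)) \<le> (1 - e0) ^ k * M" for k
    unfolding M_def L0_def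
  proof (rule miss_decay[OF determined_P _ determined_charged_part])
    fix w :: "nat list" assume w: "w \<noteq> []" "cyl w \<subseteq> charged_part"
    show "m (cyl w \<inter> pre (length w) (miss (P z) N1)) \<le> (1 - e0) * m (cyl w)"
    proof (rule miss_word[OF _ _ w])
      fix j assume "j \<in> F \<inter> charged"
      then obtain v where v: "v \<noteq> []" "cyl v \<subseteq> P j" "last v = z" "a1 \<le> m (cyl v)" "length v \<le> N1"
        using v by blast
      have "cyl v \<inter> miss (P z) N1 = {}"
      proof -
        have l: "length v - 1 < length v" using v(1) by simp
        have "(T ^^ (length v - 1)) x \<in> P z" if "x \<in> cyl v" for x
          using that v(1,3) l by (auto simp: cyl_def last_conv_nth)
        then show ?thesis using l v(5) unfolding miss_def by fastforce
      qed
      then show "\<exists>A\<in>sets L. A \<subseteq> P j \<and> A \<inter> miss (P z) N1 = {} \<and> K * e0 \<le> m A"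
        using v e0 by (intro bexI[of _ "cyl v"]) auto
    qed (use e0 in auto)
  qed (use e0 in auto)
  \<comment> \<open>makes \<open>K * (K * (c * b))\<close> at most \<open>a1 * X\<close> for the threshold \<open>X\<close> below\<close>
  define c where "c = min 1 (a1 / (4 * K ^ 4 * M))"
  have c: "0 < c" "c \<le> 1" using a1 K_pos M by (auto simp: c_def)
  have c': "c * (4 * K ^ 4 * M) \<le> a1"
    using a1 K_pos M by (auto simp: c_def min_def field_simps)
  define C1 where "C1 = real N1 + 1 + real L0 * (1 + (\<bar>ln (2 * K * M)\<bar> + 1) / e0)"
  have C1: "1 \<le> C1" using e0 by (simp add: C1_def)
  have main: "p (miss B k) \<le> (K * M * exp 1) * exp (- ((c / C1) * b * real k / (real q + 1 + ln (1 / b))))"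
    if B: "determined q B" and q: "1 \<le> q" and b: "0 < b" "b \<le> p B" for B q b k
  proof -
    have Bs [measurable]: "B \<in> sets L" using B by (rule determined_sets)
    have b1: "b \<le> 1" by (rule order_trans[OF b(2)]) simp
    \<comment> \<open>so many attempts make the first term of \<open>base_decomposition\<close> at most \<open>b / 2\<close>\<close>
    define kb where "kb = nat \<lceil>ln (2 * K * M / b) / e0\<rceil>"
    define N where "N = kb * L0"
    have "m (charged_part \<inter> miss (P z) N) \<le> (1 - e0) ^ kb * M" unfolding N_def by (rule decay0)
    also have "(1 - e0) ^ kb \<le> exp (- e0) ^ kb"
      using e0 exp_ge_add_one_self[of "- e0"] by (intro power_mono) auto
    also have "\<dots> = exp (- (e0 * real kb))" by (simp add: exp_of_nat_mult[symmetric] mult.commute)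
    also have "\<dots> \<le> exp (- ln (2 * K * M / b))"
    proof -
      have "ln (2 * K * M / b) / e0 \<le> real kb" unfolding kb_def by linarith
      then have "ln (2 * K * M / b) \<le> e0 * real kb" using e0 by (simp add: field_simps)
      then show ?thesis by simp
    qed
    also have "\<dots> = b / (2 * K * M)" using K_pos M b by (simp add: exp_minus)
    finally have "m (charged_part \<inter> miss (P z) N) \<le> b / (2 * K)" using M by (simp add: field_simps)
    then have small: "K * m (charged_part \<inter> miss (P z) N) \<le> b / 2" using K_pos by (simp add: field_simps)
    \<comment> \<open>the second term of \<open>base_decomposition\<close> is then \<open>b / 4\<close>\<close>
    define X where "X = b / (4 * K ^ 2 * M)"
    have X: "0 < X" using b K_pos M by (simp add: X_def)
    have "\<exists>l<N. X < m (pre l B \<inter> G z)"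
    proof (rule ccontr)
      assume "\<not> ?thesis"
      then have "m (pre l B \<inter> G z) \<le> X" if "l < N" for l using that not_less by blast
      then have "p B \<le> K * (m (charged_part \<inter> miss (P z) N) + K * X * m (space L))"
        using X by (intro base_decomposition) simp_all
      also have "\<dots> = K * m (charged_part \<inter> miss (P z) N) + b / 4"
        using K_pos M by (simp add: X_def M_def[symmetric] power2_eq_square field_simps)
      finally show False using small b by linarith
    qed
    then obtain l where l: "l < N" "X < m (pre l B \<inter> G z)" by blast
    define N' where "N' = N1 + N + 1"
    define e where "e = c * b"
    have e: "0 \<le> e" "e \<le> 1" using c b b1 by (auto simp: e_def mult_le_one)
    have Ke: "K * (K * e) \<le> a1 * X"
    proof -
      have "K * (K * e) = (c * (4 * K ^ 4 * M)) * X"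
        using K_pos M by (simp add: e_def X_def power2_eq_square power4_eq_xxxx field_simps)
      also have "\<dots> \<le> a1 * X" using c' X by (intro mult_right_mono) auto
      finally show ?thesis .
    qed
    have decay: "m (charged_part \<inter> miss B (k' * (q + N'))) \<le> (1 - e) ^ k' * m (space L)" for k'
    proof (rule miss_decay[OF B q determined_charged_part])
      fix w :: "nat list" assume w: "w \<noteq> []" "cyl w \<subseteq> charged_part"
      show "m (cyl w \<inter> pre (length w) (miss B N')) \<le> (1 - e) * m (cyl w)"
      proof (rule miss_word[OF _ _ w])
        fix j assume "j \<in> F \<inter> charged"
        then obtain v where v: "v \<noteq> []" "cyl v \<subseteq> P j" "last v = z" "a1 \<le> m (cyl v)" "length v \<le> N1"
          using v by blast
        let ?A = "cyl v \<inter> pre (length v) (pre l B)"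
        have "?A \<inter> miss B N' = {}"
          unfolding pre_pre using v(5) l by (auto simp: pre_def miss_def N'_def)
        moreover have "K * e \<le> m ?A"
        proof -
          have "K * (K * e) \<le> a1 * X" by (rule Ke)
          also have "\<dots> \<le> m (cyl v) * m (pre l B \<inter> G z)" using v(4) l X by (intro mult_mono) auto
          also have "\<dots> \<le> K * m ?A" using low[OF v(1), of "pre l B"] v(3) by simp
          finally show ?thesis using K_pos by simp
        qed
        ultimately show "\<exists>A\<in>sets L. A \<subseteq> P j \<and> A \<inter> miss B N' = {} \<and> K * e \<le> m A"
          using v by (intro bexI[of _ ?A]) auto
      qed (use e in auto)
    qed (use e in auto)
    define D where "D = q + N'"
    have D0: "0 < D" using q by (simp add: D_def)
    define k' where "k' = k div D"
    have "p (miss B k) = p (miss B k \<inter> charged_part)"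
      using p_charged_part mu_sets mu.prob_space by (intro mu.measure_space_inter[symmetric]) auto
    also have "\<dots> \<le> K * m (miss B k \<inter> charged_part)" by (intro mu_bound) auto
    also have "m (miss B k \<inter> charged_part) \<le> m (charged_part \<inter> miss B (k' * D))"
      using miss_antimono[of "k' * D" k B] by (intro finite_measure_mono) (auto simp: k'_def)
    also have "\<dots> \<le> (1 - e) ^ k' * M" using decay by (simp add: D_def M_def)
    also have "(1 - e) ^ k' \<le> exp (- e) ^ k'"
      using e exp_ge_add_one_self[of "- e"] by (intro power_mono) auto
    also have "\<dots> = exp (- (e * real k'))" by (simp add: exp_of_nat_mult[symmetric] mult.commute)
    also have "\<dots> \<le> exp (1 - e * real k / real D)"
    proof -
      have "real k / real D \<le> real k' + 1"
      proof -
        have "k = k' * D + k mod D" by (simp add: k'_def)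
        moreover have "k mod D < D" using D0 by simp
        ultimately have "k \<le> (k' + 1) * D" by simp
        then have "real k \<le> (real k' + 1) * real D" by (metis of_nat_1 of_nat_add of_nat_le_iff of_nat_mult)
        then show ?thesis using D0 by (simp add: field_simps)
      qed
      then have "e * (real k / real D) \<le> e * (real k' + 1)" using e by (intro mult_left_mono) auto
      then show ?thesis using e by (simp add: algebra_simps)
    qed
    also have "\<dots> \<le> exp (1 - (c / C1) * b * real k / (real q + 1 + ln (1 / b)))"
    proof -
      let ?u = "real q + 1 + ln (1 / b)"
      have lb: "0 \<le> ln (1 / b)" using b b1 by simp
      have u: "1 \<le> ?u" using lb by simp
      have "real kb \<le> 1 + (\<bar>ln (2 * K * M)\<bar> + ln (1 / b)) / e0"
      proof -
        have "real kb \<le> max 0 (ln (2 * K * M / b) / e0 + 1)" unfolding kb_def by linarith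
        also have "ln (2 * K * M / b) = ln (2 * K * M) + ln (1 / b)"
          using K_pos M b by (simp add: ln_div)
        also have "max 0 ((ln (2 * K * M) + ln (1 / b)) / e0 + 1) \<le> 1 + (\<bar>ln (2 * K * M)\<bar> + ln (1 / b)) / e0"
          using e0 lb by (auto intro!: divide_right_mono)
        finally show ?thesis .
      qed
      also have "\<dots> \<le> (1 + (\<bar>ln (2 * K * M)\<bar> + 1) / e0) * ?u"
      proof -
        have "\<bar>ln (2 * K * M)\<bar> + ln (1 / b) \<le> (\<bar>ln (2 * K * M)\<bar> + 1) * ?u"
          using u lb mult_left_mono[OF u, of "\<bar>ln (2 * K * M)\<bar>"] by (simp add: distrib_right)
        then have "(\<bar>ln (2 * K * M)\<bar> + ln (1 / b)) / e0 \<le> (\<bar>ln (2 * K * M)\<bar> + 1) * ?u / e0"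
          using e0 by (intro divide_right_mono) auto
        then show ?thesis using u by (simp add: distrib_right)
      qed
      finally have kb: "real L0 * real kb \<le> real L0 * ((1 + (\<bar>ln (2 * K * M)\<bar> + 1) / e0) * ?u)"
        by (intro mult_left_mono) auto
      have "real D = real q + 1 + real N1 + real L0 * real kb"
        by (simp add: D_def N'_def N_def)
      also have "\<dots> \<le> ?u + real N1 * ?u + real L0 * ((1 + (\<bar>ln (2 * K * M)\<bar> + 1) / e0) * ?u)"
        using kb lb mult_left_mono[OF u, of "real N1"] by simp
      also have "\<dots> = C1 * ?u" by (simp add: C1_def algebra_simps)
      finally have D: "real D \<le> C1 * ?u" .
      have "(c / C1) * b * real k / ?u = e * real k / (C1 * ?u)" by (simp add: e_def)
      also have "\<dots> \<le> e * real k / real D"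
        using D D0 e C1 u by (intro divide_left_mono) auto
      finally show ?thesis by simp
    qed
    finally have "p (miss B k) \<le> K * (exp (1 - (c / C1) * b * real k / (real q + 1 + ln (1 / b))) * M)"
      using K_pos M by (simp add: mult_left_mono mult_right_mono)
    then show ?thesis by (simp add: exp_diff exp_minus field_simps)
  qed
  show ?thesis
    using main K_pos M c C1 by (intro that[of "K * M * exp 1" "c / C1"]) auto
qed

end

section \<open>Piecewise expanding interval maps\<close>

text \<open>
  The measure of the image is the integral of \<open>\<bar>g'\<bar>\<close>, by the change of variables formula for
  derivatives within \<open>S\<close>, which may be discontinuous, and one-sided at endpoints.
\<close>

lemma measure_image_bounds:
  fixes g :: "real \<Rightarrow> real"
  assumes S: "S \<in> lmeasurable" and gS: "g ` S \<in> lmeasurable"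
    and der: "\<And>x. x \<in> S \<Longrightarrow> (g has_real_derivative g' x) (at x within S)" and inj: "inj_on g S"
  shows "(\<And>x. x \<in> S \<Longrightarrow> lo \<le> \<bar>g' x\<bar>) \<Longrightarrow> lo * measure lebesgue S \<le> measure lebesgue (g ` S)"
    and "(\<And>x. x \<in> S \<Longrightarrow> \<bar>g' x\<bar> \<le> hi) \<Longrightarrow> measure lebesgue (g ` S) \<le> hi * measure lebesgue S"
proof -
  have one: "(\<lambda>_. 1::real) absolutely_integrable_on (g ` S)"
    using gS by (simp add: absolutely_integrable_on_const)
  have "(\<lambda>x. \<bar>g' x\<bar> * 1) absolutely_integrable_on S \<and>
    integral S (\<lambda>x. \<bar>g' x\<bar> * 1) = measure lebesgue (g ` S)"
    using S der inj one gS
    by (subst has_absolute_integral_change_of_variables_1'[where f = "\<lambda>_. 1::real"])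
       (auto simp: lmeasure_integral)
  then have int: "(\<lambda>x. \<bar>g' x\<bar>) integrable_on S" and
    eq: "integral S (\<lambda>x. \<bar>g' x\<bar>) = measure lebesgue (g ` S)"
    by (auto simp: set_lebesgue_integral_eq_integral(1))
  have c: "(\<lambda>_. c) integrable_on S" "integral S (\<lambda>_. c) = c * measure lebesgue S" for c :: real
  proof -
    show "(\<lambda>_. c) integrable_on S" using S by (simp add: integrable_on_const)
    have "integral S (\<lambda>x. c * 1) = c * integral S (\<lambda>_. 1)" by (rule integral_mult_right)
    then show "integral S (\<lambda>_. c) = c * measure lebesgue S" using S by (simp add: lmeasure_integral)
  qed
  show "lo * measure lebesgue S \<le> measure lebesgue (g ` S)" if lo: "\<And>x. x \<in> S \<Longrightarrow> lo \<le> \<bar>g' x\<bar>"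
    unfolding eq[symmetric] c(2)[symmetric] by (intro integral_le c int lo)
  show "measure lebesgue (g ` S) \<le> hi * measure lebesgue S" if hi: "\<And>x. x \<in> S \<Longrightarrow> \<bar>g' x\<bar> \<le> hi"
    unfolding eq[symmetric] c(2)[symmetric] by (intro integral_le c int hi)
qed

lemma interval_Icc_subset:
  fixes S :: "real set" assumes "is_interval S" "x \<in> S" "y \<in> S" shows "{x..y} \<subseteq> S"
proof
  fix z assume "z \<in> {x..y}"
  then show "z \<in> S" using assms mem_is_interval_1_I[of S x y z] by simp
qed

lemma interval_limit_point:
  fixes S :: "real set" assumes "is_interval S" "x \<in> S" "y \<in> S" "x \<noteq> y" "z \<in> S" shows "z islimpt S"
proof (rule connected_imp_perfect)
  show "connected S" using assms by (simp add: is_interval_connected_1)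
  show "S \<noteq> {a}" for a using assms by auto
qed (fact assms)

lemma real_derivative_unique_within:
  assumes "(f has_real_derivative a) (at x within S)" "(f has_real_derivative b) (at x within S)"
    and "x islimpt S"
  shows "a = b"
  using assms vector_derivative_unique_within[of x S f a b]
  by (simp add: has_real_derivative_iff_has_vector_derivative trivial_limit_within)

locale interval_map =
  fixes Y :: "real set" and T :: "real \<Rightarrow> real" and P :: "nat \<Rightarrow> real set"
  assumes a1: "A1 Y T P" and a2: "A2 T P" and a3: "A3 T P"
    and T_borel: "T \<in> restrict_space borel Y \<rightarrow>\<^sub>M restrict_space borel Y"
begin

abbreviation Leb :: "real measure" where "Leb \<equiv> restrict_space lborel Y"

lemma Y_interval: "is_interval Y" and Y_bounded: "bounded Y" and markov: "markov_partition Y T P"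
  using a1 by (auto simp: A1_def)

lemma P_interval: "is_interval (P i)" and P_interior: "interior (P i) \<noteq> {}" and P_sub: "P i \<subseteq> Y"
  and P_disjoint: "disjoint_family P" and P_covers: "Y - (\<Union>i. P i) \<in> null_sets lborel"
  and P_markov: "T ` P i \<inter> interior (P j) \<noteq> {} \<Longrightarrow> interior (P j) \<subseteq> T ` P i"
  using markov unfolding markov_partition_def by blast+

lemma Y_borel [measurable]: "Y \<in> sets borel"
  using Y_interval by (rule real_interval_borel_measurable)

lemma space_Leb [simp]: "space Leb = Y"
  by (simp add: space_restrict_space)

lemma sets_Leb: "A \<in> sets Leb \<longleftrightarrow> A \<in> sets borel \<and> A \<subseteq> Y"
  by (subst sets_restrict_space_iff) (auto intro: borel_comp)

lemma measure_Leb: "A \<in> sets Leb \<Longrightarrow> measure Leb A = measure lebesgue A"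
  by (simp add: sets_Leb measure_restrict_space)

lemma Leb_lmeasurable: "A \<in> sets Leb \<Longrightarrow> A \<in> lmeasurable"
  using bounded_subset[OF Y_bounded] by (intro bounded_set_imp_lmeasurable) (auto simp: sets_Leb)

lemma interval_sets_Leb: "is_interval A \<Longrightarrow> A \<subseteq> Y \<Longrightarrow> A \<in> sets Leb"
  by (simp add: sets_Leb real_interval_borel_measurable)

sublocale markov_coding Leb T P
proof (intro markov_coding.intro markov_coding_axioms.intro finite_measureI)
  have "emeasure lborel Y \<noteq> \<infinity>"
    using emeasure_bounded_finite[OF Y_bounded] by simp
  then show "emeasure Leb (space Leb) \<noteq> \<infinity>" by (simp add: emeasure_restrict_space)
  have "sets Leb = sets (restrict_space borel Y)" by (rule sets_restrict_space_cong) simp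
  then show "T \<in> Leb \<rightarrow>\<^sub>M Leb" using T_borel by (simp cong: measurable_cong_sets)
  show "P i \<in> sets Leb" for i by (intro interval_sets_Leb P_interval P_sub)
  show "disjoint_family P" by (rule P_disjoint)
  show "space Leb - (\<Union>i. P i) \<in> null_sets Leb"
    using P_covers by (subst null_sets_restrict_space) auto
qed

lemma cyl_refinement:
  assumes "w \<noteq> []" "x \<in> cyl w" shows "cyl w \<in> refinement P T (length w - 1)"
proof -
  have "cyl w = (\<Inter>i\<le>length w - 1. (T ^^ i) -` P (w ! i))"
  proof (intro set_eqI iffI)
    fix x assume x: "x \<in> (\<Inter>i\<le>length w - 1. (T ^^ i) -` P (w ! i))"
    then have "x \<in> P (w ! 0)" by force
    moreover have "(T ^^ i) x \<in> P (w ! i)" if "i < length w" for i using x that by auto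
    ultimately show "x \<in> cyl w" using P_sub by (auto simp: cyl_def)
  next
    fix x assume x: "x \<in> cyl w"
    have "i < length w" if "i \<le> length w - 1" for i using that assms(1) by (cases w) auto
    then show "x \<in> (\<Inter>i\<le>length w - 1. (T ^^ i) -` P (w ! i))" using x by (auto simp: cyl_def)
  qed
  then show ?thesis using assms unfolding refinement_def by blast
qed

lemma cyl_Cons: "cyl (i # w) = P i \<inter> pre 1 (cyl w)"
  using cyl_append[of "[i]" w] by (simp add: cyl_single)

lemma P_limit_point: "x \<in> P i \<Longrightarrow> x islimpt P i"
proof -
  assume x: "x \<in> P i"
  obtain z where "z \<in> interior (P i)" using P_interior by blast
  then have "z islimpt P i" by (rule interior_limit_point)
  then obtain y where "y \<in> P i" "y \<noteq> z" unfolding islimpt_def by blast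
  moreover have "z \<in> P i" using \<open>z \<in> interior (P i)\<close> interior_subset by blast
  ultimately show "x islimpt P i" using interval_limit_point[OF P_interval] x by blast
qed

text \<open>
  At a common endpoint of two elements the derivatives within them differ; the element that contains
  the point decides.
\<close>

definition dT :: "real \<Rightarrow> real" where
  "dT x = vector_derivative T (at x within P (SOME i. x \<in> P i))"

lemma dT_eq: assumes "x \<in> P i" shows "dT x = vector_derivative T (at x within P i)"
proof -
  have "x \<in> P (SOME i. x \<in> P i)" using assms by (rule someI)
  then have "(SOME i. x \<in> P i) = i" using assms P_disjoint unfolding disjoint_family_on_def by blast
  then show ?thesis by (simp add: dT_def)
qed

lemma dT_derivative:
  assumes x: "x \<in> P i"
  shows "(T has_real_derivative dT x) (at x within P i)" and "dT x \<noteq> 0"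
proof -
  obtain \<Lambda> C where "\<Lambda> > 1" "C > 0" and L: "\<And>n \<omega> x. n \<ge> 1 \<Longrightarrow> \<omega> \<in> refinement P T (n - 1) \<Longrightarrow> x \<in> \<omega> \<Longrightarrow>
     \<exists>D. ((T ^^ n) has_real_derivative D) (at x within \<omega>) \<and> \<bar>D\<bar> \<ge> C * \<Lambda> ^ n"
    using a2 unfolding A2_def by blast
  have "P i \<in> refinement P T (1 - 1)" using cyl_refinement[of "[i]" x] x by (simp add: cyl_single)
  then obtain D where D: "(T has_real_derivative D) (at x within P i)" "\<bar>D\<bar> \<ge> C * \<Lambda>"
    using L[of 1 "P i" x] x by auto
  have "D \<noteq> 0" using D(2) \<open>\<Lambda> > 1\<close> \<open>C > 0\<close> by (auto simp: mult_le_0_iff)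
  moreover have "vector_derivative T (at x within P i) = D"
    using D(1) P_limit_point[OF x]
    by (intro vector_derivative_within) (auto simp: has_real_derivative_iff_has_vector_derivative trivial_limit_within)
  ultimately show "(T has_real_derivative dT x) (at x within P i)" "dT x \<noteq> 0"
    using D(1) by (auto simp: dT_eq[OF x])
qed

lemma T_cont: "continuous_on (P i) T"
  using dT_derivative(1) by (intro DERIV_continuous_on)

text \<open>
  By Rolle's theorem, since the derivative of \<open>T\<close> within \<open>P i\<close> never vanishes.
\<close>

lemma T_inj: "inj_on T (P i)"
proof -
  have False if "x \<in> P i" "y \<in> P i" "x < y" "T x = T y" for x y
  proof -
    have sub: "{x..y} \<subseteq> P i" using that by (intro interval_Icc_subset P_interval)
    have der: "(T has_real_derivative dT z) (at z)" if zz: "x < z" "z < y" for z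
    proof -
      have "(T has_real_derivative dT z) (at z within {x<..<y})"
      proof (rule has_field_derivative_subset)
        show "(T has_real_derivative dT z) (at z within P i)"
          using sub zz by (intro dT_derivative(1)) auto
        show "{x<..<y} \<subseteq> P i" using sub by auto
      qed
      then show ?thesis using zz at_within_open[of z "{x<..<y}"] by (simp only: greaterThanLessThan_iff open_greaterThanLessThan)
    qed
    have "\<exists>z. x < z \<and> z < y \<and> (T has_real_derivative 0) (at z)"
    proof (rule Rolle)
      show "T differentiable (at z)" if "x < z" "z < y" for z
        using der[OF that] real_differentiable_def by blast
    qed (fact that continuous_on_subset[OF T_cont sub])+
    then obtain z where z: "x < z" "z < y" "(T has_real_derivative 0) (at z)" by blast
    then have "dT z = 0" using der[of z] DERIV_unique by blast
    moreover have "z \<in> P i" using sub z by auto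
    ultimately show False using dT_derivative(2) by blast
  qed
  then show ?thesis unfolding inj_on_def by (metis linorder_neqE)
qed

text \<open>
  The derivative of the \<open>n\<close>-th iterate along the orbit of \<open>x\<close>, as given by the chain rule.
\<close>

definition J :: "nat \<Rightarrow> real \<Rightarrow> real" where
  "J n x = (\<Prod>k<n. dT ((T ^^ k) x))"

lemma J_Suc: "J (Suc n) x = dT x * J n (T x)"
proof -
  have "J (Suc n) x = dT ((T ^^ 0) x) * (\<Prod>k<n. dT ((T ^^ Suc k) x))"
    unfolding J_def by (rule prod.lessThan_Suc_shift)
  moreover have "(T ^^ Suc k) x = (T ^^ k) (T x)" for k by (simp add: funpow_swap1)
  ultimately show ?thesis by (simp only: J_def funpow_0)
qed

lemma funpow_Cons: "T ^^ length (i # w) = T ^^ length w \<circ> T"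
  by (simp add: funpow_Suc_right del: funpow.simps)

lemma cyl_derivative:
  "x \<in> cyl w \<Longrightarrow> ((T ^^ length w) has_real_derivative J (length w) x) (at x within cyl w)"
proof (induction w arbitrary: x)
  case Nil then show ?case by (simp add: J_def id_def)
next
  case (Cons i w)
  then have x: "x \<in> P i" "T x \<in> cyl w" by (auto simp: cyl_Cons pre_def)
  have sub: "T ` cyl (i # w) \<subseteq> cyl w" by (auto simp: cyl_Cons pre_def)
  have "((T ^^ length w) \<circ> T has_real_derivative J (length w) (T x) * dT x) (at x within cyl (i # w))"
  proof (rule DERIV_image_chain)
    show "((T ^^ length w) has_real_derivative J (length w) (T x)) (at (T x) within T ` cyl (i # w))"
      using Cons.IH[OF x(2)] sub by (rule has_field_derivative_subset)
    show "(T has_real_derivative dT x) (at x within cyl (i # w))"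
      using dT_derivative(1)[OF x(1)] by (rule has_field_derivative_subset) (auto simp: cyl_Cons)
  qed
  then show ?case unfolding funpow_Cons by (simp add: J_Suc mult.commute o_def)
qed

lemma J_nonzero: "x \<in> cyl w \<Longrightarrow> J (length w) x \<noteq> 0"
  unfolding J_def cyl_def using dT_derivative(2) by (auto simp: prod_zero_iff)

lemma cyl_inj: "inj_on (T ^^ length w) (cyl w)"
proof (induction w)
  case (Cons i w)
  have "inj_on (T ^^ length w \<circ> T) (cyl (i # w))"
  proof (rule comp_inj_on)
    show "inj_on T (cyl (i # w))" by (rule inj_on_subset[OF T_inj[of i]]) (auto simp: cyl_Cons)
    show "inj_on (T ^^ length w) (T ` cyl (i # w))"
      by (rule inj_on_subset[OF Cons.IH]) (auto simp: cyl_Cons pre_def)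
  qed
  then show ?case unfolding funpow_Cons .
qed simp

text \<open>
  A continuous injection on an interval is monotone, so the preimage of an interval under a branch
  is an interval.
\<close>

lemma cyl_interval: "is_interval (cyl w)"
proof (induction w)
  case Nil
  have "cyl [] = Y" by (auto simp: cyl_def)
  then show ?case using Y_interval by simp
next
  case (Cons i w)
  have "z \<in> cyl (i # w)" if x: "x \<in> cyl (i # w)" and y: "y \<in> cyl (i # w)"
    and z: "x \<le> z" "z \<le> y" for x y z
  proof (cases "z = x \<or> z = y")
    case False
    then have z': "x < z" "z < y" using z by auto
    have xy: "x \<in> P i" "y \<in> P i" using x y by (auto simp: cyl_Cons)
    have sub: "{x..y} \<subseteq> P i" using xy by (intro interval_Icc_subset P_interval)
    have "(T x < T z \<and> T z < T y) \<or> (T y < T z \<and> T z < T x)"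
      using z' continuous_on_subset[OF T_cont sub] inj_on_subset[OF T_inj sub]
      by (rule continuous_inj_imp_mono)
    moreover have "T x \<in> cyl w" "T y \<in> cyl w" using x y by (auto simp: cyl_Cons pre_def)
    ultimately have "T z \<in> cyl w"
      using interval_Icc_subset[OF Cons.IH, of "T x" "T y"] interval_Icc_subset[OF Cons.IH, of "T y" "T x"]
      by auto
    moreover have "z \<in> P i" using sub z by auto
    ultimately show ?thesis using P_sub by (auto simp: cyl_Cons pre_def)
  qed (use x y in auto)
  then show ?case unfolding is_interval_1 by blast
qed

lemma image_interval: "is_interval ((T ^^ length w) ` cyl w)"
proof -
  have "continuous_on (cyl w) (T ^^ length w)"
    using cyl_derivative by (rule DERIV_continuous_on)
  then show ?thesis using cyl_interval[of w] connected_continuous_image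
    by (simp add: is_interval_connected_1)
qed

lemma image_sub: "(T ^^ length w) ` cyl w \<subseteq> Y"
proof
  fix y assume "y \<in> (T ^^ length w) ` cyl w"
  then obtain x where "x \<in> cyl w" "y = (T ^^ length w) x" by blast
  then show "y \<in> Y" using Tn_space[of x] cyl_space[of w] by auto
qed

lemma cyl_pre_Y: "cyl w \<inter> pre (length w) Y = cyl w"
  using image_sub[of w] cyl_space[of w] by (auto simp: pre_def)

lemma Y_sets: "Y \<in> sets Leb"
  by (intro interval_sets_Leb Y_interval order_refl)

lemma image_sets: "(T ^^ length w) ` cyl w \<in> sets Leb"
  by (intro interval_sets_Leb image_interval image_sub)


lemma cyl_islimpt: "0 < m (cyl w) \<Longrightarrow> x \<in> cyl w \<Longrightarrow> x islimpt cyl w"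
proof (rule connected_imp_perfect)
  assume "0 < m (cyl w)"
  then have m: "0 < measure lebesgue (cyl w)" by (simp add: measure_Leb)
  show "cyl w \<noteq> {a}" for a using m by auto
qed (use cyl_interval[of w] in \<open>simp_all add: is_interval_connected_1\<close>)

text \<open>
  The expansion hypothesis speaks of some derivative within the cylinder. On a cylinder of positive
  length every point is a limit point, so this derivative is the product \<open>J\<close>.
\<close>

lemma expansion:
  obtains C \<Lambda> where "0 < C" "1 < \<Lambda>" "\<And>w x. w \<noteq> [] \<Longrightarrow> 0 < m (cyl w) \<Longrightarrow>
    x \<in> cyl w \<Longrightarrow> C * \<Lambda> ^ length w \<le> \<bar>J (length w) x\<bar>"
proof -
  obtain \<Lambda> C where LC: "\<Lambda> > 1" "C > 0" and L: "\<And>n \<omega> x. n \<ge> 1 \<Longrightarrow> \<omega> \<in> refinement P T (n - 1) \<Longrightarrow> x \<in> \<omega> \<Longrightarrow>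
     \<exists>D. ((T ^^ n) has_real_derivative D) (at x within \<omega>) \<and> \<bar>D\<bar> \<ge> C * \<Lambda> ^ n"
    using a2 unfolding A2_def by blast
  have "C * \<Lambda> ^ length w \<le> \<bar>J (length w) x\<bar>"
    if w: "w \<noteq> []" and m: "0 < m (cyl w)" and x: "x \<in> cyl w" for w x
  proof -
    have "1 \<le> length w" using w by (cases w) auto
    then obtain D where D: "((T ^^ length w) has_real_derivative D) (at x within cyl w)"
      "C * \<Lambda> ^ length w \<le> \<bar>D\<bar>"
      using L[OF _ cyl_refinement[OF w x] x] by blast
    have "D = J (length w) x"
      using D(1) cyl_derivative[OF x] cyl_islimpt[OF m x] by (rule real_derivative_unique_within)
    then show ?thesis using D(2) by simp
  qed
  then show ?thesis by (rule that[OF LC(2,1)])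
qed

text \<open>
  After \<open>k\<close> steps the two orbits still share \<open>n - k\<close> symbols, so the factors of \<open>J\<close> at time \<open>k\<close> differ by a
  factor of at most \<open>exp (C * \<tau> ^ (n - k - 1))\<close>; the exponents form a geometric series.
\<close>

lemma distortion:
  obtains D where "1 \<le> D" "\<And>w x y. x \<in> cyl w \<Longrightarrow> y \<in> cyl w \<Longrightarrow>
    \<bar>J (length w) x\<bar> \<le> D * \<bar>J (length w) y\<bar>"
proof -
  obtain \<tau> C where t: "0 < \<tau>" "\<tau> < 1" "C > 0" and A: "\<forall>n. \<forall>\<omega>\<in>refinement P T n. \<forall>i. \<omega> \<subseteq> P i \<longrightarrow>
     (\<forall>x\<in>\<omega>. \<forall>y\<in>\<omega>.
        \<bar>ln (\<bar>vector_derivative T (at x within P i)\<bar> / \<bar>vector_derivative T (at y within P i)\<bar>)\<bar>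
          \<le> C * \<tau> ^ n)"
    using a3 unfolding A3_def by (elim exE conjE)
  have main: "\<bar>J (length w) x\<bar> \<le> exp (C * (\<Sum>k<length w. \<tau> ^ k)) * \<bar>J (length w) y\<bar>"
    if "x \<in> cyl w" "y \<in> cyl w" for w x y
    using that
  proof (induction w arbitrary: x y)
    case (Cons i w)
    let ?n = "length w"
    have x: "x \<in> P i" "T x \<in> cyl w" and y: "y \<in> P i" "T y \<in> cyl w"
      using Cons.prems by (auto simp: cyl_Cons pre_def)
    have "\<bar>ln (\<bar>dT x\<bar> / \<bar>dT y\<bar>)\<bar> \<le> C * \<tau> ^ ?n"
      unfolding dT_eq[OF x(1)] dT_eq[OF y(1)]
    proof (rule A[rule_format, OF _ _ Cons.prems])
      show "cyl (i # w) \<in> refinement P T ?n"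
        using cyl_refinement[of "i # w" x] Cons.prems(1) by simp
      show "cyl (i # w) \<subseteq> P i" by (auto simp: cyl_Cons)
    qed
    then have "ln (\<bar>dT x\<bar> / \<bar>dT y\<bar>) \<le> C * \<tau> ^ ?n" by linarith
    moreover have pos: "0 < \<bar>dT x\<bar>" "0 < \<bar>dT y\<bar>" using dT_derivative(2)[OF x(1)] dT_derivative(2)[OF y(1)] by auto
    ultimately have "\<bar>dT x\<bar> / \<bar>dT y\<bar> \<le> exp (C * \<tau> ^ ?n)"
      by (metis divide_pos_pos exp_le_cancel_iff exp_ln)
    then have d: "\<bar>dT x\<bar> \<le> exp (C * \<tau> ^ ?n) * \<bar>dT y\<bar>" using pos by (simp add: field_simps)
    have "\<bar>J (length (i # w)) x\<bar> = \<bar>dT x\<bar> * \<bar>J ?n (T x)\<bar>" by (simp add: J_Suc abs_mult)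
    also have "\<dots> \<le> (exp (C * \<tau> ^ ?n) * \<bar>dT y\<bar>) * (exp (C * (\<Sum>k<?n. \<tau> ^ k)) * \<bar>J ?n (T y)\<bar>)"
      using d Cons.IH[OF x(2) y(2)] by (intro mult_mono) auto
    also have "\<dots> = exp (C * (\<Sum>k<length (i # w). \<tau> ^ k)) * \<bar>J (length (i # w)) y\<bar>"
      by (simp add: J_Suc abs_mult distrib_left exp_add)
    finally show ?case .
  qed (simp add: J_def)
  have "exp (C * (\<Sum>k<n. \<tau> ^ k)) \<le> exp (C * (1 / (1 - \<tau>)))" for n
  proof -
    have "(\<Sum>k<n. \<tau> ^ k) \<le> (\<Sum>k. \<tau> ^ k)" using t by (intro sum_le_suminf summable_geometric) auto
    also have "\<dots> = 1 / (1 - \<tau>)" using t by (intro suminf_geometric) auto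
    finally have "C * (\<Sum>k<n. \<tau> ^ k) \<le> C * (1 / (1 - \<tau>))"
      using t by (intro mult_left_mono) auto
    then show ?thesis by simp
  qed
  then have "\<bar>J (length w) x\<bar> \<le> exp (C * (1 / (1 - \<tau>))) * \<bar>J (length w) y\<bar>"
    if "x \<in> cyl w" "y \<in> cyl w" for w x y
    using order_trans[OF main[OF that] mult_right_mono[OF _ abs_ge_zero]] by simp
  then show ?thesis using t by (intro that[of "exp (C * (1 / (1 - \<tau>)))"]) auto
qed

lemma image_bounds:
  assumes A: "A \<in> sets Leb"
  shows "(\<And>x. x \<in> cyl w \<Longrightarrow> lo \<le> \<bar>J (length w) x\<bar>) \<Longrightarrow> lo * m (cyl w \<inter> pre (length w) A) \<le> m (A \<inter> (T ^^ length w) ` cyl w)"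
    and "(\<And>x. x \<in> cyl w \<Longrightarrow> \<bar>J (length w) x\<bar> \<le> hi) \<Longrightarrow> m (A \<inter> (T ^^ length w) ` cyl w) \<le> hi * m (cyl w \<inter> pre (length w) A)"
proof -
  let ?S = "cyl w \<inter> pre (length w) A" and ?g = "T ^^ length w"
  have S: "?S \<in> sets Leb" using A by auto
  have I: "A \<inter> ?g ` cyl w \<in> sets Leb" using A image_sets by auto
  have gS: "?g ` ?S = A \<inter> ?g ` cyl w" using cyl_space[of w] by (auto simp: pre_def)
  have der: "(?g has_real_derivative J (length w) x) (at x within ?S)" if "x \<in> ?S" for x
    using cyl_derivative[of x w] that by (intro has_field_derivative_subset[of ?g _ x "cyl w" ?S]) auto
  have inj: "inj_on ?g ?S" by (rule inj_on_subset[OF cyl_inj]) auto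
  have S': "?S \<in> lmeasurable" "?g ` ?S \<in> lmeasurable" unfolding gS using S I Leb_lmeasurable by auto
  have mI: "m (A \<inter> ?g ` cyl w) = measure lebesgue (?g ` ?S)"
    unfolding gS by (rule measure_Leb[OF I])
  show "lo * m ?S \<le> m (A \<inter> ?g ` cyl w)"
    if "\<And>x. x \<in> cyl w \<Longrightarrow> lo \<le> \<bar>J (length w) x\<bar>"
    unfolding measure_Leb[OF S] mI using that by (intro measure_image_bounds(1)[OF S' der inj]) auto
  show "m (A \<inter> ?g ` cyl w) \<le> hi * m ?S"
    if "\<And>x. x \<in> cyl w \<Longrightarrow> \<bar>J (length w) x\<bar> \<le> hi"
    unfolding measure_Leb[OF S] mI using that by (intro measure_image_bounds(2)[OF S' der inj]) auto
qed


definition G :: "nat \<Rightarrow> real set" where "G i = T ` P i"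

lemma G_interval: "is_interval (G i)" and G_sub: "G i \<subseteq> Y"
  using image_interval[of "[i]"] image_sub[of "[i]"] by (simp_all add: G_def cyl_single)

lemma G_sets: "G i \<in> sets Leb"
  by (intro interval_sets_Leb G_interval G_sub)

lemma P_frontier: "P i - interior (P i) \<in> null_sets Leb"
proof -
  have "negligible (frontier (P i))"
    using P_interval by (intro negligible_convex_frontier) (simp add: is_interval_convex)
  then have "negligible (P i - interior (P i))"
    by (rule negligible_subset) (use closure_subset in \<open>auto simp: frontier_def\<close>)
  then have "P i - interior (P i) \<in> null_sets lebesgue" by (simp add: negligible_iff_null_sets)
  moreover have "P i - interior (P i) \<in> sets borel"
    using real_interval_borel_measurable[OF P_interval] by auto
  ultimately have "P i - interior (P i) \<in> null_sets lborel"
    by (simp add: null_sets_completion_iff)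
  then show ?thesis using P_sub by (subst null_sets_restrict_space) auto
qed

lemma null_setsI: "A \<in> sets Leb \<Longrightarrow> m A = 0 \<Longrightarrow> A \<in> null_sets Leb"
  by (simp add: null_sets_def emeasure_eq_measure)

lemma image_null:
  assumes N: "N \<in> null_sets Leb"
  shows "(T ^^ length w) ` (cyl w \<inter> N) \<in> null_sets lebesgue"
proof -
  have "N \<in> null_sets lborel" using N by (simp add: null_sets_restrict_space)
  then have "negligible N" by (simp add: negligible_iff_null_sets null_sets_completionI)
  then have "negligible (cyl w \<inter> N)" by (rule negligible_subset) auto
  moreover have "(T ^^ length w) differentiable_on (cyl w \<inter> N)"
    unfolding differentiable_on_def
  proof
    fix x assume x: "x \<in> cyl w \<inter> N"
    have "((T ^^ length w) has_real_derivative J (length w) x) (at x within cyl w \<inter> N)"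
      by (rule has_field_derivative_subset[OF cyl_derivative]) (use x in blast)+
    then show "(T ^^ length w) differentiable (at x within cyl w \<inter> N)"
      by (rule differentiableI[OF has_field_derivative_imp_has_derivative])
  qed
  ultimately have "negligible ((T ^^ length w) ` (cyl w \<inter> N))"
    by (intro negligible_differentiable_image_negligible) simp_all
  then show ?thesis by (simp add: negligible_iff_null_sets)
qed

lemma image_pos:
  assumes "0 < m (cyl w)" shows "0 < m ((T ^^ length w) ` cyl w)"
proof -
  obtain D where D: "1 \<le> D" "\<And>w x y. x \<in> cyl w \<Longrightarrow> y \<in> cyl w \<Longrightarrow>
    \<bar>J (length w) x\<bar> \<le> D * \<bar>J (length w) y\<bar>" by (rule distortion) blast
  have "cyl w \<noteq> {}" using assms by auto
  then obtain y where y: "y \<in> cyl w" by blast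
  define lo where "lo = \<bar>J (length w) y\<bar> / D"
  have lo: "0 < lo" using J_nonzero[OF y] D(1) by (simp add: lo_def)
  have "lo \<le> \<bar>J (length w) x\<bar>" if "x \<in> cyl w" for x
    using D(2)[OF y that] D(1) by (simp add: lo_def field_simps)
  then have "lo * m (cyl w \<inter> pre (length w) Y) \<le> m (Y \<inter> (T ^^ length w) ` cyl w)"
    using Y_sets by (intro image_bounds(1)) auto
  moreover note cyl_pre_Y
  moreover have "Y \<inter> (T ^^ length w) ` cyl w = (T ^^ length w) ` cyl w"
    using image_sub[of w] by blast
  ultimately show ?thesis using mult_pos_pos[OF lo assms] by simp
qed

lemma positive_meets_interior:
  assumes I: "is_interval I" "I \<subseteq> P i" "0 < m I" shows "I \<inter> interior (P i) \<noteq> {}"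
proof
  assume "I \<inter> interior (P i) = {}"
  then have "I \<subseteq> P i - interior (P i)" using I by blast
  moreover have "I \<in> sets Leb" using I P_sub by (intro interval_sets_Leb) auto
  ultimately have "I \<in> null_sets Leb" using P_frontier null_sets_subset by blast
  then show False using I(3) by (simp add: measure_eq_0_null_sets)
qed

text \<open>
  An interval of positive length inside \<open>P j\<close> meets the interior of \<open>P j\<close>, where the Markov property
  applies. Intersections that consist of endpoints only are excluded in this way.
\<close>

lemma Markov_step:
  assumes "is_interval I" "I \<subseteq> G i" "I \<subseteq> P j" "0 < m I"
  shows "interior (P j) \<subseteq> G i"
  using positive_meets_interior[of I j] assms P_markov[of i j] unfolding G_def by blast

text \<open>
  By the Markov property each step of an admissible word covers the whole interior of the next
  element, so only the images of frontier points can be missed.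
\<close>

lemma image_full:
  "w \<noteq> [] \<Longrightarrow> 0 < m (cyl w) \<Longrightarrow>
    G (last w) - (T ^^ length w) ` cyl w \<in> null_sets lebesgue"
proof (induction w)
  case (Cons i w)
  show ?case
  proof (cases "w = []")
    case True then show ?thesis by (simp add: cyl_single G_def)
  next
    case False
    then obtain j v where w: "w = j # v" by (cases w) auto
    let ?I = "T ` cyl (i # w)"
    have I: "?I = G i \<inter> cyl w"
      using P_sub[of i] by (auto simp: cyl_Cons pre_def G_def)
    have Ii: "is_interval ?I" unfolding I by (intro is_interval_Int G_interval cyl_interval)
    have Is: "?I \<in> sets Leb" using Ii G_sub by (intro interval_sets_Leb) (auto simp: I)
    have Ip: "0 < m ?I"
    proof (rule ccontr)
      assume "\<not> 0 < m ?I"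
      then have "m ?I = 0" by (simp add: zero_less_measure_iff)
      then have N: "?I \<in> null_sets Leb" using Is by (intro null_setsI)
      have "(T ^^ length w) ` (cyl w \<inter> ?I) \<in> null_sets lebesgue" by (rule image_null[OF N])
      moreover have "(T ^^ length w) ` (cyl w \<inter> ?I) = (T ^^ length (i # w)) ` cyl (i # w)"
      proof -
        have "cyl w \<inter> ?I = ?I" using I by blast
        then show ?thesis unfolding funpow_Cons image_comp[symmetric] by simp
      qed
      ultimately have "measure lebesgue ((T ^^ length (i # w)) ` cyl (i # w)) = 0"
        by (simp add: measure_eq_0_null_sets)
      then show False using image_pos[OF Cons.prems(2)] measure_Leb[OF image_sets[of "i # w"]] by simp
    qed
    have "cyl w \<subseteq> P j" unfolding w cyl_Cons by blast
    then have int: "interior (P j) \<subseteq> G i" using Ii Ip by (intro Markov_step[of ?I]) (auto simp: I)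
    have sub: "cyl w \<subseteq> ?I \<union> (cyl w \<inter> (P j - interior (P j)))"
      using int \<open>cyl w \<subseteq> P j\<close> unfolding I by blast
    have "m ?I \<le> m (cyl w)" unfolding I by (intro finite_measure_mono) auto
    then have IH: "G (last w) - (T ^^ length w) ` cyl w \<in> null_sets lebesgue"
      using Cons.IH False Ip by simp
    have N: "(T ^^ length w) ` (cyl w \<inter> (P j - interior (P j))) \<in> null_sets lebesgue"
      by (rule image_null[OF P_frontier])
    have comp: "(T ^^ length (i # w)) ` cyl (i # w) = (T ^^ length w) ` ?I"
      unfolding funpow_Cons by (simp add: image_comp)
    have "H - g ` I \<subseteq> (H - g ` A) \<union> g ` B" if "A \<subseteq> I \<union> B" for H A B I :: "real set" and g :: "real \<Rightarrow> real"
      using that by blast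
    from this[OF sub] have "G (last w) - (T ^^ length (i # w)) ` cyl (i # w) \<subseteq>
      (G (last w) - (T ^^ length w) ` cyl w) \<union> (T ^^ length w) ` (cyl w \<inter> (P j - interior (P j)))"
      unfolding comp .
    moreover have "G (last w) - (T ^^ length (i # w)) ` cyl (i # w) \<in> sets lebesgue"
      using G_sets[of "last w"] image_sets[of "i # w"] unfolding sets_Leb
      by (intro sets.Diff) (simp_all del: list.size funpow.simps)
    ultimately have "G (last w) - (T ^^ length (i # w)) ` cyl (i # w) \<in> null_sets lebesgue"
      using null_sets_subset[OF null_sets.Un[OF IH N]] by blast
    then show ?thesis using False by simp
  qed
qed simp

lemma image_measure:
  assumes "w \<noteq> []" "0 < m (cyl w)" and A: "A \<in> sets Leb"
  shows "m (A \<inter> (T ^^ length w) ` cyl w) = m (A \<inter> G (last w))"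
proof -
  let ?g = "(T ^^ length w) ` cyl w" and ?G = "G (last w)"
  have s: "A \<inter> ?g \<in> sets Leb" "A \<inter> ?G \<in> sets Leb" "?g \<in> sets Leb" "?G \<in> sets Leb"
    using A image_sets G_sets by auto
  have sub: "?g \<subseteq> ?G"
  proof -
    have "w = butlast w @ [last w]" using assms(1) by simp
    then have "cyl w = cyl (butlast w) \<inter> pre (length w - 1) (P (last w))"
      by (metis cyl_append cyl_single length_butlast)
    then have "(T ^^ (length w - 1)) x \<in> P (last w)" if "x \<in> cyl w" for x
      using that by (auto simp: pre_def)
    moreover have "T ^^ length w = T \<circ> T ^^ (length w - 1)" using assms(1) by (cases w) auto
    ultimately show ?thesis by (auto simp: G_def)
  qed
  have "A \<inter> ?G - ?g \<in> null_sets lebesgue"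
    using image_full[OF assms(1,2)] by (rule null_sets_subset) (use s in \<open>auto simp: sets_Leb\<close>)
  then have "measure lebesgue (A \<inter> ?G) = measure lebesgue (A \<inter> ?G - (A \<inter> ?G - ?g))"
    using s by (subst measure_Diff_null_set) (auto simp: sets_Leb)
  also have "A \<inter> ?G - (A \<inter> ?G - ?g) = A \<inter> ?g" using sub by blast
  finally show ?thesis by (simp add: measure_Leb[OF s(1)] measure_Leb[OF s(2)])
qed

lemma G_large: obtains c where "0 < c" "\<And>i. c < m (G i)"
proof -
  obtain c where "0 < c" "\<And>i. c < measure lborel (T ` P i)" using a1 unfolding A1_def by blast
  moreover have "measure lborel (T ` P i) = m (G i)" for i
    using measure_Leb[OF G_sets] G_sets by (simp add: G_def sets_Leb)
  ultimately show ?thesis using that by auto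
qed

text \<open>
  Up to the square of the distortion constant, the proportion of the cylinder that is mapped into \<open>A\<close>
  is the proportion of \<open>A\<close> in the image \<open>G (last w)\<close>, whose length lies between two positive constants.
\<close>

lemma bounded_distortion:
  obtains K where "0 < K"
    "\<And>w A. w \<noteq> [] \<Longrightarrow> A \<in> sets Leb \<Longrightarrow>
      m (cyl w \<inter> pre (length w) A) \<le> K * m (cyl w) * m (A \<inter> G (last w))"
    "\<And>w A. w \<noteq> [] \<Longrightarrow> A \<in> sets Leb \<Longrightarrow>
      m (cyl w) * m (A \<inter> G (last w)) \<le> K * m (cyl w \<inter> pre (length w) A)"
proof -
  obtain D where D: "1 \<le> D" "\<And>w x y. x \<in> cyl w \<Longrightarrow> y \<in> cyl w \<Longrightarrow>
    \<bar>J (length w) x\<bar> \<le> D * \<bar>J (length w) y\<bar>" by (rule distortion) blast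
  obtain c where c: "0 < c" "\<And>i. c < m (G i)" by (rule G_large) blast
  define M where "M = m Y"
  have M: "m A \<le> M" if "A \<in> sets Leb" for A
    using that bounded_measure[of A] by (simp add: M_def)
  have M0: "0 \<le> M" by (simp add: M_def)
  define K where "K = D\<^sup>2 / c + D\<^sup>2 * M"
  have K0: "0 < K" using D(1) c(1) M0 by (auto simp: K_def intro!: add_pos_nonneg)
  have K1: "D\<^sup>2 \<le> K * c" using c(1) M0 by (simp add: K_def distrib_right)
  have K2: "D\<^sup>2 * M \<le> K" using c(1) by (simp add: K_def)
  have both: "m (cyl w \<inter> pre (length w) A) \<le> K * m (cyl w) * m (A \<inter> G (last w)) \<and>
    m (cyl w) * m (A \<inter> G (last w)) \<le> K * m (cyl w \<inter> pre (length w) A)"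
    if w: "w \<noteq> []" and A: "A \<in> sets Leb" for w A
  proof (cases "m (cyl w) = 0")
    case True
    have "m (cyl w \<inter> pre (length w) A) \<le> m (cyl w)"
      using A by (intro finite_measure_mono) auto
    then show ?thesis using True K0 by simp
  next
    case False
    then have pos: "0 < m (cyl w)" by (simp add: zero_less_measure_iff)
    then have "cyl w \<noteq> {}" by auto
    then obtain y where y: "y \<in> cyl w" by blast
    let ?C = "m (cyl w)" and ?S = "m (cyl w \<inter> pre (length w) A)"
    let ?A = "m (A \<inter> G (last w))" and ?G = "m (G (last w))"
    define j where "j = \<bar>J (length w) y\<bar>"
    have j: "0 < j" using J_nonzero[OF y] by (simp add: j_def)
    have lo: "j / D \<le> \<bar>J (length w) x\<bar>" if "x \<in> cyl w" for x
      using D(2)[OF y that] D(1) by (simp add: j_def field_simps)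
    have hi: "\<bar>J (length w) x\<bar> \<le> D * j" if "x \<in> cyl w" for x
      using D(2)[OF that y] by (simp add: j_def)
    have GY: "Y \<inter> G (last w) = G (last w)" using G_sub by blast
    have S1: "j / D * ?S \<le> ?A"
      using image_bounds(1)[OF A lo] image_measure[OF w pos A] by simp
    have S2: "?A \<le> D * j * ?S"
      using image_bounds(2)[OF A hi] image_measure[OF w pos A] by simp
    have C1: "j / D * ?C \<le> ?G"
      using image_bounds(1)[OF Y_sets lo] image_measure[OF w pos Y_sets] unfolding cyl_pre_Y GY by simp
    have C2: "?G \<le> D * j * ?C"
      using image_bounds(2)[OF Y_sets hi] image_measure[OF w pos Y_sets] unfolding cyl_pre_Y GY by simp
    have S0: "0 \<le> ?S" "0 \<le> ?A" "0 \<le> ?G" by auto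
    have D0: "0 < D" using D(1) by simp
    have S1': "j * ?S \<le> D * ?A" using S1 D0 by (simp add: field_simps)
    have C1': "j * ?C \<le> D * ?G" using C1 D0 by (simp add: field_simps)
    have "j * (?S * ?G) = (j * ?S) * ?G" by simp
    also have "\<dots> \<le> (D * ?A) * (D * j * ?C)" using D0 by (intro mult_mono[OF S1' C2]) simp_all
    finally have "j * (?S * ?G) \<le> j * (D\<^sup>2 * (?C * ?A))" by (simp add: power2_eq_square mult_ac)
    then have 1: "?S * ?G \<le> D\<^sup>2 * (?C * ?A)" using j by simp
    have "c * ?S \<le> ?G * ?S" using less_imp_le[OF c(2)[of "last w"]] S0(1) by (rule mult_right_mono)
    also have "?G * ?S \<le> D\<^sup>2 * (?C * ?A)" using 1 by (simp add: mult.commute)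
    also have "D\<^sup>2 * (?C * ?A) \<le> (K * c) * (?C * ?A)" using K1 by (intro mult_right_mono) auto
    finally have "c * ?S \<le> c * (K * ?C * ?A)" by (simp add: mult_ac)
    then have up: "?S \<le> K * ?C * ?A" using c(1) by simp
    have "j * (?C * ?A) = (j * ?C) * ?A" by simp
    also have "\<dots> \<le> (D * ?G) * (D * j * ?S)" using D0 by (intro mult_mono[OF C1' S2]) simp_all
    finally have "j * (?C * ?A) \<le> j * (D\<^sup>2 * ?G * ?S)" by (simp add: power2_eq_square mult_ac)
    then have "?C * ?A \<le> D\<^sup>2 * ?G * ?S" using j by simp
    also have "\<dots> \<le> D\<^sup>2 * M * ?S" using M[OF G_sets] by (intro mult_right_mono mult_left_mono) auto
    also have "\<dots> \<le> K * ?S" using K2 by (intro mult_right_mono) auto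
    finally show ?thesis using up by simp
  qed
  show ?thesis using K0 both that by blast
qed

text \<open>
  Finitely many elements cover \<open>Y\<close> up to a set shorter than any of the images; hence every image meets
  one of them in positive measure, and then contains it by the Markov property.
\<close>

lemma big_elements: "\<exists>F. finite F \<and> (\<forall>i. \<exists>j\<in>F. 0 < m (P j) \<and> m (P j - G i) = 0)"
proof -
  obtain c where c: "0 < c" "\<And>i. c < m (G i)" by (rule G_large) blast
  let ?U = "\<lambda>n. \<Union>i<n. P i"
  have U: "?U n \<in> sets Leb" for n by (intro sets.finite_UN) auto
  have "(\<lambda>n. m (?U n)) \<longlonglongrightarrow> m (\<Union>n. ?U n)"
  proof (rule finite_Lim_measure_incseq)
    show "incseq ?U" unfolding incseq_def by (intro allI impI UN_mono) auto
  qed (use U in blast)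
  moreover have "m (\<Union>n. ?U n) = m Y"
  proof -
    have eq: "(\<Union>n. ?U n) = (\<Union>i. P i)" by auto
    have "Y - (\<Union>i. P i) \<in> null_sets Leb" using P_cover by simp
    then have "m (Y - (\<Union>i. P i)) = 0" by (simp add: measure_eq_0_null_sets)
    moreover have "(\<Union>i. P i) \<in> sets Leb" by (intro sets.countable_UN'' countableI_type P_sets)
    ultimately show ?thesis
      using finite_measure_compl[of "\<Union>i. P i"] by (simp add: eq)
  qed
  ultimately have "\<forall>\<^sub>F n in sequentially. m Y - c < m (?U n)"
    using c(1) by (intro order_tendstoD(1)) auto
  then obtain n where n: "m Y - c < m (?U n)" by (auto simp: eventually_sequentially)
  have "\<exists>j\<in>{..<n}. 0 < m (P j) \<and> m (P j - G i) = 0" for i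
  proof -
    have "\<exists>j<n. 0 < m (G i \<inter> P j)"
    proof (rule ccontr)
      assume "\<not> ?thesis"
      then have "m (G i \<inter> P j) = 0" if "j < n" for j using that by (simp add: zero_less_measure_iff)
      then have "G i \<inter> P j \<in> null_sets Leb" if "j < n" for j using that G_sets by (intro null_setsI) auto
      then have "(\<Union>j<n. G i \<inter> P j) \<in> null_sets Leb" by (intro null_sets_UN') auto
      then have "m (G i \<inter> ?U n) = 0" unfolding Int_UN_distrib by (rule measure_eq_0_null_sets)
      then have "m (G i) = m (G i - ?U n)"
        using finite_measure_Diff'[OF G_sets U, of i n] by simp
      also have "\<dots> \<le> m (Y - ?U n)" using U G_sub Y_interval
        by (intro finite_measure_mono sets.Diff[OF interval_sets_Leb]) auto
      also have "\<dots> = m Y - m (?U n)" using finite_measure_compl[OF U, of n] by simp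
      finally show False using n c(2)[of i] by linarith
    qed
    then obtain j where j: "j < n" "0 < m (G i \<inter> P j)" by blast
    have "interior (P j) \<subseteq> G i"
      using j(2) by (intro Markov_step[of "G i \<inter> P j"] is_interval_Int G_interval P_interval) auto
    then have "P j - G i \<subseteq> P j - interior (P j)" by blast
    then have "P j - G i \<in> null_sets Leb"
      using null_sets_subset[OF P_frontier, of "P j - G i" j] G_sets by auto
    then have "m (P j - G i) = 0" by (simp add: measure_eq_0_null_sets)
    moreover have "m (G i \<inter> P j) \<le> m (P j)" by (intro finite_measure_mono) auto
    ultimately show ?thesis using j by (intro bexI[of _ j]) auto
  qed
  then show ?thesis by blast
qed

lemma cyl_diameter:
  obtains C \<Lambda> where "0 < C" "1 < \<Lambda>"
    "\<And>w x y. w \<noteq> [] \<Longrightarrow> x \<in> cyl w \<Longrightarrow> y \<in> cyl w \<Longrightarrow> \<bar>x - y\<bar> \<le> C / \<Lambda> ^ length w"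
proof -
  obtain C \<Lambda> where C: "0 < C" "1 < \<Lambda>" "\<And>w x. w \<noteq> [] \<Longrightarrow> 0 < m (cyl w) \<Longrightarrow>
    x \<in> cyl w \<Longrightarrow> C * \<Lambda> ^ length w \<le> \<bar>J (length w) x\<bar>" by (rule expansion) blast
  have main: "y - x \<le> (m Y + 1) / C / \<Lambda> ^ length w"
    if w: "w \<noteq> []" and xy: "x \<in> cyl w" "y \<in> cyl w" "x < y" for w x y
  proof -
    have "y - x = measure lebesgue {x..y}" using xy(3) by simp
    also have "\<dots> = m {x..y}"
    proof -
      have "{x..y} \<subseteq> Y" using interval_Icc_subset[OF cyl_interval xy(1,2)] cyl_space[of w] by auto
      then show ?thesis by (intro measure_Leb[symmetric]) (simp add: sets_Leb)
    qed
    also have "\<dots> \<le> m (cyl w)"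
      using interval_Icc_subset[OF cyl_interval xy(1,2)] by (intro finite_measure_mono) auto
    finally have le: "y - x \<le> m (cyl w)" .
    then have pos: "0 < m (cyl w)" using xy(3) by linarith
    have "C * \<Lambda> ^ length w * m (cyl w) \<le> m (Y \<inter> (T ^^ length w) ` cyl w)"
      using image_bounds(1)[OF Y_sets, of w "C * \<Lambda> ^ length w"] C(3)[OF w pos] unfolding cyl_pre_Y by blast
    also have "\<dots> \<le> m Y" using Y_sets by (intro finite_measure_mono) auto
    finally have "C * \<Lambda> ^ length w * m (cyl w) \<le> m Y + 1" by simp
    then have "m (cyl w) \<le> (m Y + 1) / C / \<Lambda> ^ length w"
      using C by (simp add: field_simps)
    then show ?thesis using le by linarith
  qed
  have "\<bar>x - y\<bar> \<le> (m Y + 1) / C / \<Lambda> ^ length w"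
    if w: "w \<noteq> []" and xy: "x \<in> cyl w" "y \<in> cyl w" for w x y
  proof (cases x y rule: linorder_cases)
    case less then show ?thesis using main[OF w xy(1,2)] by linarith
  next
    case equal then show ?thesis using C by simp
  next
    case greater then show ?thesis using main[OF w xy(2,1)] by linarith
  qed
  moreover have "0 < (m Y + 1) / C"
    using C(1) by (intro divide_pos_pos add_nonneg_pos) simp_all
  ultimately show ?thesis using C(2) by (intro that[of "(m Y + 1) / C" \<Lambda>])
qed


text \<open>
  A Borel set nearly fills an open set around it, and an open set is filled by the cylinders inside it
  as their diameters shrink to zero.
\<close>

lemma open_approximation:
  assumes dist: "distorted_markov_coding Leb T P G K F" and E: "E \<in> sets Leb" and e: "0 < e"
  shows "\<exists>n0. \<forall>n\<ge>n0. \<exists>W. (\<forall>w\<in>W. length w = n) \<and>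
    m (E - (\<Union>w\<in>W. cyl w)) < e \<and> m ((\<Union>w\<in>W. cyl w) - E) < e"
proof -
  interpret d: distorted_markov_coding Leb T P G K F by (rule dist)
  obtain C \<Lambda> where C: "0 < C" "1 < \<Lambda>"
    "\<And>w x y. w \<noteq> [] \<Longrightarrow> x \<in> cyl w \<Longrightarrow> y \<in> cyl w \<Longrightarrow> \<bar>x - y\<bar> \<le> C / \<Lambda> ^ length w"
    by (rule cyl_diameter) blast
  have Eb: "E \<in> sets borel" using E by (simp add: sets_Leb)
  obtain U where U: "open U" "E \<subseteq> U" "emeasure lborel (U - E) < e"
    using outer_regular_lborel[OF Eb e] by blast
  define W where "W n = {w. length w = n \<and> cyl w \<subseteq> U}" for n
  define V where "V n = (\<Union>w\<in>W n. cyl w)" for n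
  have V: "V n \<in> sets Leb" for n
    unfolding V_def by (intro sets.countable_UN'' countableI_type cyl_sets)
  have "V n \<subseteq> U" for n by (auto simp: V_def W_def)
  have VE: "m (V n - E) < e" for n
  proof -
    have s: "V n - E \<in> sets Leb" using V E by auto
    have "ennreal (m (V n - E)) = emeasure Leb (V n - E)"
      by (simp add: emeasure_eq_measure)
    also have "\<dots> = emeasure lborel (V n - E)"
      using s by (intro emeasure_restrict_space) (auto simp: sets_Leb)
    also have "\<dots> \<le> emeasure lborel (U - E)"
      using \<open>V n \<subseteq> U\<close> U(1) Eb by (intro emeasure_mono) auto
    also have "\<dots> < ennreal e" using U(3) .
    finally show ?thesis by (simp add: ennreal_less_iff)
  qed
  let ?A = "\<lambda>n. E \<inter> full \<inter> V n"
  have inc: "incseq ?A"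
  proof (rule incseq_SucI, rule subsetI)
    fix n x assume x: "x \<in> ?A n"
    then obtain w where w: "length w = n" "cyl w \<subseteq> U" "x \<in> cyl w" by (auto simp: V_def W_def)
    obtain v where v: "length v = Suc n" "x \<in> cyl v" using full_word[of x "Suc n"] x by blast
    have eq: "cyl v = cyl (take n v) \<inter> pre (length (take n v)) (cyl (drop n v))"
      using cyl_append[of "take n v" "drop n v"] by simp
    then have "x \<in> cyl (take n v)" using v(2) by blast
    then have "take n v = w" using cyl_disjoint[of "take n v" w] w v by auto
    then have "cyl v \<subseteq> U" using eq w(2) by blast
    then have "x \<in> V (Suc n)" using v by (auto simp: V_def W_def)
    then show "x \<in> ?A (Suc n)" using x by blast
  qed
  have un: "(\<Union>n. ?A n) = E \<inter> full"
  proof (intro equalityI subsetI)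
    fix x assume x: "x \<in> E \<inter> full"
    then have "x \<in> U" using U(2) by blast
    then obtain r where r: "0 < r" "ball x r \<subseteq> U" using U(1) open_contains_ball by blast
    have "(\<lambda>n. C / \<Lambda> ^ n) \<longlonglongrightarrow> 0" using C(2) by (rule LIMSEQ_divide_realpow_zero)
    then have "\<forall>\<^sub>F n in sequentially. C / \<Lambda> ^ n < r" using r(1) by (rule order_tendstoD(2))
    then obtain n0 where n0: "\<And>n. n \<ge> n0 \<Longrightarrow> C / \<Lambda> ^ n < r" by (auto simp: eventually_sequentially)
    obtain w where w: "length w = Suc n0" "x \<in> cyl w" using full_word[of x "Suc n0"] x by blast
    have "cyl w \<subseteq> ball x r"
    proof
      fix y assume y: "y \<in> cyl w"
      have "w \<noteq> []" using w by auto
      then have "\<bar>x - y\<bar> \<le> C / \<Lambda> ^ length w" using w y by (intro C(3))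
      also have "\<dots> < r" using n0[of "length w"] w by simp
      finally show "y \<in> ball x r" by (simp add: dist_real_def)
    qed
    then have "x \<in> V (Suc n0)" using w r by (auto simp: V_def W_def)
    then show "x \<in> (\<Union>n. ?A n)" using x by blast
  qed auto
  have "(\<lambda>n. m (?A n)) \<longlonglongrightarrow> m (\<Union>n. ?A n)"
    using inc V E by (intro finite_Lim_measure_incseq) auto
  also have "m (\<Union>n. ?A n) = m E" unfolding un using d.m_Int_full[OF E] .
  finally have "\<forall>\<^sub>F n in sequentially. m E - e < m (?A n)"
    using e by (intro order_tendstoD(1)) auto
  then obtain n0 where n0: "\<And>n. n \<ge> n0 \<Longrightarrow> m E - e < m (?A n)"
    by (auto simp: eventually_sequentially)
  have "m (E - V n) < e" if "n \<ge> n0" for n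
  proof -
    have "m (?A n) \<le> m (E \<inter> V n)" using E V by (intro finite_measure_mono) auto
    then show ?thesis using n0[OF that] finite_measure_Diff'[OF E V, of n] by linarith
  qed
  then show ?thesis
    using VE by (intro exI[of _ n0] allI impI exI[of _ "W _"]) (auto simp: V_def W_def)
qed

lemma generating_coding: "\<exists>K F. generating_markov_coding Leb T P G K F"
proof -
  obtain K where K: "0 < K"
    "\<And>w A. w \<noteq> [] \<Longrightarrow> A \<in> sets Leb \<Longrightarrow>
      m (cyl w \<inter> pre (length w) A) \<le> K * m (cyl w) * m (A \<inter> G (last w))"
    "\<And>w A. w \<noteq> [] \<Longrightarrow> A \<in> sets Leb \<Longrightarrow>
      m (cyl w) * m (A \<inter> G (last w)) \<le> K * m (cyl w \<inter> pre (length w) A)"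
    by (rule bounded_distortion) blast
  obtain F where F: "finite F" "\<And>i. \<exists>j\<in>F. 0 < m (P j) \<and> m (P j - G i) = 0"
    using big_elements by blast
  have d: "distorted_markov_coding Leb T P G K F"
    by (intro distorted_markov_coding.intro markov_coding_axioms distorted_markov_coding_axioms.intro
      G_sets K F)
  have "generating_markov_coding Leb T P G K F"
    by (intro generating_markov_coding.intro generating_markov_coding_axioms.intro d open_approximation[OF d])
  then show ?thesis by blast
qed

text \<open>
  If \<open>A\<close> had measure strictly between zero and one, then conditioning \<open>\<mu>\<close> on \<open>A\<close> would give a second
  absolutely continuous invariant probability measure.
\<close>

lemma acip_ergodic:
  assumes mu: "A4 Y T \<mu>" and A: "A \<in> sets Leb" and sub: "pre 1 A \<subseteq> A" and pos: "0 < measure \<mu> A"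
  shows "measure \<mu> A = 1"
proof -
  have ac: "acip Y T \<mu>" and uniq: "\<And>\<nu>. acip Y T \<nu> \<Longrightarrow> \<nu> = \<mu>" using mu by (auto simp: A4_def)
  interpret prob_space \<mu> using ac by (simp add: acip_def)
  have sets_mu: "sets \<mu> = sets (restrict_space borel Y)" using ac by (simp add: acip_def)
  have sets_mu': "sets \<mu> = sets Leb" unfolding sets_mu by (rule sets_restrict_space_cong) simp
  have space_mu: "space \<mu> = Y" using sets_eq_imp_space_eq[OF sets_mu'] by simp
  have T: "T \<in> \<mu> \<rightarrow>\<^sub>M \<mu>" and inv: "distr \<mu> \<mu> T = \<mu>" using ac by (auto simp: acip_def invariant_measure_def)
  have acont: "absolutely_continuous (restrict_space lborel Y) \<mu>" using ac by (simp add: acip_def)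
  have A': "A \<in> sets \<mu>" using A sets_mu' by simp
  have pre: "T -` B \<inter> space \<mu> = pre 1 B" for B by (simp add: pre_def space_mu)
  have einv: "emeasure \<mu> (pre 1 B) = emeasure \<mu> B" if "B \<in> sets \<mu>" for B
    using emeasure_distr[OF T that] inv by (simp add: pre)
  \<comment> \<open>\<open>\<mu>\<close> conditioned on \<open>A\<close>\<close>
  define \<nu> where "\<nu> = density \<mu> (\<lambda>x. indicator A x / emeasure \<mu> A)"
  have nz: "emeasure \<mu> A \<noteq> 0" using pos by (simp add: emeasure_eq_measure)
  have nu: "emeasure \<nu> B = emeasure \<mu> (A \<inter> B) / emeasure \<mu> A" if "B \<in> sets \<mu>" for B
  proof -
    have "emeasure \<nu> B = (\<integral>\<^sup>+x. indicator (A \<inter> B) x / emeasure \<mu> A \<partial>\<mu>)"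
      unfolding \<nu>_def using A' that
      by (subst emeasure_density) (auto intro!: nn_integral_cong simp: indicator_def)
    also have "\<dots> = emeasure \<mu> (A \<inter> B) / emeasure \<mu> A"
      using A' that by (subst nn_integral_divide) auto
    finally show ?thesis .
  qed
  have snu: "sets \<nu> = sets \<mu>" by (simp add: \<nu>_def)
  have "acip Y T \<nu>"
    unfolding acip_def
  proof (intro conjI)
    show "sets \<nu> = sets (restrict_space borel Y)" using snu sets_mu by simp
    show "prob_space \<nu>"
    proof
      have "A \<inter> space \<mu> = A" using A' sets.sets_into_space by blast
      then show "emeasure \<nu> (space \<nu>) = 1"
        using nu[of "space \<mu>"] nz sets_eq_imp_space_eq[OF snu]
        by (simp add: ennreal_divide_self emeasure_eq_measure)
    qed
    show "invariant_measure \<nu> T"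
      unfolding invariant_measure_def
    proof
      show T': "T \<in> \<nu> \<rightarrow>\<^sub>M \<nu>" using T snu by (simp cong: measurable_cong_sets)
      show "distr \<nu> \<nu> T = \<nu>"
      proof (rule measure_eqI)
        fix B assume "B \<in> sets (distr \<nu> \<nu> T)"
        then have B: "B \<in> sets \<mu>" using snu by simp
        have pB: "pre 1 B \<in> sets \<mu>" "pre 1 (A \<inter> B) \<in> sets \<mu>" "pre 1 A \<in> sets \<mu>"
          using A B sets_mu' by auto
        have "emeasure (distr \<nu> \<nu> T) B = emeasure \<nu> (pre 1 B)"
          using T' B snu sets_eq_imp_space_eq[OF snu] by (subst emeasure_distr) (auto simp: pre)
        also have "\<dots> = emeasure \<mu> (A \<inter> pre 1 B) / emeasure \<mu> A" by (rule nu[OF pB(1)])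
        also have "emeasure \<mu> (A \<inter> pre 1 B) = emeasure \<mu> (pre 1 (A \<inter> B))"
        proof -
          have "emeasure \<mu> (A - pre 1 A) = emeasure \<mu> A - emeasure \<mu> (pre 1 A)"
            using A' pB sub by (intro emeasure_Diff) auto
          then have "emeasure \<mu> (A - pre 1 A) = 0" using einv[OF A'] by (simp add: emeasure_eq_measure)
          then have N: "A - pre 1 A \<in> null_sets \<mu>" using A' pB by (auto simp: null_sets_def)
          have "A \<inter> pre 1 B = pre 1 (A \<inter> B) \<union> ((A - pre 1 A) \<inter> pre 1 B)"
            using sub unfolding pre_Int by blast
          moreover have "(A - pre 1 A) \<inter> pre 1 B \<in> null_sets \<mu>"
            using N pB(1) by (rule null_set_Int2)
          ultimately show ?thesis using pB(2) by (simp add: emeasure_Un_null_set)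
        qed
        also have "\<dots> = emeasure \<mu> (A \<inter> B)" using A' B by (intro einv) auto
        also have "\<dots> / emeasure \<mu> A = emeasure \<nu> B" by (rule nu[OF B, symmetric])
        finally show "emeasure (distr \<nu> \<nu> T) B = emeasure \<nu> B" .
      qed (simp add: snu)
    qed
    show "absolutely_continuous (restrict_space lborel Y) \<nu>"
      unfolding absolutely_continuous_def
    proof
      fix N assume "N \<in> null_sets (restrict_space lborel Y)"
      then have N: "N \<in> null_sets \<mu>" using acont by (auto simp: absolutely_continuous_def)
      then have "A \<inter> N \<in> null_sets \<mu>" using A' by (rule null_set_Int1)
      then show "N \<in> null_sets \<nu>" using N nu[of N] snu by (auto simp: null_sets_def)
    qed
  qed
  then have eq: "\<nu> = \<mu>" by (rule uniq)
  have "emeasure \<mu> A = emeasure \<mu> (A \<inter> A) / emeasure \<mu> A" using nu[OF A'] unfolding eq .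
  also have "\<dots> = 1" using nz by (simp add: ennreal_divide_self emeasure_eq_measure)
  finally show ?thesis by (simp add: emeasure_eq_measure)
qed

lemma mixing_system_acip:
  assumes mu: "A4 Y T \<mu>" shows "\<exists>K F. mixing_system Leb T P G K F \<mu>"
proof -
  obtain K F where g: "generating_markov_coding Leb T P G K F" using generating_coding by blast
  have ac: "acip Y T \<mu>" using mu by (auto simp: A4_def)
  have sets_mu: "sets \<mu> = sets (restrict_space borel Y)" using ac by (simp add: acip_def)
  have sets_mu': "sets \<mu> = sets Leb" unfolding sets_mu by (rule sets_restrict_space_cong) simp
  have space_mu: "space \<mu> = Y" using sets_eq_imp_space_eq[OF sets_mu'] by simp
  have "mixing_system Leb T P G K F \<mu>"
  proof (intro mixing_system.intro g mixing_system_axioms.intro sets_mu')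
    show "prob_space \<mu>" "absolutely_continuous Leb \<mu>" using ac by (auto simp: acip_def)
    show "measure \<mu> (pre 1 A) = measure \<mu> A" if A: "A \<in> sets Leb" for A
    proof -
      have "T \<in> \<mu> \<rightarrow>\<^sub>M \<mu>" "distr \<mu> \<mu> T = \<mu>" using ac by (auto simp: acip_def invariant_measure_def)
      then have "measure \<mu> A = measure \<mu> (T -` A \<inter> space \<mu>)"
        using measure_distr[of T \<mu> \<mu> A] A sets_mu' by simp
      then show ?thesis by (simp add: pre_def space_mu)
    qed
    show "measure \<mu> A = 1" if "A \<in> sets Leb" "pre 1 A \<subseteq> A" "0 < measure \<mu> A" for A
      using acip_ergodic[OF mu that] .
  qed
  then show ?thesis by blast
qed

lemma acip_hitting_time_tail:
  assumes mu: "A4 Y T \<mu>"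
  obtains C c where "0 < C" "0 < c"
    "\<And>B q b k. determined q B \<Longrightarrow> 1 \<le> q \<Longrightarrow> 0 < b \<Longrightarrow> b \<le> measure \<mu> B \<Longrightarrow>
       measure \<mu> (miss B k) \<le> C * exp (- (c * b * real k / (real q + 1 + ln (1 / b))))"
proof -
  obtain K F where ms: "mixing_system Leb T P G K F \<mu>" using mixing_system_acip[OF mu] by blast
  interpret ms: mixing_system Leb T P G K F \<mu> by (rule ms)
  show ?thesis by (rule ms.hitting_time_tail) (rule that)
qed

end

section \<open>Tails of the return time\<close>

lemma powr_increment_bounds:
  fixes b t :: real assumes b: "0 < b" and t: "1 \<le> t"
  shows "t powr (- b) - (t + 1) powr (- b) \<le> b * t powr (- b - 1)"
    and "b * 2 powr (- b - 1) * t powr (- b - 1) \<le> t powr (- b) - (t + 1) powr (- b)"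
proof -
  have "\<exists>z. t < z \<and> z < t + 1 \<and>
      (t + 1) powr (- b) - t powr (- b) = ((t + 1) - t) * (- b * z powr (- b - 1))"
  proof (rule MVT2)
    fix x assume "t \<le> x" "x \<le> t + 1"
    then show "((\<lambda>x. x powr (- b)) has_real_derivative - b * x powr (- b - 1)) (at x)"
      using t by (intro has_real_derivative_powr) auto
  qed simp
  then obtain z where z: "t < z" "z < t + 1"
    and eq: "t powr (- b) - (t + 1) powr (- b) = b * z powr (- b - 1)" by auto
  have "z powr (- b - 1) \<le> t powr (- b - 1)" using z t b by (intro powr_mono2') auto
  then show "t powr (- b) - (t + 1) powr (- b) \<le> b * t powr (- b - 1)"
    unfolding eq using b by simp
  have "(2 * t) powr (- b - 1) \<le> z powr (- b - 1)" using z t b by (intro powr_mono2') auto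
  then have "2 powr (- b - 1) * t powr (- b - 1) \<le> z powr (- b - 1)" using t by (simp add: powr_mult)
  then show "b * 2 powr (- b - 1) * t powr (- b - 1) \<le> t powr (- b) - (t + 1) powr (- b)"
    unfolding eq using b by (simp add: mult.assoc)
qed

lemma sum_powr_bound:
  fixes b :: real assumes b: "0 < b" "b < 1"
  shows "(\<Sum>t=1..u. real t powr (- b)) \<le> real u powr (1 - b) / (1 - b)"
proof (induction u)
  case (Suc u)
  have "(1 - b) * real (Suc u) powr (- b) \<le> real (Suc u) powr (1 - b) - real u powr (1 - b)"
  proof (cases "u = 0")
    case True then show ?thesis using b by simp
  next
    case False
    have "\<exists>z. real u < z \<and> z < real u + 1 \<and>
      (real u + 1) powr (1 - b) - real u powr (1 - b) = ((real u + 1) - real u) * ((1 - b) * z powr (1 - b - 1))"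
    proof (rule MVT2)
      fix x assume "real u \<le> x" "x \<le> real u + 1"
      then show "((\<lambda>x. x powr (1 - b)) has_real_derivative (1 - b) * x powr (1 - b - 1)) (at x)"
        using False by (intro has_real_derivative_powr) auto
    qed simp
    then obtain z where z: "real u < z" "z < real u + 1"
      and eq: "(real u + 1) powr (1 - b) - real u powr (1 - b) = (1 - b) * z powr (- b)" by auto
    have "(real u + 1) powr (- b) \<le> z powr (- b)" using z b by (intro powr_mono2') auto
    then have "(1 - b) * (real u + 1) powr (- b) \<le> (1 - b) * z powr (- b)"
      using b by (intro mult_left_mono) auto
    then show ?thesis using eq by (simp add: add.commute)
  qed
  then have "real (Suc u) powr (- b) \<le> (real (Suc u) powr (1 - b) - real u powr (1 - b)) / (1 - b)"
    using b by (simp add: field_simps)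
  then show ?case using Suc.IH by (simp add: diff_divide_distrib)
qed (use b in simp)

lemma (in prob_space) prob_indicator_sum_ge:
  assumes "finite I" and A: "\<And>i. i \<in> I \<Longrightarrow> A i \<in> events" and u: "0 < u"
  shows "prob {x \<in> space M. u \<le> (\<Sum>i\<in>I. indicator (A i) x :: real)} \<le> (\<Sum>i\<in>I. prob (A i)) / u"
proof -
  have int: "integrable M (\<lambda>x. \<Sum>i\<in>I. indicator (A i) x :: real)"
    using A by (intro Bochner_Integration.integrable_sum integrable_real_indicator) (auto simp: emeasure_eq_measure)
  have "prob {x \<in> space M. u \<le> (\<Sum>i\<in>I. indicator (A i) x :: real)} \<le>
      (\<integral>x. (\<Sum>i\<in>I. indicator (A i) x :: real) \<partial>M) / u"
    using int u by (intro integral_Markov_inequality_measure[where A = "space M"]) (auto intro!: sum_nonneg)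
  also have "(\<integral>x. (\<Sum>i\<in>I. indicator (A i) x :: real) \<partial>M) = (\<Sum>i\<in>I. prob (A i))"
    using A by (subst Bochner_Integration.integral_sum) (auto intro!: integrable_real_indicator simp: emeasure_eq_measure)
  finally show ?thesis .
qed

text \<open>
  Reduces moments of truncated return times to the measures of their tails.
\<close>

lemma sum_indicator_le:
  "(\<Sum>t=1..u. indicator {x. t \<le> g x} x :: real) = real (min (g x) (u::nat))"
proof -
  have "(\<Sum>t=1..u. indicator {x. t \<le> g x} x :: real) = (\<Sum>t\<in>{1..u}. if t \<le> g x then 1 else 0)"
    by (intro sum.cong) (auto simp: indicator_def)
  also have "\<dots> = real (card ({1..u} \<inter> {t. t \<le> g x}))" by (simp add: sum.If_cases)
  also have "{1..u} \<inter> {t. t \<le> g x} = {1..min (g x) u}" by auto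
  finally show ?thesis by simp
qed

text \<open>
  Used with a tail minus a multiple of a power: bounds on the increments of a tail determine its size,
  because both terms tend to zero.
\<close>

lemma limit_zero_nonneg:
  fixes g :: "nat \<Rightarrow> real"
  assumes "g \<longlonglongrightarrow> 0" "\<And>t. n0 \<le> t \<Longrightarrow> g (Suc t) \<le> g t" "n0 \<le> t"
  shows "0 \<le> g t"
proof -
  have "decseq (\<lambda>i. g (i + n0))" using assms(2) by (intro decseq_SucI) auto
  moreover have "(\<lambda>i. g (i + n0)) \<longlonglongrightarrow> 0" using assms(1) by (rule LIMSEQ_ignore_initial_segment)
  ultimately have "0 \<le> g ((t - n0) + n0)" by (rule decseq_ge)
  then show ?thesis using assms(3) by simp
qed

locale induced_setting =
  fixes M :: "real measure" and f :: "real \<Rightarrow> real" and Y :: "real set" and \<beta> :: real and P :: "nat \<Rightarrow> real set"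
  assumes X_borel: "space M \<in> sets borel" and M_sets: "sets M = sets (restrict_space borel (space M))"
    and inv: "invariant_measure M f" and cons: "conservative M f" and erg: "ergodic M f"
    and YX: "Y \<subseteq> space M"
    and A1: "A1 Y (first_return f Y) P" and A2: "A2 (first_return f Y) P" and A3: "A3 (first_return f Y) P"
    and A4: "A4 Y (first_return f Y) (restrict_space M Y)" and A5: "A5 (return_time f Y) P"
    and A6: "A6 Y (return_time f Y) (restrict_space M Y) \<beta>"
begin

abbreviation "T \<equiv> first_return f Y"
abbreviation "R \<equiv> return_time f Y"
abbreviation "\<mu> \<equiv> restrict_space M Y"

lemma sets_mu: "sets \<mu> = sets (restrict_space borel Y)"
  using A4 by (simp add: A4_def acip_def)

sublocale mu: prob_space \<mu>
  using A4 by (simp add: A4_def acip_def)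

lemma T_borel: "T \<in> restrict_space borel Y \<rightarrow>\<^sub>M restrict_space borel Y"
  using A4 sets_mu by (simp add: A4_def acip_def invariant_measure_def cong: measurable_cong_sets)

sublocale im: interval_map Y T P
  by (intro interval_map.intro A1 A2 A3 T_borel)

lemma beta: "0 < \<beta>" "\<beta> < 1"
  using A6 by (auto simp: A6_def)

lemma sets_M: "A \<in> sets M \<longleftrightarrow> A \<in> sets borel \<and> A \<subseteq> space M"
  unfolding M_sets by (subst sets_restrict_space_iff) (use X_borel in auto)

lemma Y_M [measurable]: "Y \<in> sets M"
  using im.Y_borel YX by (simp add: sets_M)

lemma space_mu: "space \<mu> = Y"
  using YX by (auto simp: space_restrict_space)

lemma sets_mu_iff: "A \<in> sets \<mu> \<longleftrightarrow> A \<in> sets M \<and> A \<subseteq> Y"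
  by (subst sets_restrict_space_iff) (use Y_M YX in \<open>auto simp: Int_absorb1\<close>)

lemma sets_mu_Leb: "sets \<mu> = sets im.Leb"
  unfolding sets_mu by (rule sets_restrict_space_cong) simp

lemma emeasure_mu: "A \<subseteq> Y \<Longrightarrow> emeasure \<mu> A = emeasure M A"
  by (rule emeasure_restrict_space) (use Y_M YX in \<open>auto simp: Int_absorb1\<close>)

lemma f_meas [measurable]: "f \<in> M \<rightarrow>\<^sub>M M"
  using inv by (simp add: invariant_measure_def)

lemma fn_meas [measurable]: "(f ^^ n) \<in> M \<rightarrow>\<^sub>M M"
  by (induction n) (auto intro: measurable_comp)

lemma f_emeasure: "A \<in> sets M \<Longrightarrow> emeasure M (f -` A \<inter> space M) = emeasure M A"
  using inv emeasure_distr[of f M M A] by (simp add: invariant_measure_def)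

lemma fn_space: "x \<in> space M \<Longrightarrow> (f ^^ n) x \<in> space M"
  using measurable_space[OF fn_meas] .

lemma return_pos: "R x \<noteq> 0 \<Longrightarrow> (f ^^ R x) x \<in> Y \<and> (\<forall>i. 1 \<le> i \<and> i < R x \<longrightarrow> (f ^^ i) x \<notin> Y)"
proof -
  assume "R x \<noteq> 0"
  then have ex: "\<exists>n. 1 \<le> n \<and> (f ^^ n) x \<in> Y" and R: "R x = (LEAST n. 1 \<le> n \<and> (f ^^ n) x \<in> Y)"
    by (auto simp: return_time_def split: if_splits)
  show ?thesis using LeastI_ex[OF ex] not_less_Least[of _ "\<lambda>n. 1 \<le> n \<and> (f ^^ n) x \<in> Y"]
    unfolding R[symmetric] by blast
qed

lemma R_ge_iff: "(1 \<le> t \<and> t \<le> R x) \<longleftrightarrow>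
    1 \<le> t \<and> (\<forall>i\<in>{1..<t}. (f ^^ i) x \<notin> Y) \<and> (\<exists>n. t \<le> n \<and> (f ^^ n) x \<in> Y)"
proof
  assume "1 \<le> t \<and> t \<le> R x"
  then show "1 \<le> t \<and> (\<forall>i\<in>{1..<t}. (f ^^ i) x \<notin> Y) \<and> (\<exists>n. t \<le> n \<and> (f ^^ n) x \<in> Y)"
    using return_pos[of x] by auto
next
  assume r: "1 \<le> t \<and> (\<forall>i\<in>{1..<t}. (f ^^ i) x \<notin> Y) \<and> (\<exists>n. t \<le> n \<and> (f ^^ n) x \<in> Y)"
  then have ex: "\<exists>n\<ge>1. (f ^^ n) x \<in> Y" by (meson order_trans)
  then have R: "R x = (LEAST n. 1 \<le> n \<and> (f ^^ n) x \<in> Y)" by (simp add: return_time_def)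
  have "1 \<le> R x \<and> (f ^^ R x) x \<in> Y" unfolding R using LeastI_ex[of "\<lambda>n. 1 \<le> n \<and> (f ^^ n) x \<in> Y"] ex by blast
  then have "\<not> R x < t" using r by auto
  then show "1 \<le> t \<and> t \<le> R x" using r by simp
qed

definition tail :: "nat \<Rightarrow> real set" where "tail t = {x \<in> Y. t \<le> R x}"

lemma tail_M [measurable]: "tail t \<in> sets M"
proof (cases "t = 0")
  case True then show ?thesis by (simp add: tail_def)
next
  case False
  have "tail t = Y \<inter> (space M - (\<Union>i\<in>{1..<t}. (f ^^ i) -` Y \<inter> space M)) \<inter> (\<Union>n\<in>{t..}. (f ^^ n) -` Y \<inter> space M)"
  proof (intro set_eqI)
    fix x
    have t: "1 \<le> t" using False by simp
    have "x \<in> tail t \<longleftrightarrow> x \<in> Y \<and> (\<forall>i\<in>{1..<t}. (f ^^ i) x \<notin> Y) \<and> (\<exists>n. t \<le> n \<and> (f ^^ n) x \<in> Y)"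
      using R_ge_iff[of t x] t unfolding tail_def by blast
    also have "\<dots> \<longleftrightarrow> x \<in> Y \<inter> (space M - (\<Union>i\<in>{1..<t}. (f ^^ i) -` Y \<inter> space M)) \<inter> (\<Union>n\<in>{t..}. (f ^^ n) -` Y \<inter> space M)"
      using YX by (cases "x \<in> Y") (auto dest: subsetD)
    finally show "x \<in> tail t \<longleftrightarrow> \<dots>" .
  qed
  also have "\<dots> \<in> sets M"
    by (intro sets.Int sets.Diff sets.finite_UN sets.countable_UN'' Y_M sets.top measurable_sets[OF fn_meas]) auto
  finally show ?thesis .
qed

lemma tail_mu [measurable]: "tail t \<in> sets \<mu>"
proof -
  have "tail t \<subseteq> Y" by (auto simp: tail_def)
  then show ?thesis using tail_M by (simp only: sets_mu_iff simp_thms)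
qed

lemma tail_Leb [measurable]: "tail t \<in> sets im.Leb"
  using tail_mu sets_mu_Leb by simp

lemma measure_tail_diff: "measure \<mu> (tail t) - measure \<mu> (tail (Suc t)) = measure \<mu> {x \<in> Y. R x = t}"
proof -
  have "{x \<in> Y. R x = t} = tail t - tail (Suc t)" by (auto simp: tail_def)
  moreover have "tail (Suc t) \<subseteq> tail t" by (auto simp: tail_def)
  ultimately show ?thesis using mu.finite_measure_Diff[OF tail_mu tail_mu, of "Suc t" t] by simp
qed

lemma tail_tendsto: "(\<lambda>t. measure \<mu> (tail t)) \<longlonglongrightarrow> 0"
proof -
  have "(\<lambda>t. measure \<mu> (tail t)) \<longlonglongrightarrow> measure \<mu> (\<Inter>t. tail t)"
  proof (rule mu.finite_Lim_measure_decseq)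
    show "range tail \<subseteq> sets \<mu>" using tail_mu by blast
    show "decseq tail" unfolding decseq_def tail_def by auto
  qed
  also have "(\<Inter>t. tail t) = {}"
  proof -
    have "x \<notin> tail (Suc (R x))" for x by (simp add: tail_def)
    then show ?thesis by blast
  qed
  finally show ?thesis by simp
qed

lemma return_tail:
  obtains c n0 where "0 < c" "1 \<le> n0"
    "\<And>t. n0 \<le> t \<Longrightarrow> inverse c * real t powr (- \<beta> - 1) \<le> measure \<mu> {x \<in> Y. R x = t}"
    "\<And>t. n0 \<le> t \<Longrightarrow> measure \<mu> {x \<in> Y. R x = t} \<le> c * real t powr (- \<beta> - 1)"
proof -
  obtain c where c: "0 < c" and ev: "\<forall>\<^sub>F n in sequentially.
      inverse c \<le> measure \<mu> {x\<in>Y. R x = n} / real n powr (- \<beta> - 1) \<and>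
      measure \<mu> {x\<in>Y. R x = n} / real n powr (- \<beta> - 1) \<le> c"
    using A6 unfolding A6_def comparable_def by blast
  then obtain n0 where n0: "\<forall>n\<ge>n0. inverse c \<le> measure \<mu> {x\<in>Y. R x = n} / real n powr (- \<beta> - 1) \<and>
      measure \<mu> {x\<in>Y. R x = n} / real n powr (- \<beta> - 1) \<le> c"
    unfolding eventually_sequentially by blast
  have "inverse c * real t powr (- \<beta> - 1) \<le> measure \<mu> {x \<in> Y. R x = t} \<and>
    measure \<mu> {x \<in> Y. R x = t} \<le> c * real t powr (- \<beta> - 1)" if "max 1 n0 \<le> t" for t
  proof -
    have "0 < real t powr (- \<beta> - 1)" using that by simp
    then show ?thesis using n0[rule_format, of t] that by (simp add: pos_le_divide_eq pos_divide_le_eq)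
  qed
  then show ?thesis using c by (intro that[of c "max 1 n0"]) auto
qed

lemma tail_excess_tendsto: "(\<lambda>t. measure \<mu> (tail t) - d * real t powr (- \<beta>)) \<longlonglongrightarrow> 0"
proof -
  have "(\<lambda>t. real t powr (- \<beta>)) \<longlonglongrightarrow> 0"
    using beta by (intro tendsto_neg_powr filterlim_real_sequentially) auto
  from tendsto_diff[OF tail_tendsto tendsto_mult_left[OF this, of d]] show ?thesis by simp
qed

lemma tail_upper: obtains C where "0 < C" "\<And>t. 1 \<le> t \<Longrightarrow> measure \<mu> (tail t) \<le> C * real t powr (- \<beta>)"
proof -
  obtain c n0 where c: "0 < c" "1 \<le> n0"
    "\<And>t. n0 \<le> t \<Longrightarrow> measure \<mu> {x \<in> Y. R x = t} \<le> c * real t powr (- \<beta> - 1)" by (rule return_tail) blast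
  define d where "d = c / (\<beta> * 2 powr (- \<beta> - 1))"
  have d: "0 < d" using c beta by (simp add: d_def)
  define g where "g t = - (measure \<mu> (tail t) - d * real t powr (- \<beta>))" for t
  have step: "g (Suc t) \<le> g t" if "n0 \<le> t" for t
  proof -
    have "measure \<mu> (tail t) - measure \<mu> (tail (Suc t)) \<le> c * real t powr (- \<beta> - 1)"
      using c(3)[OF that] by (simp add: measure_tail_diff)
    also have "\<dots> = d * (\<beta> * 2 powr (- \<beta> - 1) * real t powr (- \<beta> - 1))"
      using beta by (simp add: d_def)
    also have "\<dots> \<le> d * (real t powr (- \<beta>) - (real t + 1) powr (- \<beta>))"
      using d c(2) that beta by (intro mult_left_mono powr_increment_bounds(2)) auto
    finally show ?thesis by (simp add: g_def algebra_simps)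
  qed
  have "g \<longlonglongrightarrow> 0" unfolding g_def using tendsto_minus[OF tail_excess_tendsto] by simp
  then have "0 \<le> g t" if "n0 \<le> t" for t using step that by (rule limit_zero_nonneg)
  then have big: "measure \<mu> (tail t) \<le> d * real t powr (- \<beta>)" if "n0 \<le> t" for t
    using that by (simp add: g_def)
  define C where "C = d + real n0 powr \<beta>"
  have "measure \<mu> (tail t) \<le> C * real t powr (- \<beta>)" if t: "1 \<le> t" for t
  proof (cases "n0 \<le> t")
    case True
    have "d * real t powr (- \<beta>) \<le> C * real t powr (- \<beta>)" by (intro mult_right_mono) (auto simp: C_def)
    then show ?thesis using big[OF True] by linarith
  next
    case False
    have "1 \<le> (real n0 / real t) powr \<beta>" using False t beta by (intro ge_one_powr_ge_zero) auto
    also have "\<dots> = real n0 powr \<beta> * real t powr (- \<beta>)" by (simp add: powr_divide powr_minus_divide)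
    also have "\<dots> \<le> C * real t powr (- \<beta>)" using d by (intro mult_right_mono) (auto simp: C_def)
    finally show ?thesis using mu.prob_le_1[of "tail t"] by linarith
  qed
  then show ?thesis using d by (intro that[of C]) (auto simp: C_def add_pos_nonneg)
qed

lemma tail_lower: obtains c n0 where "0 < c" "1 \<le> n0" "\<And>t. n0 \<le> t \<Longrightarrow> c * real t powr (- \<beta>) \<le> measure \<mu> (tail t)"
proof -
  obtain c n0 where c: "0 < c" "1 \<le> n0"
    "\<And>t. n0 \<le> t \<Longrightarrow> inverse c * real t powr (- \<beta> - 1) \<le> measure \<mu> {x \<in> Y. R x = t}" by (rule return_tail) blast
  define d where "d = inverse c / \<beta>"
  have d: "0 < d" using c beta by (simp add: d_def)
  define g where "g t = measure \<mu> (tail t) - d * real t powr (- \<beta>)" for t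
  have step: "g (Suc t) \<le> g t" if "n0 \<le> t" for t
  proof -
    have "d * (real t powr (- \<beta>) - (real t + 1) powr (- \<beta>)) \<le> d * (\<beta> * real t powr (- \<beta> - 1))"
      using d c(2) that beta by (intro mult_left_mono powr_increment_bounds(1)) auto
    also have "\<dots> = inverse c * real t powr (- \<beta> - 1)" using beta by (simp add: d_def)
    also have "\<dots> \<le> measure \<mu> (tail t) - measure \<mu> (tail (Suc t))"
      using c(3)[OF that] by (simp add: measure_tail_diff)
    finally show ?thesis by (simp add: g_def algebra_simps)
  qed
  have "g \<longlonglongrightarrow> 0" unfolding g_def by (rule tail_excess_tendsto)
  then have "0 \<le> g t" if "n0 \<le> t" for t using step that by (rule limit_zero_nonneg)
  then have "d * real t powr (- \<beta>) \<le> measure \<mu> (tail t)" if "n0 \<le> t" for t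
    using that by (simp add: g_def)
  then show ?thesis using d c(2) that by blast
qed

definition return_sum :: "nat \<Rightarrow> real \<Rightarrow> nat" where "return_sum k x = (\<Sum>j<k. R ((T ^^ j) x))"

lemma return_sum_mono: "i \<le> j \<Longrightarrow> return_sum i x \<le> return_sum j x"
  unfolding return_sum_def by (rule sum_mono2) auto

lemma f_return_sum: "(f ^^ return_sum k x) x = (T ^^ k) x"
proof (induction k)
  case (Suc k)
  have "(f ^^ return_sum (Suc k) x) x = (f ^^ R ((T ^^ k) x)) ((f ^^ return_sum k x) x)"
    unfolding return_sum_def sum.lessThan_Suc by (simp add: funpow_add add.commute)
  also have "\<dots> = (f ^^ R ((T ^^ k) x)) ((T ^^ k) x)" using Suc by simp
  also have "\<dots> = T ((T ^^ k) x)" by (rule first_return_def[symmetric])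
  finally show ?case by simp
qed (simp add: return_sum_def)

lemma excursion: "n < return_sum k x \<Longrightarrow> \<exists>j<k. \<exists>i<R ((T ^^ j) x). (f ^^ n) x = (f ^^ i) ((T ^^ j) x)"
proof (induction k)
  case (Suc k)
  show ?case
  proof (cases "n < return_sum k x")
    case True then show ?thesis using Suc.IH less_SucI by blast
  next
    case False
    define i where "i = n - return_sum k x"
    have "i < R ((T ^^ k) x)" using Suc.prems False by (simp add: i_def return_sum_def)
    moreover have "(f ^^ n) x = (f ^^ i) ((T ^^ k) x)"
    proof -
      have "(f ^^ (i + return_sum k x)) x = (f ^^ i) ((f ^^ return_sum k x) x)" by (simp only: funpow_add comp_apply)
      then show ?thesis using False by (simp add: i_def f_return_sum)
    qed
    ultimately show ?thesis by blast
  qed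
qed (simp add: return_sum_def)

lemma measure_mu_pre: "A \<in> sets \<mu> \<Longrightarrow> measure \<mu> (im.pre n A) = measure \<mu> A"
proof -
  obtain K F where "mixing_system im.Leb T P im.G K F \<mu>" using im.mixing_system_acip[OF A4] by blast
  then interpret ms: mixing_system im.Leb T P im.G K F \<mu> .
  show "A \<in> sets \<mu> \<Longrightarrow> measure \<mu> (im.pre n A) = measure \<mu> A"
    using ms.mu_pre sets_mu_Leb by simp
qed

text \<open>
  The event that the first \<open>k\<close> return times, each truncated at \<open>u\<close>, add up to \<open>u\<close> or more.
\<close>

definition long :: "nat \<Rightarrow> nat \<Rightarrow> real set" where
  "long k u = {x \<in> space \<mu>. real u \<le> (\<Sum>(j, t)\<in>{..<k} \<times> {1..u}. indicator (im.pre j (tail t)) x)}"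

lemma long_sets [measurable]: "long k u \<in> sets \<mu>"
proof -
  have "im.pre j (tail t) \<in> sets \<mu>" for j t using tail_Leb sets_mu_Leb by auto
  then show ?thesis unfolding long_def by (intro measurable) auto
qed

text \<open>
  Markov's inequality for the sum of the truncated return times, whose mean is at most
  \<open>k\<close> times the sum of \<open>C * t powr (- \<beta>)\<close> up to \<open>u\<close>, hence of order \<open>k * u powr (1 - \<beta>)\<close>.
\<close>

lemma long_bound: obtains C where "0 < C" "\<And>k u. 1 \<le> u \<Longrightarrow> measure \<mu> (long k u) \<le> C * real k * real u powr (- \<beta>)"
proof -
  obtain C where C: "0 < C" "\<And>t. 1 \<le> t \<Longrightarrow> measure \<mu> (tail t) \<le> C * real t powr (- \<beta>)" by (rule tail_upper) blast
  have "measure \<mu> (long k u) \<le> C / (1 - \<beta>) * real k * real u powr (- \<beta>)" if u: "1 \<le> u" for k u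
  proof -
    have "measure \<mu> (long k u) \<le> (\<Sum>(j, t)\<in>{..<k} \<times> {1..u}. measure \<mu> (im.pre j (tail t))) / real u"
      unfolding long_def case_prod_beta using u tail_Leb sets_mu_Leb
      by (intro mu.prob_indicator_sum_ge) auto
    also have "(\<Sum>(j, t)\<in>{..<k} \<times> {1..u}. measure \<mu> (im.pre j (tail t))) = real k * (\<Sum>t=1..u. measure \<mu> (tail t))"
      by (simp add: measure_mu_pre[OF tail_mu] sum.cartesian_product[symmetric])
    also have "(\<Sum>t=1..u. measure \<mu> (tail t)) \<le> (\<Sum>t=1..u. C * real t powr (- \<beta>))" by (intro sum_mono C) auto
    also have "\<dots> = C * (\<Sum>t=1..u. real t powr (- \<beta>))" by (simp add: sum_distrib_left)
    also have "\<dots> \<le> C * (real u powr (1 - \<beta>) / (1 - \<beta>))"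
      using C beta by (intro mult_left_mono sum_powr_bound) auto
    also have "real k * (C * (real u powr (1 - \<beta>) / (1 - \<beta>))) / real u = C / (1 - \<beta>) * real k * real u powr (- \<beta>)"
      using u by (simp add: powr_diff powr_minus_divide mult.commute)
    finally show ?thesis by (simp add: divide_right_mono mult_left_mono)
  qed
  then show ?thesis using C beta by (intro that[of "C / (1 - \<beta>)"]) auto
qed

text \<open>
  A single return time of at least \<open>u\<close> already makes the truncated sum reach \<open>u\<close>.
\<close>

lemma return_sum_less: assumes x: "x \<in> Y" and n: "x \<notin> long k u" shows "return_sum k x < u"
proof (rule ccontr)
  assume "\<not> return_sum k x < u"
  then have u: "u \<le> return_sum k x" by simp
  have ind: "indicator (im.pre j (tail t)) x = (indicator {x. t \<le> R ((T ^^ j) x)} x :: real)" for j t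
    using x im.Tn_space[of x j] by (auto simp: indicator_def im.pre_def tail_def)
  have "(\<Sum>(j, t)\<in>{..<k} \<times> {1..u}. indicator (im.pre j (tail t)) x :: real) =
      (\<Sum>j<k. \<Sum>t=1..u. indicator {x. t \<le> R ((T ^^ j) x)} x)"
    unfolding sum.cartesian_product[symmetric] ind ..
  also have "\<dots> = (\<Sum>j<k. real (min (R ((T ^^ j) x)) u))"
    by (intro sum.cong refl) (rule sum_indicator_le)
  also have "\<dots> = real (\<Sum>j<k. min (R ((T ^^ j) x)) u)" by simp
  finally have eq: "(\<Sum>(j, t)\<in>{..<k} \<times> {1..u}. indicator (im.pre j (tail t)) x :: real) =
    real (\<Sum>j<k. min (R ((T ^^ j) x)) u)" .
  have "u \<le> (\<Sum>j<k. min (R ((T ^^ j) x)) u)"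
  proof (cases "\<exists>j<k. u \<le> R ((T ^^ j) x)")
    case True
    then obtain j where j: "j < k" "u \<le> R ((T ^^ j) x)" by blast
    have "min (R ((T ^^ j) x)) u \<le> (\<Sum>j<k. min (R ((T ^^ j) x)) u)"
      using j by (intro member_le_sum) auto
    then show ?thesis using j by simp
  next
    case False
    then have "(\<Sum>j<k. min (R ((T ^^ j) x)) u) = return_sum k x"
      unfolding return_sum_def by (intro sum.cong) (auto simp: min_def not_le)
    then show ?thesis using u by simp
  qed
  then have "real u \<le> (\<Sum>(j, t)\<in>{..<k} \<times> {1..u}. indicator (im.pre j (tail t)) x :: real)"
    unfolding eq by (simp only: of_nat_le_iff)
  then have "x \<in> long k u" unfolding long_def space_mu using x by simp
  then show False using n by simp
qed


section \<open>Excursions and recurrence\<close>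

lemma fn_null: assumes "N \<in> null_sets M" shows "(f ^^ n) -` N \<inter> space M \<in> null_sets M"
proof (induction n)
  case 0
  have "(f ^^ 0) -` N \<inter> space M = N" using sets.sets_into_space[OF null_setsD2[OF assms]] by auto
  then show ?case using assms by simp
next
  case (Suc n)
  let ?A = "(f ^^ n) -` N \<inter> space M"
  have "(f ^^ Suc n) -` N \<inter> space M = f -` ?A \<inter> space M"
    using measurable_space[OF f_meas] by (auto simp: funpow_swap1)
  moreover have "f -` ?A \<inter> space M \<in> null_sets M"
    using f_emeasure[OF null_setsD2[OF Suc]] null_setsD1[OF Suc] measurable_sets[OF f_meas null_setsD2[OF Suc]]
    by (intro null_setsI) simp_all
  ultimately show ?case by (simp only:)
qed

definition excursion_hits :: "real set \<Rightarrow> real set" where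
  "excursion_hits U = (\<Union>i. tail (Suc i) \<inter> ((f ^^ i) -` U \<inter> space M))"

lemma excursion_hits_sets: "U \<in> sets M \<Longrightarrow> excursion_hits U \<in> sets M"
  unfolding excursion_hits_def by (intro sets.countable_UN'' countableI_type sets.Int tail_M measurable_sets[OF fn_meas])

lemma excursion_hits_sub: "excursion_hits U \<subseteq> Y"
  by (auto simp: excursion_hits_def tail_def)

text \<open>
  A point of \<open>D k\<close> starts in \<open>Y\<close>, has not returned up to time \<open>k\<close>, and is in \<open>U\<close> at that time; a point of \<open>E k\<close>
  is in \<open>U\<close> at time \<open>k\<close> and has been outside \<open>Y\<close> all the time. The preimage of \<open>E k\<close> is the disjoint union of
  \<open>D (k + 1)\<close> and \<open>E (k + 1)\<close>, so invariance peels the sets \<open>D k\<close> off the mass of \<open>U\<close> one after the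
  other. This is the inequality half of Kac's formula.
\<close>

lemma excursion_hits_emeasure:
  assumes U: "U \<in> sets M" shows "emeasure M (excursion_hits U) \<le> emeasure M U"
proof -
  define N where "N a k = space M - (\<Union>i\<in>{a..k}. (f ^^ i) -` Y \<inter> space M)" for a k :: nat
  define D where "D k = Y \<inter> N 1 k \<inter> ((f ^^ k) -` U \<inter> space M)" for k
  define E where "E k = N 0 k \<inter> ((f ^^ k) -` U \<inter> space M)" for k
  have Ns: "N a k \<in> sets M" for a k
    unfolding N_def by (intro sets.Diff sets.top sets.finite_UN measurable_sets[OF fn_meas] Y_M) auto
  have Ds: "D k \<in> sets M" and Es: "E k \<in> sets M" for k
    unfolding D_def E_def by (intro sets.Int Y_M Ns measurable_sets[OF fn_meas] U)+
  have main: "(\<Sum>k<Suc n. emeasure M (D k)) + emeasure M (E n) = emeasure M U" for n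
  proof (induction n)
    case 0
    have "D 0 \<union> E 0 = U" "D 0 \<inter> E 0 = {}"
      using sets.sets_into_space[OF U] YX by (auto simp: D_def E_def N_def)
    then show ?case using plus_emeasure[OF Ds Es, of 0 0] by simp
  next
    case (Suc n)
    have "f -` E n \<inter> space M = D (Suc n) \<union> E (Suc n)"
    proof (intro set_eqI)
      fix x
      have sh: "(f ^^ i) (f x) = (f ^^ Suc i) x" for i by (simp add: funpow_swap1)
      have "x \<in> f -` E n \<inter> space M \<longleftrightarrow> x \<in> space M \<and> (\<forall>i\<le>n. (f ^^ Suc i) x \<notin> Y) \<and> (f ^^ Suc n) x \<in> U"
        using measurable_space[OF f_meas, of x] unfolding E_def N_def vimage_eq Int_iff Diff_iff UN_iff sh
        by (auto simp del: funpow.simps)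
      also have "\<dots> \<longleftrightarrow> x \<in> space M \<and> (\<forall>i\<in>{1..Suc n}. (f ^^ i) x \<notin> Y) \<and> (f ^^ Suc n) x \<in> U"
      proof -
        have "(\<forall>i\<le>n. Q (Suc i)) \<longleftrightarrow> (\<forall>i\<in>{1..Suc n}. Q i)" for Q :: "nat \<Rightarrow> bool"
        proof (intro iffI ballI allI impI)
          fix i assume a: "\<forall>i\<le>n. Q (Suc i)" "i \<in> {1..Suc n}"
          then obtain k where "i = Suc k" by (cases i) auto
          then show "Q i" using a by simp
        qed auto
        from this[of "\<lambda>i. (f ^^ i) x \<notin> Y"] show ?thesis by blast
      qed
      also have "\<dots> \<longleftrightarrow> x \<in> D (Suc n) \<union> E (Suc n)"
      proof -
        have "{0..Suc n} = insert 0 {1..Suc n}" by auto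
        then show ?thesis using YX unfolding D_def E_def N_def by (auto simp del: funpow.simps simp: funpow_0)
      qed
      finally show "x \<in> f -` E n \<inter> space M \<longleftrightarrow> x \<in> D (Suc n) \<union> E (Suc n)" .
    qed
    moreover have "D (Suc n) \<inter> E (Suc n) = {}" by (auto simp: D_def E_def N_def)
    ultimately have "emeasure M (E n) = emeasure M (D (Suc n)) + emeasure M (E (Suc n))"
      using f_emeasure[OF Es, of n] plus_emeasure[OF Ds Es, of "Suc n" "Suc n"] by simp
    then show ?case using Suc by (simp add: add.assoc)
  qed
  have part: "(\<Sum>k<n. emeasure M (D k)) \<le> emeasure M U" for n
  proof -
    have "(\<Sum>k<n. emeasure M (D k)) \<le> (\<Sum>k<Suc n. emeasure M (D k))" by (intro sum_mono2) auto
    also have "\<dots> \<le> emeasure M U" unfolding main[of n, symmetric] by simp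
    finally show ?thesis .
  qed
  have "excursion_hits U \<subseteq> (\<Union>k. D k)"
  proof
    fix x assume "x \<in> excursion_hits U"
    then obtain i where i: "x \<in> tail (Suc i)" "(f ^^ i) x \<in> U" "x \<in> space M" by (auto simp: excursion_hits_def)
    then have "x \<in> Y" "\<forall>k\<in>{1..<Suc i}. (f ^^ k) x \<notin> Y"
      using R_ge_iff[of "Suc i" x] by (auto simp: tail_def)
    then have "x \<in> D i" using i by (auto simp: D_def N_def)
    then show "x \<in> (\<Union>k. D k)" by blast
  qed
  then have "emeasure M (excursion_hits U) \<le> emeasure M (\<Union>k. D k)"
    using Ds by (intro emeasure_mono) auto
  also have "\<dots> \<le> (\<Sum>k. emeasure M (D k))" using Ds by (intro emeasure_subadditive_countably) auto
  also have "\<dots> \<le> emeasure M U" using part by (intro suminf_le_const summableI)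
  finally show ?thesis .
qed

lemma emeasure_Y: "emeasure M Y = 1"
  using mu.emeasure_space_1 emeasure_mu[of Y] space_mu by simp

text \<open>
  The set of points that visit \<open>Y\<close> infinitely often is exactly invariant, so ergodicity makes it null or
  conull. The points of \<open>Y\<close> that never return form a wandering set, null by conservativity; since every
  point of \<open>Y\<close> with finitely many visits is mapped into it at the last visit, \<open>Y\<close> is almost entirely
  recurrent, and the invariant set is not null.
\<close>

lemma AE_enters: "AE x in M. \<exists>p. (f ^^ p) x \<in> Y"
proof -
  define A where "A = (\<Inter>N. \<Union>n\<in>{N..}. (f ^^ n) -` Y \<inter> space M)"
  define L where "L = Y - (\<Union>n\<in>{1..}. (f ^^ n) -` Y \<inter> space M)"
  have As: "A \<in> sets M"
    unfolding A_def by (intro sets.countable_INT sets.countable_UN'' countableI_type measurable_sets[OF fn_meas] Y_M image_subsetI) auto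
  have Ls: "L \<in> sets M"
    unfolding L_def by (intro sets.Diff Y_M sets.countable_UN'' countableI_type measurable_sets[OF fn_meas])
  have A_iff: "x \<in> A \<longleftrightarrow> x \<in> space M \<and> (\<forall>N. \<exists>n\<ge>N. (f ^^ n) x \<in> Y)" for x
    unfolding A_def by auto
  have inv: "f -` A \<inter> space M = A"
  proof (intro set_eqI)
    fix x
    have "(\<forall>N. \<exists>n\<ge>N. (f ^^ n) (f x) \<in> Y) \<longleftrightarrow> (\<forall>N. \<exists>n\<ge>N. (f ^^ n) x \<in> Y)"
    proof
      assume a: "\<forall>N. \<exists>n\<ge>N. (f ^^ n) (f x) \<in> Y"
      show "\<forall>N. \<exists>n\<ge>N. (f ^^ n) x \<in> Y"
      proof
        fix N
        obtain n where "n \<ge> N" "(f ^^ n) (f x) \<in> Y" using a by blast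
        then have "Suc n \<ge> N" "(f ^^ Suc n) x \<in> Y" by (auto simp: funpow_swap1)
        then show "\<exists>n\<ge>N. (f ^^ n) x \<in> Y" by blast
      qed
    next
      assume a: "\<forall>N. \<exists>n\<ge>N. (f ^^ n) x \<in> Y"
      show "\<forall>N. \<exists>n\<ge>N. (f ^^ n) (f x) \<in> Y"
      proof
        fix N
        obtain n where n: "n \<ge> Suc N" "(f ^^ n) x \<in> Y" using a by blast
        then obtain k where "n = Suc k" by (cases n) auto
        then have "k \<ge> N" "(f ^^ k) (f x) \<in> Y" using n by (auto simp: funpow_swap1)
        then show "\<exists>n\<ge>N. (f ^^ n) (f x) \<in> Y" by blast
      qed
    qed
    then show "x \<in> f -` A \<inter> space M \<longleftrightarrow> x \<in> A"
      using measurable_space[OF f_meas, of x] unfolding A_iff vimage_eq Int_iff by blast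
  qed
  have "wandering M f L"
    unfolding wandering_def
  proof (intro conjI Ls)
    have no: "False" if "a < b" "(f ^^ a) x \<in> L" "(f ^^ b) x \<in> L" "x \<in> space M" for a b x
    proof -
      have "(f ^^ (b - a)) ((f ^^ a) x) = (f ^^ (b - a + a)) x" by (simp only: funpow_add comp_apply)
      then have "(f ^^ (b - a)) ((f ^^ a) x) \<in> Y" using that by (simp add: L_def)
      then show False using that fn_space[of x a] by (auto simp: L_def)
    qed
    show "disjoint_family (\<lambda>n. (f ^^ n) -` L \<inter> space M)"
      unfolding disjoint_family_on_def
    proof (intro ballI impI)
      fix a b :: nat assume "a \<noteq> b"
      then consider "a < b" | "b < a" by linarith
      then show "(f ^^ a) -` L \<inter> space M \<inter> ((f ^^ b) -` L \<inter> space M) = {}"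
        by cases (use no in blast)+
    qed
  qed
  then have L: "L \<in> null_sets M" using cons by (simp add: conservative_def)
  have cover: "Y \<subseteq> A \<union> (\<Union>n. (f ^^ n) -` L \<inter> space M)"
  proof
    fix x assume x: "x \<in> Y"
    show "x \<in> A \<union> (\<Union>n. (f ^^ n) -` L \<inter> space M)"
    proof (cases "x \<in> A")
      case False
      then obtain N where N: "\<And>n. n \<ge> N \<Longrightarrow> (f ^^ n) x \<notin> Y" using x YX unfolding A_iff by blast
      define n where "n = Max {n. n \<le> N \<and> (f ^^ n) x \<in> Y}"
      have fin: "finite {n. n \<le> N \<and> (f ^^ n) x \<in> Y}" by simp
      have ne: "{n. n \<le> N \<and> (f ^^ n) x \<in> Y} \<noteq> {}" using x by (auto intro!: exI[of _ 0])
      have n: "(f ^^ n) x \<in> Y" using Max_in[OF fin ne] by (simp add: n_def)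
      have "(f ^^ (k + n)) x \<notin> Y" if "1 \<le> k" for k
      proof
        assume a: "(f ^^ (k + n)) x \<in> Y"
        then have "k + n \<le> N" using N[of "k + n"] by (meson nle_le)
        then have "k + n \<le> n" using a Max_ge[OF fin, of "k + n"] by (simp add: n_def)
        then show False using that by simp
      qed
      then have "(f ^^ n) x \<in> L" using n by (auto simp: L_def funpow_add)
      then show ?thesis using x YX by blast
    qed simp
  qed
  have "A \<notin> null_sets M"
  proof
    assume "A \<in> null_sets M"
    then have "A \<union> (\<Union>n. (f ^^ n) -` L \<inter> space M) \<in> null_sets M"
      by (intro null_sets.Un null_sets_UN fn_null L)
    then have "Y \<in> null_sets M" using cover Y_M null_sets_subset by blast
    then show False using emeasure_Y by (simp add: null_sets_def)
  qed
  then have N: "space M - A \<in> null_sets M" using erg As inv by (auto simp: ergodic_def)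
  show ?thesis
  proof (rule AE_I'[OF N], rule subsetI)
    fix x assume x: "x \<in> {x \<in> space M. \<not> (\<exists>p. (f ^^ p) x \<in> Y)}"
    then have "x \<notin> A" unfolding A_iff by blast
    then show "x \<in> space M - A" using x by blast
  qed
qed

lemma AE_mu_transfer:
  assumes Q: "AE y in \<mu>. Q y" shows "AE x in M. \<forall>p. (f ^^ p) x \<in> Y \<longrightarrow> Q ((f ^^ p) x)"
proof -
  obtain N where N: "N \<in> null_sets \<mu>" "{y \<in> space \<mu>. \<not> Q y} \<subseteq> N"
    using Q unfolding eventually_ae_filter by blast
  have NM: "N \<in> null_sets M"
    using N(1) emeasure_mu[of N] by (auto simp: null_sets_def sets_mu_iff)
  have "(\<Union>p. (f ^^ p) -` N \<inter> space M) \<in> null_sets M" by (intro null_sets_UN fn_null NM)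
  then show ?thesis
  proof (rule AE_I', intro subsetI)
    fix x assume "x \<in> {x \<in> space M. \<not> (\<forall>p. (f ^^ p) x \<in> Y \<longrightarrow> Q ((f ^^ p) x))}"
    then obtain p where "x \<in> space M" "(f ^^ p) x \<in> Y" "\<not> Q ((f ^^ p) x)" by blast
    then have "(f ^^ p) x \<in> N" using N(2) by (auto simp: space_mu)
    then show "x \<in> (\<Union>p. (f ^^ p) -` N \<inter> space M)" using \<open>x \<in> space M\<close> by blast
  qed
qed

section \<open>Almost sure estimates along powers of two\<close>

lemma borel_cantelli:
  assumes A: "\<And>m. A m \<in> sets \<mu>" and le: "\<And>m. start \<le> m \<Longrightarrow> measure \<mu> (A m) \<le> a m" and s: "summable a"
  shows "AE y in \<mu>. y \<in> Y \<and> (\<forall>\<^sub>F m in sequentially. y \<notin> A m)"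
proof -
  have "summable (\<lambda>m. measure \<mu> (A m))"
    using s le by (intro summable_comparison_test_ev[OF _ s]) (auto simp: eventually_sequentially)
  then have "AE y in \<mu>. \<forall>\<^sub>F m in sequentially. y \<in> space \<mu> - A m"
    using A by (intro borel_cantelli_AE1) (auto simp: mu.emeasure_eq_measure)
  then show ?thesis using AE_space by eventually_elim (auto simp: space_mu elim: eventually_mono)
qed

lemma summable_inverse_square: "summable (\<lambda>m. C / real m ^ 2)"
  using summable_mult[OF inverse_power_summable[of 2, where 'a = real], of C] by (simp add: divide_inverse)

text \<open>
  With \<open>u powr \<beta>\<close> at least \<open>2 ^ m * m ^ 2\<close>, the bound on \<open>long\<close> is of order \<open>1 / m ^ 2\<close>.
\<close>

lemma many_returns_upper:
  "AE y in \<mu>. \<forall>\<^sub>F m in sequentially. return_sum (2 ^ m) y < nat \<lceil>(2 ^ m * real m ^ 2) powr (1 / \<beta>)\<rceil>"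
proof -
  define u where "u m = nat \<lceil>(2 ^ m * real m ^ 2) powr (1 / \<beta>)\<rceil>" for m
  obtain C where C: "0 < C" "\<And>k u. 1 \<le> u \<Longrightarrow> measure \<mu> (long k u) \<le> C * real k * real u powr (- \<beta>)"
    by (rule long_bound) blast
  have "measure \<mu> (long (2 ^ m) (u m)) \<le> C / real m ^ 2" if m: "1 \<le> m" for m
  proof -
    let ?w = "2 ^ m * real m ^ 2"
    have w: "0 < ?w" using m by simp
    have wu: "?w powr (1 / \<beta>) \<le> real (u m)" unfolding u_def by linarith
    have w0: "0 < ?w powr (1 / \<beta>)" using w m by simp
    have "1 \<le> u m" using wu w0 by linarith
    then have "measure \<mu> (long (2 ^ m) (u m)) \<le> C * real (2 ^ m) * real (u m) powr (- \<beta>)" by (rule C(2))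
    also have "real (u m) powr (- \<beta>) \<le> (?w powr (1 / \<beta>)) powr (- \<beta>)"
      using wu w0 beta by (intro powr_mono2') auto
    also have "\<dots> = 1 / ?w" using w beta by (simp add: powr_powr powr_minus_divide)
    also have "C * real (2 ^ m) * (1 / ?w) = C / real m ^ 2" by simp
    finally show ?thesis using C(1) by (simp add: mult_left_mono)
  qed
  then have "AE y in \<mu>. y \<in> Y \<and> (\<forall>\<^sub>F m in sequentially. y \<notin> long (2 ^ m) (u m))"
    by (intro borel_cantelli[where start = 1 and a = "\<lambda>m. C / real m ^ 2"] long_sets summable_inverse_square)
  then show ?thesis
  proof eventually_elim
    case (elim y)
    then have y: "y \<in> Y" and ev: "\<forall>\<^sub>F m in sequentially. y \<notin> long (2 ^ m) (u m)" by auto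
    show ?case using ev by (rule eventually_mono) (use return_sum_less[OF y] u_def in auto)
  qed
qed

text \<open>
  A set of measure \<open>\<kappa> * m ^ 3 / 2 ^ m\<close> is missed during \<open>2 ^ m\<close> steps with probability of order
  \<open>exp (- s * m ^ 2)\<close>: one factor \<open>m\<close> of the surplus \<open>m ^ 3\<close> pays for the length of the blocks in
  \<open>hitting_time_tail\<close>, and already \<open>exp (- s * m)\<close> is summable.
\<close>

lemma targets_hit:
  assumes B: "\<And>m. start \<le> m \<Longrightarrow> im.determined (q m) (B m)" and q: "\<And>m. start \<le> m \<Longrightarrow> 1 \<le> q m"
    and qA: "\<And>m. start \<le> m \<Longrightarrow> real (q m) \<le> A * real m" and \<kappa>: "0 < \<kappa>"
    and mass: "\<And>m. start \<le> m \<Longrightarrow> \<kappa> * (real m ^ 3 / 2 ^ m) \<le> measure \<mu> (B m)"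
  shows "AE y in \<mu>. \<forall>\<^sub>F m in sequentially. \<exists>j<2 ^ m. (T ^^ j) y \<in> B m"
proof -
  obtain C c where C: "0 < C" "0 < c" and hit:
    "\<And>B q b k. im.determined q B \<Longrightarrow> 1 \<le> q \<Longrightarrow> 0 < b \<Longrightarrow> b \<le> measure \<mu> B \<Longrightarrow>
       measure \<mu> (im.miss B k) \<le> C * exp (- (c * b * real k / (real q + 1 + ln (1 / b))))"
    by (rule im.acip_hitting_time_tail[OF A4]) blast
  define A' where "A' = \<bar>A\<bar> + 2 + \<bar>ln \<kappa>\<bar>"
  have A': "0 < A'" by (simp add: A'_def add_nonneg_pos)
  define s where "s = c * \<kappa> / A'"
  have s: "0 < s" using C \<kappa> A' by (simp add: s_def)
  define m1 where "m1 = max 1 start"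
  \<comment> \<open>the maximum only serves to have measurable sets for all \<open>m\<close>\<close>
  define D where "D m = im.miss (B (max m1 m)) (2 ^ m)" for m
  have Ds: "D m \<in> sets \<mu>" for m
    unfolding D_def sets_mu_Leb using B[of "max m1 m"] im.determined_sets by (auto simp: m1_def)
  have "measure \<mu> (D m) \<le> C * exp (- s) ^ m" if m: "m1 \<le> m" for m
  proof -
    have mm: "start \<le> m" "1 \<le> m" "max m1 m = m" using m by (auto simp: m1_def)
    define b where "b = \<kappa> * (real m ^ 3 / 2 ^ m)"
    have b: "0 < b" using \<kappa> mm by (simp add: b_def)
    have "b \<le> measure \<mu> (B m)" using mass[OF mm(1)] by (simp add: b_def)
    then have b1: "b \<le> 1" by (rule order_trans) simp
    have lb: "0 \<le> ln (1 / b)" using b b1 by simp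
    have "ln (1 / b) = real m * ln 2 - 3 * ln (real m) - ln \<kappa>"
      using \<kappa> mm by (simp add: b_def ln_div ln_mult ln_realpow)
    also have "\<dots> \<le> real m * 1 + \<bar>ln \<kappa>\<bar> * real m"
    proof -
      have "ln 2 \<le> (1::real)" using ln_le_minus_one[of 2] by simp
      then have "real m * ln 2 \<le> real m * 1" by (intro mult_left_mono) auto
      moreover have "0 \<le> 3 * ln (real m)" using mm by simp
      moreover have "- ln \<kappa> \<le> \<bar>ln \<kappa>\<bar> * real m"
        using mult_left_mono[of 1 "real m" "\<bar>ln \<kappa>\<bar>"] mm by simp
      ultimately show ?thesis by linarith
    qed
    finally have 1: "ln (1 / b) \<le> real m * 1 + \<bar>ln \<kappa>\<bar> * real m" .
    have "A * real m \<le> \<bar>A\<bar> * real m" by (intro mult_right_mono) auto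
    then have den: "real (q m) + 1 + ln (1 / b) \<le> A' * real m"
    proof -
      have "real (q m) \<le> \<bar>A\<bar> * real m" using qA[OF mm(1)] \<open>A * real m \<le> _\<close> by (rule order_trans)
      moreover have "1 \<le> real m" using mm by simp
      ultimately have "real (q m) + 1 + ln (1 / b) \<le> \<bar>A\<bar> * real m + 2 * real m + \<bar>ln \<kappa>\<bar> * real m"
        using 1 by linarith
      then show ?thesis by (simp add: A'_def distrib_right)
    qed
    have den0: "0 < real (q m) + 1 + ln (1 / b)" using lb by linarith
    have "s * real m \<le> s * real m ^ 2"
      using s mm by (intro mult_left_mono) (auto simp: power2_eq_square)
    also have "\<dots> = c * b * real (2 ^ m) / (A' * real m)"
      using mm A' by (simp add: s_def b_def power2_eq_square power3_eq_cube field_simps)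
    also have "\<dots> \<le> c * b * real (2 ^ m) / (real (q m) + 1 + ln (1 / b))"
      using den den0 C b by (intro divide_left_mono) (auto intro!: mult_pos_pos order.strict_trans2[OF den0 den])
    finally have ex: "s * real m \<le> c * b * real (2 ^ m) / (real (q m) + 1 + ln (1 / b))" .
    have "measure \<mu> (D m) \<le> C * exp (- (c * b * real (2 ^ m) / (real (q m) + 1 + ln (1 / b))))"
      unfolding D_def mm(3) using mass[OF mm(1)] by (intro hit B q mm b) (simp add: b_def)
    also have "\<dots> \<le> C * exp (- (s * real m))" using ex C by (intro mult_left_mono) auto
    also have "exp (- (s * real m)) = exp (- s) ^ m" by (simp add: exp_of_nat_mult[symmetric] mult.commute)
    finally show ?thesis .
  qed
  moreover have "summable (\<lambda>m. C * exp (- s) ^ m)" using s by (intro summable_mult summable_geometric) auto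
  ultimately have "AE y in \<mu>. y \<in> Y \<and> (\<forall>\<^sub>F m in sequentially. y \<notin> D m)"
    by (intro borel_cantelli[where start = m1 and a = "\<lambda>m. C * exp (- s) ^ m"] Ds)
  then show ?thesis
  proof eventually_elim
    case (elim y)
    have "\<forall>\<^sub>F m in sequentially. m1 \<le> m" by (rule eventually_ge_at_top)
    with elim[THEN conjunct2] show ?case
    proof eventually_elim
      case (elim m)
      then show ?case using \<open>y \<in> Y \<and> _\<close> by (auto simp: D_def im.miss_def max_def split: if_splits)
    qed
  qed
qed

lemma tail_determined: "im.determined 1 (tail t)"
  unfolding im.determined_def
proof (intro conjI allI impI tail_Leb)
  fix w :: "nat list" assume "length w = 1"
  then obtain i where w: "w = [i]" by (cases w) auto
  obtain r where "\<And>x. x \<in> P i \<Longrightarrow> R x = r" using A5 unfolding A5_def constant_on_def by meson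
  then show "im.cyl w \<subseteq> tail t \<or> im.cyl w \<inter> tail t = {}"
    using im.P_sub[of i] unfolding w im.cyl_single tail_def by (cases "t \<le> r") auto
qed

text \<open>
  The sum of the first \<open>2 ^ m\<close> return times is at least its largest term, and the tail event that makes this
  term large is a target as in \<open>targets_hit\<close>.
\<close>

lemma many_returns_lower:
  "AE y in \<mu>. \<forall>\<^sub>F m in sequentially. nat \<lfloor>(2 ^ m / real m ^ 3) powr (1 / \<beta>)\<rfloor> \<le> return_sum (2 ^ m) y"
proof -
  define t where "t m = nat \<lfloor>(2 ^ m / real m ^ 3) powr (1 / \<beta>)\<rfloor>" for m
  obtain c n0 where c: "0 < c" "1 \<le> n0" "\<And>t. n0 \<le> t \<Longrightarrow> c * real t powr (- \<beta>) \<le> measure \<mu> (tail t)"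
    by (rule tail_lower) blast
  have "filterlim (\<lambda>m. (2 ^ m / real m ^ 3) powr (1 / \<beta>)) at_top sequentially"
    using beta by real_asymp
  then have "\<forall>\<^sub>F m in sequentially. real n0 \<le> (2 ^ m / real m ^ 3) powr (1 / \<beta>)"
    by (simp add: filterlim_at_top)
  then obtain m0 where m0: "\<And>m. m0 \<le> m \<Longrightarrow> real n0 \<le> (2 ^ m / real m ^ 3) powr (1 / \<beta>)"
    by (auto simp: eventually_sequentially)
  have mass: "c * (real m ^ 3 / 2 ^ m) \<le> measure \<mu> (tail (t m))" if "max 1 m0 \<le> m" for m
  proof -
    let ?v = "2 ^ m / real m ^ 3"
    have v: "0 < ?v" using that by simp
    have n0: "n0 \<le> t m" unfolding t_def using m0[of m] that by (simp add: le_nat_floor)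
    have "real (t m) \<le> ?v powr (1 / \<beta>)" unfolding t_def by (simp add: of_nat_nat)
    then have "(?v powr (1 / \<beta>)) powr (- \<beta>) \<le> real (t m) powr (- \<beta>)"
      using n0 c(2) beta by (intro powr_mono2') auto
    moreover have "(?v powr (1 / \<beta>)) powr (- \<beta>) = real m ^ 3 / 2 ^ m"
      using v beta by (simp add: powr_powr powr_minus_divide)
    ultimately have "c * (real m ^ 3 / 2 ^ m) \<le> c * real (t m) powr (- \<beta>)"
      using c by (intro mult_left_mono) simp_all
    also have "\<dots> \<le> measure \<mu> (tail (t m))" by (rule c(3)[OF n0])
    finally show ?thesis .
  qed
  have "AE y in \<mu>. \<forall>\<^sub>F m in sequentially. \<exists>j<2 ^ m. (T ^^ j) y \<in> tail (t m)"
    by (rule targets_hit[where start = "max 1 m0" and A = 1 and q = "\<lambda>_. 1", OF tail_determined _ _ c(1) mass]) auto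
  then show ?thesis
  proof eventually_elim
    case (elim y)
    then show ?case
    proof eventually_elim
      case (elim m)
      then obtain j where "j < 2 ^ m" "t m \<le> R ((T ^^ j) y)" by (auto simp: tail_def)
      moreover have "R ((T ^^ j) y) \<le> return_sum (2 ^ m) y" unfolding return_sum_def
        using \<open>j < 2 ^ m\<close> by (intro member_le_sum) auto
      ultimately show ?case by (simp add: t_def)
    qed
  qed
qed


section \<open>Targets at a point of positive density\<close>

text \<open>
  The limit that defines the density at \<open>xt\<close>, at the fixed precision of a factor two.
\<close>

definition density_within :: "real \<Rightarrow> real \<Rightarrow> real \<Rightarrow> bool" where
  "density_within xt h d \<longleftrightarrow> (\<forall>a b. a \<le> xt \<longrightarrow> xt \<le> b \<longrightarrow> b - a < d \<longrightarrow> 0 < emeasure lborel ({a..b} \<inter> space M) \<longrightarrow>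
    ennreal (h / 2) * emeasure lborel ({a..b} \<inter> space M) \<le> emeasure M ({a..b} \<inter> space M) \<and>
    emeasure M ({a..b} \<inter> space M) \<le> ennreal (2 * h) * emeasure lborel ({a..b} \<inter> space M))"

lemma density_bounds:
  assumes dens: "has_density_at M h xt" and h: "0 < h"
  obtains d where "0 < d" "density_within xt h d"
proof -
  let ?Z = "{(a, b). a \<le> xt \<and> xt \<le> b \<and> 0 < emeasure lborel ({a..b} \<inter> space M)}"
  let ?r = "\<lambda>(a, b). emeasure M ({a..b} \<inter> space M) / emeasure lborel ({a..b} \<inter> space M)"
  have lim: "(?r \<longlongrightarrow> ennreal h) (at (xt, xt) within ?Z)" using dens by (simp add: has_density_at_def)
  have "\<forall>\<^sub>F ab in at (xt, xt) within ?Z. ennreal (h / 2) < ?r ab"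
    using lim by (rule order_tendstoD(1)) (use h in \<open>simp add: ennreal_less_iff\<close>)
  moreover have "\<forall>\<^sub>F ab in at (xt, xt) within ?Z. ?r ab < ennreal (2 * h)"
    using lim by (rule order_tendstoD(2)) (use h in \<open>simp add: ennreal_less_iff\<close>)
  ultimately have "\<forall>\<^sub>F ab in at (xt, xt) within ?Z. ennreal (h / 2) < ?r ab \<and> ?r ab < ennreal (2 * h)"
    by (rule eventually_conj)
  then obtain d where d: "0 < d" and D: "\<And>ab. ab \<in> ?Z \<Longrightarrow> ab \<noteq> (xt, xt) \<Longrightarrow> dist ab (xt, xt) < d \<Longrightarrow>
      ennreal (h / 2) < ?r ab \<and> ?r ab < ennreal (2 * h)"
    unfolding eventually_at by blast
  have "ennreal (h / 2) * emeasure lborel ({a..b} \<inter> space M) \<le> emeasure M ({a..b} \<inter> space M) \<and>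
    emeasure M ({a..b} \<inter> space M) \<le> ennreal (2 * h) * emeasure lborel ({a..b} \<inter> space M)"
    if ab: "a \<le> xt" "xt \<le> b" "b - a < d" "0 < emeasure lborel ({a..b} \<inter> space M)" for a b
  proof -
    let ?L = "emeasure lborel ({a..b} \<inter> space M)" and ?M = "emeasure M ({a..b} \<inter> space M)"
    have "(a, b) \<noteq> (xt, xt)"
    proof
      assume "(a, b) = (xt, xt)"
      then have "?L \<le> emeasure lborel {xt}" by (intro emeasure_mono) auto
      then show False using ab(4) by simp
    qed
    moreover have "dist (a, b) (xt, xt) < d"
    proof -
      have "dist (a, b) (xt, xt) \<le> \<bar>a - xt\<bar> + \<bar>b - xt\<bar>"
        by (simp add: dist_Pair_Pair dist_real_def sqrt_sum_squares_le_sum_abs)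
      then show ?thesis using ab by simp
    qed
    ultimately have r: "ennreal (h / 2) < ?M / ?L" "?M / ?L < ennreal (2 * h)"
      using D[of "(a, b)"] ab by auto
    have "?L \<le> emeasure lborel {a..b}" by (intro emeasure_mono) auto
    also have "\<dots> < \<infinity>" using ab by simp
    finally obtain l where l: "?L = ennreal l" "0 < l" using ab(4) by (cases ?L) auto
    have "?M \<noteq> \<infinity>"
    proof
      assume "?M = \<infinity>"
      then have "?M / ?L = \<infinity>" using l by (simp add: ennreal_top_divide)
      then show False using r(2) by simp
    qed
    then obtain n where n: "?M = ennreal n" "0 \<le> n" by (cases ?M) auto
    have "h / 2 < n / l" "n / l < 2 * h"
      using r l n h by (simp_all add: divide_ennreal ennreal_less_iff)
    then show ?thesis using l n h by (simp add: field_simps flip: ennreal_mult)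
  qed
  then have "density_within xt h d" unfolding density_within_def by blast
  then show ?thesis by (rule that[OF d])
qed

text \<open>
  The target may be an endpoint of \<open>Y\<close>, so only one side of it need belong to \<open>Y\<close>.
\<close>

lemma side_interval:
  assumes xt: "xt \<in> Y"
  obtains r where "0 < r" "{xt..xt + r} \<subseteq> Y \<or> {xt - r..xt} \<subseteq> Y"
proof -
  obtain z where "z \<in> interior (P 0)" using im.P_interior by blast
  then have "z islimpt P 0" "z \<in> P 0" using interior_limit_point interior_subset by blast+
  then obtain z' where "z' \<in> P 0" "z' \<noteq> z" unfolding islimpt_def by blast
  then obtain y where y: "y \<in> Y" "y \<noteq> xt" using \<open>z \<in> P 0\<close> im.P_sub by (cases "z = xt") blast+
  show ?thesis
  proof (cases "xt < y")
    case True
    then show ?thesis using interval_Icc_subset[OF im.Y_interval xt y(1)] by (intro that[of "y - xt"]) auto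
  next
    case False
    then show ?thesis using interval_Icc_subset[OF im.Y_interval y(1) xt] y(2) by (intro that[of "xt - y"]) auto
  qed
qed

lemma ball_mass_lower:
  assumes dens: "has_density_at M h xt" and h: "0 < h" and xt: "xt \<in> Y"
  obtains r where "0 < r" "\<And>\<rho>. 0 < \<rho> \<Longrightarrow> \<rho> \<le> r \<Longrightarrow> h / 2 * \<rho> \<le> measure \<mu> {y \<in> Y. \<bar>y - xt\<bar> \<le> \<rho>}"
proof -
  obtain d where d: "0 < d" and D: "density_within xt h d" by (rule density_bounds[OF dens h])
  obtain s where s: "0 < s" "{xt..xt + s} \<subseteq> Y \<or> {xt - s..xt} \<subseteq> Y" by (rule side_interval[OF xt])
  have Ds: "{y \<in> Y. \<bar>y - xt\<bar> \<le> \<rho>} \<in> sets \<mu>" for \<rho>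
  proof -
    have "{y \<in> Y. \<bar>y - xt\<bar> \<le> \<rho>} = Y \<inter> {xt - \<rho>..xt + \<rho>}" by auto
    then show ?thesis using im.Y_borel YX by (auto simp: sets_mu_iff sets_M)
  qed
  have "h / 2 * \<rho> \<le> measure \<mu> {y \<in> Y. \<bar>y - xt\<bar> \<le> \<rho>}" if \<rho>: "0 < \<rho>" "\<rho> \<le> min s (d / 2)" for \<rho>
  proof -
    obtain a b where ab: "a \<le> xt" "xt \<le> b" "b - a = \<rho>" "{a..b} \<subseteq> Y"
    proof (cases "{xt..xt + s} \<subseteq> Y")
      case True
      then show ?thesis using \<rho> by (intro that[of xt "xt + \<rho>"]) auto
    next
      case False
      then have "{xt - s..xt} \<subseteq> Y" using s by blast
      then show ?thesis using \<rho> by (intro that[of "xt - \<rho>" xt]) auto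
    qed
    have I: "{a..b} \<inter> space M = {a..b}" using ab(4) YX by blast
    have len: "emeasure lborel {a..b} = ennreal \<rho>" using ab by simp
    have "ennreal (h / 2) * ennreal \<rho> \<le> emeasure M {a..b}"
      using D[unfolded density_within_def, rule_format, of a b] ab \<rho> d unfolding I len by simp
    also have "\<dots> = emeasure \<mu> {a..b}" using ab(4) by (rule emeasure_mu[symmetric])
    also have "\<dots> \<le> emeasure \<mu> {y \<in> Y. \<bar>y - xt\<bar> \<le> \<rho>}" using ab by (intro emeasure_mono Ds) auto
    finally show ?thesis using h \<rho> by (simp add: mu.emeasure_eq_measure flip: ennreal_mult)
  qed
  then show ?thesis using s d by (intro that[of "min s (d / 2)"]) auto
qed

lemma ball_sets: "{x \<in> space M. \<bar>x - xt\<bar> \<le> \<rho>} \<in> sets M"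
proof -
  have "{x \<in> space M. \<bar>x - xt\<bar> \<le> \<rho>} = space M \<inter> {xt - \<rho>..xt + \<rho>}" by auto
  then show ?thesis using X_borel by (auto simp: sets_M)
qed

lemma ball_mass_upper:
  assumes dens: "has_density_at M h xt" and h: "0 < h" and xt: "xt \<in> Y"
  obtains r where "0 < r" "\<And>\<rho>. 0 < \<rho> \<Longrightarrow> \<rho> \<le> r \<Longrightarrow> emeasure M {x \<in> space M. \<bar>x - xt\<bar> \<le> \<rho>} \<le> ennreal (4 * h * \<rho>)"
proof -
  obtain d where d: "0 < d" and D: "density_within xt h d" by (rule density_bounds[OF dens h])
  obtain s where s: "0 < s" "{xt..xt + s} \<subseteq> Y \<or> {xt - s..xt} \<subseteq> Y" by (rule side_interval[OF xt])
  have "emeasure M {x \<in> space M. \<bar>x - xt\<bar> \<le> \<rho>} \<le> ennreal (4 * h * \<rho>)" if \<rho>: "0 < \<rho>" "\<rho> \<le> min s (d / 4)" for \<rho>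
  proof -
    let ?I = "{xt - \<rho>..xt + \<rho>} \<inter> space M"
    have eq: "{x \<in> space M. \<bar>x - xt\<bar> \<le> \<rho>} = ?I" by auto
    have one_side: "{xt..xt + \<rho>} \<subseteq> ?I \<or> {xt - \<rho>..xt} \<subseteq> ?I"
    proof (cases "{xt..xt + s} \<subseteq> Y")
      case True
      moreover have "{xt..xt + \<rho>} \<subseteq> {xt..xt + s}" "{xt..xt + \<rho>} \<subseteq> {xt - \<rho>..xt + \<rho>}" using \<rho> by auto
      ultimately have "{xt..xt + \<rho>} \<subseteq> ?I" using YX by blast
      then show ?thesis ..
    next
      case False
      then have "{xt - s..xt} \<subseteq> Y" using s by blast
      moreover have "{xt - \<rho>..xt} \<subseteq> {xt - s..xt}" "{xt - \<rho>..xt} \<subseteq> {xt - \<rho>..xt + \<rho>}" using \<rho> by auto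
      ultimately have "{xt - \<rho>..xt} \<subseteq> ?I" using YX by blast
      then show ?thesis ..
    qed
    have Is: "?I \<in> sets lborel" using X_borel by simp
    from one_side have "ennreal \<rho> \<le> emeasure lborel ?I"
    proof
      assume "{xt..xt + \<rho>} \<subseteq> ?I"
      from emeasure_mono[OF this Is] show ?thesis using \<rho> by simp
    next
      assume "{xt - \<rho>..xt} \<subseteq> ?I"
      from emeasure_mono[OF this Is] show ?thesis using \<rho> by simp
    qed
    moreover have "0 < ennreal \<rho>" using \<rho> by simp
    ultimately have "0 < emeasure lborel ?I" by (rule order.strict_trans2[rotated])
    then have "emeasure M ?I \<le> ennreal (2 * h) * emeasure lborel ?I"
      using D[unfolded density_within_def, rule_format, of "xt - \<rho>" "xt + \<rho>"] \<rho> d by simp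
    also have "emeasure lborel ?I \<le> emeasure lborel {xt - \<rho>..xt + \<rho>}" by (intro emeasure_mono) auto
    also have "emeasure lborel {xt - \<rho>..xt + \<rho>} = ennreal (2 * \<rho>)" using \<rho> by simp
    also have "ennreal (2 * h) * ennreal (2 * \<rho>) = ennreal (4 * h * \<rho>)"
      using h \<rho> by (simp add: mult_ac flip: ennreal_mult)
    finally show ?thesis unfolding eq by (simp add: mult_left_mono)
  qed
  then show ?thesis using s d by (intro that[of "min s (d / 4)"]) auto
qed

lemma point_null:
  assumes dens: "has_density_at M h xt" and h: "0 < h" and xt: "xt \<in> Y"
  shows "{xt} \<in> null_sets M"
proof -
  obtain r where r: "0 < r" "\<And>\<rho>. 0 < \<rho> \<Longrightarrow> \<rho> \<le> r \<Longrightarrow> emeasure M {x \<in> space M. \<bar>x - xt\<bar> \<le> \<rho>} \<le> ennreal (4 * h * \<rho>)"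
    using ball_mass_upper[OF dens h xt] by metis
  have s: "{xt} \<in> sets M" using xt YX by (auto simp: sets_M)
  have "emeasure M {xt} \<le> 0 + ennreal e" if e: "0 < e" for e
  proof -
    define \<rho> where "\<rho> = min r (e / (4 * h))"
    have \<rho>: "0 < \<rho>" "\<rho> \<le> r" using r e h by (auto simp: \<rho>_def)
    have "emeasure M {xt} \<le> emeasure M {x \<in> space M. \<bar>x - xt\<bar> \<le> \<rho>}"
      using \<rho> xt YX by (intro emeasure_mono ball_sets) auto
    also have "\<dots> \<le> ennreal (4 * h * \<rho>)" by (rule r(2)[OF \<rho>])
    also have "\<dots> \<le> ennreal e"
    proof (rule ennreal_leI)
      have "\<rho> \<le> e / (4 * h)" by (simp add: \<rho>_def)
      then show "4 * h * \<rho> \<le> e" using h by (simp add: field_simps)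
    qed
    finally show ?thesis by simp
  qed
  then have "emeasure M {xt} \<le> 0" by (rule ennreal_le_epsilon)
  then show ?thesis using s by (simp add: null_sets_def)
qed

text \<open>
  A union bound: each of \<open>2 ^ m\<close> excursions meets the ball of radius \<open>1 / (2 ^ m * m ^ 2)\<close> with
  probability of the order of the radius. The ball is taken in the whole space, since orbits may also approach the
  target from outside \<open>Y\<close>.
\<close>

lemma excursions_avoid_ball:
  assumes dens: "has_density_at M h xt" and h: "0 < h" and xt: "xt \<in> Y"
  shows "AE y in \<mu>. \<forall>\<^sub>F m in sequentially. \<forall>n<return_sum (2 ^ m) y. 1 / (2 ^ m * real m ^ 2) < \<bar>(f ^^ n) y - xt\<bar>"
proof -
  obtain r where r: "0 < r" "\<And>\<rho>. 0 < \<rho> \<Longrightarrow> \<rho> \<le> r \<Longrightarrow> emeasure M {x \<in> space M. \<bar>x - xt\<bar> \<le> \<rho>} \<le> ennreal (4 * h * \<rho>)"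
    using ball_mass_upper[OF dens h xt] by metis
  define \<delta> where "\<delta> m = 1 / (2 ^ m * real m ^ 2)" for m
  define U where "U m = {x \<in> space M. \<bar>x - xt\<bar> \<le> \<delta> m}" for m
  have "\<delta> \<longlonglongrightarrow> 0" unfolding \<delta>_def by real_asymp
  then have "\<forall>\<^sub>F m in sequentially. \<delta> m < r" using r(1) by (rule order_tendstoD(2))
  then obtain k where k: "\<And>m. k \<le> m \<Longrightarrow> \<delta> m < r" by (auto simp: eventually_sequentially)
  define A where "A m = (\<Union>j<2 ^ m. im.pre j (excursion_hits (U m)))" for m
  have Es: "excursion_hits (U m) \<in> sets \<mu>" for m
    unfolding U_def sets_mu_iff using excursion_hits_sets[OF ball_sets] excursion_hits_sub by blast
  have pres: "im.pre j (excursion_hits (U m)) \<in> sets \<mu>" for j m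
    using Es sets_mu_Leb by auto
  have As: "A m \<in> sets \<mu>" for m unfolding A_def by (intro sets.finite_UN pres) auto
  have bound: "measure \<mu> (A m) \<le> 4 * h / real m ^ 2" if m: "max 1 k \<le> m" for m
  proof -
    have \<delta>: "0 < \<delta> m" "\<delta> m \<le> r" using m k[of m] by (auto simp: \<delta>_def)
    have "emeasure \<mu> (excursion_hits (U m)) = emeasure M (excursion_hits (U m))"
      by (rule emeasure_mu[OF excursion_hits_sub])
    also have "\<dots> \<le> emeasure M (U m)" unfolding U_def by (rule excursion_hits_emeasure[OF ball_sets])
    also have "\<dots> \<le> ennreal (4 * h * \<delta> m)" unfolding U_def by (rule r(2)[OF \<delta>])
    finally have E: "measure \<mu> (excursion_hits (U m)) \<le> 4 * h * \<delta> m"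
      using h \<delta> by (simp add: mu.emeasure_eq_measure)
    have "measure \<mu> (A m) \<le> (\<Sum>j<2 ^ m. measure \<mu> (im.pre j (excursion_hits (U m))))"
      unfolding A_def using pres by (intro measure_UNION_le) auto
    also have "\<dots> = 2 ^ m * measure \<mu> (excursion_hits (U m))" by (simp add: measure_mu_pre[OF Es])
    also have "\<dots> \<le> 2 ^ m * (4 * h * \<delta> m)" using E by (intro mult_left_mono) auto
    also have "\<dots> = 4 * h / real m ^ 2" by (simp add: \<delta>_def)
    finally show ?thesis .
  qed
  have "AE y in \<mu>. y \<in> Y \<and> (\<forall>\<^sub>F m in sequentially. y \<notin> A m)"
    by (rule borel_cantelli[OF As bound summable_inverse_square])
  then show ?thesis
  proof eventually_elim
    case (elim y)
    then have y: "y \<in> Y" and ev: "\<forall>\<^sub>F m in sequentially. y \<notin> A m" by auto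
    show ?case
    proof (rule eventually_mono[OF ev], intro allI impI)
      fix m n assume yA: "y \<notin> A m" and n: "n < return_sum (2 ^ m) y"
      obtain j i where ji: "j < 2 ^ m" "i < R ((T ^^ j) y)" "(f ^^ n) y = (f ^^ i) ((T ^^ j) y)"
        using excursion[OF n] by blast
      have Ty: "(T ^^ j) y \<in> Y" using im.Tn_space[of y j] y by simp
      have "(T ^^ j) y \<notin> excursion_hits (U m)" using yA ji(1) y by (auto simp: A_def im.pre_def)
      moreover have "(T ^^ j) y \<in> tail (Suc i)" using Ty ji(2) by (simp add: tail_def)
      moreover have "(T ^^ j) y \<in> space M" using Ty YX by blast
      ultimately have "(f ^^ i) ((T ^^ j) y) \<notin> U m" by (auto simp: excursion_hits_def)
      then show "1 / (2 ^ m * real m ^ 2) < \<bar>(f ^^ n) y - xt\<bar>"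
        using fn_space[OF \<open>(T ^^ j) y \<in> space M\<close>, of i] ji(3) by (simp add: U_def \<delta>_def not_le)
    qed
  qed
qed

text \<open>
  The ball is replaced by the union of the cylinders of length \<open>q m\<close> inside it. As cylinders shrink
  exponentially, a length proportional to \<open>m\<close> makes them shorter than half the radius, so that they still
  cover the concentric ball of half the radius, up to a null set.
\<close>

lemma ball_hit:
  assumes dens: "has_density_at M h xt" and h: "0 < h" and xt: "xt \<in> Y"
  shows "AE y in \<mu>. \<forall>\<^sub>F m in sequentially. \<exists>j<2 ^ m. \<bar>(T ^^ j) y - xt\<bar> \<le> real m ^ 3 / 2 ^ m"
proof -
  obtain r where r: "0 < r" "\<And>\<rho>. 0 < \<rho> \<Longrightarrow> \<rho> \<le> r \<Longrightarrow> h / 2 * \<rho> \<le> measure \<mu> {y \<in> Y. \<bar>y - xt\<bar> \<le> \<rho>}"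
    using ball_mass_lower[OF dens h xt] by metis
  obtain C \<Lambda> where C: "0 < C" "1 < \<Lambda>" and diam:
    "\<And>w x y. w \<noteq> [] \<Longrightarrow> x \<in> im.cyl w \<Longrightarrow> y \<in> im.cyl w \<Longrightarrow> \<bar>x - y\<bar> \<le> C / \<Lambda> ^ length w"
    using im.cyl_diameter by metis
  obtain K F where ms: "mixing_system im.Leb T P im.G K F \<mu>" using im.mixing_system_acip[OF A4] by blast
  interpret ms: mixing_system im.Leb T P im.G K F \<mu> by (rule ms)
  obtain a where a: "2 < \<Lambda> ^ a" using C(2) by (rule real_arch_pow[THEN exE])
  obtain b where b: "2 * C < \<Lambda> ^ b" using C(2) by (rule real_arch_pow[THEN exE])
  define q where "q m = a * m + b + 1" for m :: nat
  define \<rho> where "\<rho> m = real m ^ 3 / 2 ^ m" for m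
  define W where "W m = {w. length w = q m \<and> (\<forall>x\<in>im.cyl w. \<bar>x - xt\<bar> \<le> \<rho> m)}" for m
  define B where "B m = (\<Union>w\<in>W m. im.cyl w)" for m
  have "\<rho> \<longlonglongrightarrow> 0" unfolding \<rho>_def by real_asymp
  then have "\<forall>\<^sub>F m in sequentially. \<rho> m < r" using r(1) by (rule order_tendstoD(2))
  then obtain k where k: "\<And>m. k \<le> m \<Longrightarrow> \<rho> m < r" by (auto simp: eventually_sequentially)
  have det: "im.determined (q m) (B m)" for m
    unfolding B_def by (rule ms.determined_UN_cyl) (simp add: W_def)
  have qb: "real (q m) \<le> real (a + b + 1) * real m" if "1 \<le> m" for m
  proof -
    have "(b + 1) * 1 \<le> (b + 1) * m" using that by (rule mult_le_mono2)
    then have "q m \<le> (a + b + 1) * m" unfolding q_def by (simp add: algebra_simps)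
    then show ?thesis by (metis of_nat_le_iff of_nat_mult)
  qed
  have mass: "h / 4 * (real m ^ 3 / 2 ^ m) \<le> measure \<mu> (B m)" if m: "max 1 k \<le> m" for m
  proof -
    have \<rho>: "0 < \<rho> m" "\<rho> m \<le> r" using m k[of m] by (auto simp: \<rho>_def)
    let ?J = "{y \<in> Y. \<bar>y - xt\<bar> \<le> \<rho> m / 2}"
    have small: "C / \<Lambda> ^ q m \<le> \<rho> m / 2"
    proof -
      have "2 * C * 2 ^ m \<le> \<Lambda> ^ b * (\<Lambda> ^ a) ^ m"
        using a b C by (intro mult_mono power_mono) auto
      also have "\<dots> \<le> \<Lambda> ^ q m"
        using C unfolding q_def by (simp add: power_add power_mult mult.commute mult_left_mono)
      finally have le: "2 * C * 2 ^ m \<le> \<Lambda> ^ q m" .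
      have "C / \<Lambda> ^ q m \<le> C / (2 * C * 2 ^ m)" using C le by (intro divide_left_mono) auto
      also have "\<dots> = 1 / 2 ^ m / 2" using C by simp
      also have "\<dots> \<le> \<rho> m / 2" using m by (auto simp: \<rho>_def intro!: divide_right_mono)
      finally show ?thesis .
    qed
    have Js: "?J \<in> sets im.Leb"
    proof -
      have "?J = Y \<inter> {xt - \<rho> m / 2..xt + \<rho> m / 2}" unfolding abs_le_iff by auto
      then show ?thesis using im.Y_borel by (auto simp: im.sets_Leb)
    qed
    have sub: "?J \<inter> im.full \<subseteq> B m"
    proof
      fix x assume x: "x \<in> ?J \<inter> im.full"
      obtain w where w: "length w = q m" "x \<in> im.cyl w" using im.full_word[of x "q m"] x by blast
      have "\<bar>z - xt\<bar> \<le> \<rho> m" if z: "z \<in> im.cyl w" for z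
      proof -
        have "w \<noteq> []" using w(1) by (auto simp: q_def)
        then have "\<bar>z - x\<bar> \<le> C / \<Lambda> ^ length w" using z w(2) by (intro diam)
        then have "\<bar>z - x\<bar> \<le> \<rho> m / 2" using small unfolding w(1) by (rule order_trans)
        moreover have "\<bar>x - xt\<bar> \<le> \<rho> m / 2" using x by blast
        ultimately show ?thesis by linarith
      qed
      then show "x \<in> B m" using w by (auto simp: B_def W_def)
    qed
    have "h / 4 * (real m ^ 3 / 2 ^ m) = h / 2 * (\<rho> m / 2)" by (simp add: \<rho>_def)
    also have "\<dots> \<le> measure \<mu> ?J" using \<rho> by (intro r(2)) auto
    also have "\<dots> = measure \<mu> (?J \<inter> im.full)"
    proof -
      have s: "?J \<in> sets \<mu>" "im.full \<in> sets \<mu>" using Js sets_mu_Leb by auto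
      have "measure \<mu> (space im.Leb - im.full) = 0" by (rule ms.p_null[OF ms.full_conull])
      moreover have "measure \<mu> (?J - im.full) \<le> measure \<mu> (space im.Leb - im.full)"
      proof (rule mu.finite_measure_mono)
        show "space im.Leb - im.full \<in> sets \<mu>"
          unfolding sets_mu_Leb by (intro sets.compl_sets im.full_sets)
      qed auto
      ultimately have "measure \<mu> (?J - im.full) = 0" using measure_nonneg[of \<mu> "?J - im.full"] by linarith
      then show ?thesis using mu.finite_measure_Diff'[OF s] by linarith
    qed
    also have "\<dots> \<le> measure \<mu> (B m)"
      using sub det[of m] im.determined_sets sets_mu_Leb by (intro mu.finite_measure_mono) auto
    finally show ?thesis .
  qed
  have "AE y in \<mu>. \<forall>\<^sub>F m in sequentially. \<exists>j<2 ^ m. (T ^^ j) y \<in> B m"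
  proof (rule targets_hit[where start = "max 1 k" and q = q and A = "real (a + b + 1)" and \<kappa> = "h / 4"])
    show "0 < h / 4" using h by simp
    show "1 \<le> q m" for m by (simp add: q_def)
    show "real (q m) \<le> real (a + b + 1) * real m" if "max 1 k \<le> m" for m using that by (intro qb) simp
    show "im.determined (q m) (B m)" for m by (rule det)
    show "h / 4 * (real m ^ 3 / 2 ^ m) \<le> measure \<mu> (B m)" if "max 1 k \<le> m" for m using that by (rule mass)
  qed
  then show ?thesis
  proof eventually_elim
    case (elim y)
    then show ?case by (rule eventually_mono) (auto simp: B_def W_def \<rho>_def)
  qed
qed

end

section \<open>The closest visits\<close>

text \<open>
  Lets an arbitrary time \<open>n\<close> be compared with the scale \<open>m\<close> at which the sequence \<open>g\<close> passes \<open>n\<close>.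
\<close>

lemma crossing_index:
  fixes g :: "nat \<Rightarrow> real"
  assumes g: "filterlim g at_top sequentially"
  obtains N where "\<And>n. N \<le> n \<Longrightarrow> \<exists>m\<ge>k. g m \<le> real n \<and> real n < g (Suc m)"
proof
  fix n assume n: "nat \<lceil>g k\<rceil> \<le> n"
  have ex: "\<exists>m. k \<le> m \<and> real n < g (Suc m)"
  proof -
    have "\<forall>\<^sub>F m in sequentially. real n + 1 \<le> g m" using g by (simp add: filterlim_at_top)
    then obtain l where l: "\<And>m. l \<le> m \<Longrightarrow> real n + 1 \<le> g m" by (auto simp: eventually_sequentially)
    have "real n + 1 \<le> g (Suc (max k l))" by (rule l) simp
    then have "real n < g (Suc (max k l))" by linarith
    then show ?thesis by (intro exI[of _ "max k l"]) simp
  qed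
  define m where "m = (LEAST m. k \<le> m \<and> real n < g (Suc m))"
  have m: "k \<le> m" "real n < g (Suc m)" using LeastI_ex[OF ex] by (simp_all add: m_def)
  have "g m \<le> real n"
  proof (cases "m = k")
    case True
    have "g k \<le> real (nat \<lceil>g k\<rceil>)" by (rule real_nat_ceiling_ge)
    also have "\<dots> \<le> real n" using n by simp
    finally show ?thesis using True by simp
  next
    case False
    then obtain i where i: "m = Suc i" "k \<le> i" using m(1) by (cases m) auto
    then have "\<not> (k \<le> i \<and> real n < g (Suc i))" unfolding m_def[symmetric]
      using not_less_Least[of i "\<lambda>m. k \<le> m \<and> real n < g (Suc m)"] by (simp add: m_def[symmetric])
    then show ?thesis using i by simp
  qed
  then show "\<exists>m\<ge>k. g m \<le> real n \<and> real n < g (Suc m)" using m by blast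
qed

lemma powr_le_iff_inverse:
  fixes x w b :: real assumes "0 < b" "0 < w" "0 < x"
  shows "x \<le> w powr (1 / b) \<Longrightarrow> x powr b \<le> w" and "w powr (1 / b) \<le> x \<Longrightarrow> w \<le> x powr b"
proof -
  have eq: "(w powr (1 / b)) powr b = w" using assms by (simp add: powr_powr)
  show "x powr b \<le> w" if "x \<le> w powr (1 / b)"
    using powr_mono2[of b x "w powr (1 / b)"] that assms by (simp add: eq)
  show "w \<le> x powr b" if "w powr (1 / b) \<le> x"
    using powr_mono2[of b "w powr (1 / b)" x] that assms by (simp add: eq)
qed

lemma ln_2_half: "1 / 2 \<le> ln (2::real)"
proof -
  have "ln (1 / 2) \<le> (1 / 2 - 1 :: real)" by (rule ln_le_minus_one) simp
  then show ?thesis by (simp add: ln_div)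
qed

lemma index_le_ln:
  assumes "2 ^ m \<le> x" shows "real m \<le> 2 * ln (x::real)"
proof -
  have "real m * ln 2 = ln (2 ^ m)" by (simp add: ln_realpow)
  also have "\<dots> \<le> ln x" using assms by (intro ln_mono) auto
  finally have "real m * ln 2 \<le> ln x" .
  moreover have "real m * (1 / 2) \<le> real m * ln 2" using ln_2_half by (intro mult_left_mono) auto
  ultimately show ?thesis by linarith
qed

text \<open>
  All powers of the scale \<open>m\<close>, itself of order \<open>ln n\<close>, and all constants are absorbed by one further
  logarithm.
\<close>

lemma log_absorbs:
  fixes l :: real assumes m: "real m + 1 \<le> 16 * l" and l: "4 * 16 ^ 5 \<le> l"
  shows "4 * (real m + 1) ^ 5 \<le> l ^ 6"
proof -
  have "(real m + 1) ^ 5 \<le> (16 * l) ^ 5" using m by (intro power_mono) auto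
  then have "4 * (real m + 1) ^ 5 \<le> (4 * 16 ^ 5) * l ^ 5" by (simp add: power_mult_distrib)
  also have "\<dots> \<le> l * l ^ 5" using l by (intro mult_right_mono) auto
  also have "\<dots> = l ^ 6" by (simp add: power_numeral_reduce)
  finally show ?thesis .
qed

lemma eventually_ln_ge: "\<forall>\<^sub>F n in sequentially. c \<le> ln (real n)"
proof -
  have "filterlim (\<lambda>n. ln (real n)) at_top sequentially" by real_asymp
  then show ?thesis by (simp add: filterlim_at_top)
qed

context induced_setting begin

text \<open>
  The scale \<open>m\<close> is chosen so that the first \<open>2 ^ m\<close> returns happen before time \<open>n\<close>. Then \<open>n powr \<beta>\<close> is at
  most of order \<open>2 ^ m * m ^ 2\<close>, and one of these returns lies within \<open>m ^ 3 / 2 ^ m\<close> of the target.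
\<close>

lemma close_visit_from_Y:
  assumes hit: "\<forall>\<^sub>F m in sequentially. \<exists>j<2 ^ m. \<bar>(T ^^ j) y - xt\<bar> \<le> real m ^ 3 / 2 ^ m"
    and up: "\<forall>\<^sub>F m in sequentially. return_sum (2 ^ m) y < nat \<lceil>(2 ^ m * real m ^ 2) powr (1 / \<beta>)\<rceil>"
  shows "\<forall>\<^sub>F n in sequentially. \<exists>k<n. \<bar>(f ^^ k) y - xt\<bar> \<le> ln (real n) ^ 6 / real n powr \<beta>"
proof -
  obtain m1 where m1: "\<And>m. m1 \<le> m \<Longrightarrow> \<exists>j<2 ^ m. \<bar>(T ^^ j) y - xt\<bar> \<le> real m ^ 3 / 2 ^ m"
    using hit by (auto simp: eventually_sequentially)
  obtain m2 where m2: "\<And>m. m2 \<le> m \<Longrightarrow> return_sum (2 ^ m) y < nat \<lceil>(2 ^ m * real m ^ 2) powr (1 / \<beta>)\<rceil>"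
    using up by (auto simp: eventually_sequentially)
  \<comment> \<open>the summand 1 accounts for the ceiling in the bound on the returns\<close>
  define g where "g m = (2 ^ m * real m ^ 2) powr (1 / \<beta>) + 1" for m
  have "filterlim g at_top sequentially" unfolding g_def using beta by real_asymp
  then obtain N where N: "\<And>n. N \<le> n \<Longrightarrow> \<exists>m\<ge>max 1 (max m1 m2). g m \<le> real n \<and> real n < g (Suc m)"
    by (rule crossing_index) blast
  have "\<forall>\<^sub>F n in sequentially. N \<le> n \<and> 4 * 16 ^ 5 \<le> ln (real n) \<and> 1 \<le> n"
    by (intro eventually_conj eventually_ge_at_top eventually_ln_ge)
  then show ?thesis
  proof eventually_elim
    case (elim n)
    then obtain m where m: "1 \<le> m" "m1 \<le> m" "m2 \<le> m" "g m \<le> real n" "real n < g (Suc m)"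
      using N[of n] by auto
    have n: "0 < real n" using elim by simp
    let ?w = "2 ^ m * real m ^ 2" and ?w' = "2 ^ Suc m * real (Suc m) ^ 2"
    obtain j where j: "j < 2 ^ m" "\<bar>(T ^^ j) y - xt\<bar> \<le> real m ^ 3 / 2 ^ m" using m1[OF m(2)] by blast
    have "return_sum j y \<le> return_sum (2 ^ m) y" using j by (intro return_sum_mono) simp
    also have "\<dots> < nat \<lceil>?w powr (1 / \<beta>)\<rceil>" by (rule m2[OF m(3)])
    finally have "real (return_sum j y) < real (nat \<lceil>?w powr (1 / \<beta>)\<rceil>)" by simp
    also have "\<dots> \<le> g m" unfolding g_def by (simp add: of_nat_nat)
    also have "\<dots> \<le> real n" by (rule m(4))
    finally have k: "return_sum j y < n" by simp
    have w1: "2 ^ m \<le> ?w" using m(1) by simp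
    have "1 \<le> (2::real) ^ m" by simp
    then have w1': "1 \<le> ?w" using w1 by linarith
    have "?w powr 1 \<le> ?w powr (1 / \<beta>)" using w1' beta by (intro powr_mono) (auto simp: field_simps)
    then have "?w \<le> ?w powr (1 / \<beta>)" using w1' by (simp only: powr_one)
    then have "2 ^ m \<le> real n" using w1 m(4) unfolding g_def by linarith
    then have "real m \<le> 2 * ln (real n)" by (rule index_le_ln)
    then have ml: "real m + 1 \<le> 16 * ln (real n)" using elim by simp
    have "real n powr \<beta> \<le> 4 * 2 ^ m * (real m + 1) ^ 2"
    proof -
      have w'0: "1 \<le> ?w'"
      proof -
        have "1 \<le> (2::real) ^ Suc m" "1 \<le> real (Suc m) ^ 2" by (rule one_le_power, simp)+
        then show ?thesis using mult_mono[of 1 "2 ^ Suc m" 1 "real (Suc m) ^ 2"] by simp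
      qed
      then have "1 \<le> ?w' powr (1 / \<beta>)" using beta by (intro ge_one_powr_ge_zero) auto
      then have "real n / 2 \<le> ?w' powr (1 / \<beta>)" using m(5) by (simp add: g_def)
      then have "(real n / 2) powr \<beta> \<le> ?w'"
        using n w'0 beta by (intro powr_le_iff_inverse(1)) auto
      moreover have "(real n / 2) powr \<beta> = real n powr \<beta> / 2 powr \<beta>" by (simp add: powr_divide)
      ultimately have "real n powr \<beta> \<le> 2 powr \<beta> * ?w'" by (simp add: field_simps)
      also have "2 powr \<beta> * ?w' \<le> 2 * ?w'"
        using powr_mono[of \<beta> 1 2] beta w'0 by (intro mult_right_mono) auto
      also have "\<dots> = 4 * 2 ^ m * (real m + 1) ^ 2" by (simp add: add.commute)
      finally show ?thesis .
    qed
    then have "real m ^ 3 * real n powr \<beta> \<le> (real m + 1) ^ 3 * (4 * 2 ^ m * (real m + 1) ^ 2)"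
      by (intro mult_mono power_mono) auto
    also have "\<dots> = 2 ^ m * (4 * (real m + 1) ^ 5)" by (simp add: power_numeral_reduce)
    also have "\<dots> \<le> 2 ^ m * ln (real n) ^ 6" using log_absorbs[OF ml] elim by (intro mult_left_mono) auto
    finally have "real m ^ 3 * real n powr \<beta> \<le> 2 ^ m * ln (real n) ^ 6" .
    then have "real m ^ 3 / 2 ^ m \<le> ln (real n) ^ 6 / real n powr \<beta>"
      using n by (simp add: divide_simps mult.commute)
    then have "\<bar>(f ^^ return_sum j y) y - xt\<bar> \<le> ln (real n) ^ 6 / real n powr \<beta>"
      using j(2) by (simp add: f_return_sum)
    then show ?case using k by blast
  qed
qed

text \<open>
  Here the scale is chosen so that the first \<open>2 ^ (m + 1)\<close> excursions last beyond time \<open>n\<close>, while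
  \<open>n powr \<beta>\<close> is still at least of order \<open>2 ^ m / m ^ 3\<close>.
\<close>

lemma no_closer_visit_from_Y:
  assumes avoid: "\<forall>\<^sub>F m in sequentially. \<forall>n<return_sum (2 ^ m) y. 1 / (2 ^ m * real m ^ 2) < \<bar>(f ^^ n) y - xt\<bar>"
    and low: "\<forall>\<^sub>F m in sequentially. nat \<lfloor>(2 ^ m / real m ^ 3) powr (1 / \<beta>)\<rfloor> \<le> return_sum (2 ^ m) y"
  shows "\<forall>\<^sub>F n in sequentially. \<forall>k<n. 1 / (real n powr \<beta> * ln (real n) ^ 6) \<le> \<bar>(f ^^ k) y - xt\<bar>"
proof -
  obtain m1 where m1: "\<And>m. m1 \<le> m \<Longrightarrow> \<forall>n<return_sum (2 ^ m) y. 1 / (2 ^ m * real m ^ 2) < \<bar>(f ^^ n) y - xt\<bar>"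
    using avoid by (auto simp: eventually_sequentially)
  obtain m2 where m2: "\<And>m. m2 \<le> m \<Longrightarrow> nat \<lfloor>(2 ^ m / real m ^ 3) powr (1 / \<beta>)\<rfloor> \<le> return_sum (2 ^ m) y"
    using low by (auto simp: eventually_sequentially)
  have "\<forall>\<^sub>F m in sequentially. 2 * real m ^ 3 \<le> sqrt 2 ^ m" by real_asymp
  then obtain m3 where m3: "\<And>m. m3 \<le> m \<Longrightarrow> 2 * real m ^ 3 \<le> sqrt 2 ^ m" by (auto simp: eventually_sequentially)
  \<comment> \<open>the subtracted 1 accounts for the floor in the bound on the returns\<close>
  define g where "g m = (2 ^ m / real m ^ 3) powr (1 / \<beta>) - 1" for m
  have "filterlim g at_top sequentially" unfolding g_def using beta by real_asymp
  then obtain N where N: "\<And>n. N \<le> n \<Longrightarrow> \<exists>m\<ge>Max {1, m1, m2, m3}. g m \<le> real n \<and> real n < g (Suc m)"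
    by (rule crossing_index) blast
  have "\<forall>\<^sub>F n in sequentially. N \<le> n \<and> 4 * 16 ^ 5 \<le> ln (real n) \<and> 1 \<le> n"
    by (intro eventually_conj eventually_ge_at_top eventually_ln_ge)
  then show ?thesis
  proof eventually_elim
    case (elim n)
    then obtain m where m: "1 \<le> m" "m1 \<le> m" "m2 \<le> m" "m3 \<le> m" "g m \<le> real n" "real n < g (Suc m)"
      using N[of n] by auto
    have n: "1 \<le> real n" using elim by simp
    let ?v = "2 ^ m / real m ^ 3" and ?v' = "2 ^ Suc m / real (Suc m) ^ 3"
    have v0: "0 < ?v" using m(1) by simp
    have "real (n + 1) \<le> ?v' powr (1 / \<beta>)" using m(6) by (simp add: g_def)
    then have "n + 1 \<le> nat \<lfloor>?v' powr (1 / \<beta>)\<rfloor>" by (rule le_nat_floor)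
    also have "\<dots> \<le> return_sum (2 ^ Suc m) y" using m(3) by (intro m2) simp
    finally have nS: "n < return_sum (2 ^ Suc m) y" by simp
    have "?v powr (1 / \<beta>) \<le> 2 * real n" using m(5) n by (simp add: g_def)
    then have "?v \<le> (2 * real n) powr \<beta>" using n v0 beta by (intro powr_le_iff_inverse(2)) auto
    also have "\<dots> = 2 powr \<beta> * real n powr \<beta>" by (simp add: powr_mult)
    also have "\<dots> \<le> 2 * real n powr \<beta>"
      using powr_mono[of \<beta> 1 2] beta by (intro mult_right_mono) auto
    finally have "?v \<le> 2 * real n powr \<beta>" .
    then have v: "2 ^ m \<le> 2 * real n powr \<beta> * real m ^ 3" using m(1) by (simp add: divide_simps)
    have ml: "real m + 1 \<le> 16 * ln (real n)"
    proof -
      have "real n powr \<beta> \<le> real n powr 1" using n beta by (intro powr_mono) auto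
      then have "2 * real n powr \<beta> * real m ^ 3 \<le> real n * (2 * real m ^ 3)"
        using n by (simp add: mult_right_mono)
      also have "\<dots> \<le> real n * sqrt 2 ^ m" using m3[OF m(4)] by (intro mult_left_mono) auto
      finally have "2 ^ m \<le> real n * sqrt 2 ^ m" using v by linarith
      moreover have "(2::real) ^ m = sqrt 2 ^ m * sqrt 2 ^ m" by (simp flip: power_mult_distrib)
      ultimately have "sqrt 2 ^ m \<le> real n" by simp
      then have "sqrt 2 ^ m * sqrt 2 ^ m \<le> real n * real n" by (intro mult_mono) auto
      then have "2 ^ m \<le> real n ^ 2" by (simp add: power2_eq_square flip: power_mult_distrib)
      then have "real m \<le> 2 * ln (real n ^ 2)" by (rule index_le_ln)
      also have "ln (real n ^ 2) = 2 * ln (real n)" using n by (simp add: ln_realpow)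
      finally show ?thesis using elim by simp
    qed
    have "2 ^ Suc m * real (Suc m) ^ 2 \<le> 2 * (2 * real n powr \<beta> * real m ^ 3) * (real m + 1) ^ 2"
      using v by (simp add: add.commute mult_right_mono)
    also have "\<dots> = real n powr \<beta> * (4 * (real m ^ 3 * (real m + 1) ^ 2))" by simp
    also have "\<dots> \<le> real n powr \<beta> * (4 * ((real m + 1) ^ 3 * (real m + 1) ^ 2))"
      by (intro mult_left_mono mult_right_mono power_mono) auto
    also have "\<dots> = real n powr \<beta> * (4 * (real m + 1) ^ 5)" by (simp flip: power_add)
    also have "\<dots> \<le> real n powr \<beta> * ln (real n) ^ 6"
      using log_absorbs[OF ml] elim by (intro mult_left_mono) auto
    finally have "2 ^ Suc m * real (Suc m) ^ 2 \<le> real n powr \<beta> * ln (real n) ^ 6" .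
    then have le: "1 / (real n powr \<beta> * ln (real n) ^ 6) \<le> 1 / (2 ^ Suc m * real (Suc m) ^ 2)"
      by (intro frac_le) simp_all
    show ?case
    proof (intro allI impI)
      fix k assume "k < n"
      then have "k < return_sum (2 ^ Suc m) y" using nS by simp
      then have "1 / (2 ^ Suc m * real (Suc m) ^ 2) < \<bar>(f ^^ k) y - xt\<bar>"
        using m1[of "Suc m"] m(2) by simp
      then show "1 / (real n powr \<beta> * ln (real n) ^ 6) \<le> \<bar>(f ^^ k) y - xt\<bar>" using le by linarith
    qed
  qed
qed

text \<open>
  From a general starting point the orbit is followed from an entrance into \<open>Y\<close>. The finite time
  before it costs one more logarithm on one side, and on the other side finitely many points, none
  of which is the target itself.
\<close>

theorem closest_visits:
  assumes dens: "has_density_at M h xt" and h: "0 < h" and xt: "xt \<in> Y"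
  shows "AE x in M. \<forall>\<^sub>F n in sequentially.
    (\<exists>k<n. \<bar>(f ^^ k) x - xt\<bar> \<le> ln (real n) ^ 7 / real n powr \<beta>) \<and>
    (\<forall>k<n. 1 / (real n powr \<beta> * ln (real n) ^ 6) \<le> \<bar>(f ^^ k) x - xt\<bar>)"
proof -
  define good where "good y \<longleftrightarrow>
    (\<forall>\<^sub>F n in sequentially. \<exists>k<n. \<bar>(f ^^ k) y - xt\<bar> \<le> ln (real n) ^ 6 / real n powr \<beta>) \<and>
    (\<forall>\<^sub>F n in sequentially. \<forall>k<n. 1 / (real n powr \<beta> * ln (real n) ^ 6) \<le> \<bar>(f ^^ k) y - xt\<bar>)" for y
  have "AE y in \<mu>. good y"
    using ball_hit[OF assms] excursions_avoid_ball[OF assms] many_returns_upper many_returns_lower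
    by eventually_elim (simp add: good_def close_visit_from_Y no_closer_visit_from_Y)
  then have 1: "AE x in M. \<forall>p. (f ^^ p) x \<in> Y \<longrightarrow> good ((f ^^ p) x)" by (rule AE_mu_transfer)
  have 2: "AE x in M. \<forall>k. (f ^^ k) x \<noteq> xt"
  proof -
    have "(\<Union>k. (f ^^ k) -` {xt} \<inter> space M) \<in> null_sets M"
      by (intro null_sets_UN fn_null[OF point_null[OF assms]])
    then show ?thesis by (rule AE_I') auto
  qed
  from 1 2 AE_enters show ?thesis
  proof eventually_elim
    case (elim x)
    then obtain p where p: "good ((f ^^ p) x)" by blast
    define y where "y = (f ^^ p) x"
    have shift: "(f ^^ (k + p)) x = (f ^^ k) y" for k by (simp add: y_def funpow_add)
    obtain n1 where n1: "\<And>n. n1 \<le> n \<Longrightarrow> \<exists>k<n. \<bar>(f ^^ k) y - xt\<bar> \<le> ln (real n) ^ 6 / real n powr \<beta>"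
      using p unfolding good_def y_def[symmetric] by (auto simp: eventually_sequentially)
    have late: "\<forall>\<^sub>F n in sequentially. \<forall>k<n. 1 / (real n powr \<beta> * ln (real n) ^ 6) \<le> \<bar>(f ^^ k) y - xt\<bar>"
      using p unfolding good_def y_def[symmetric] by simp
    have early: "\<forall>\<^sub>F n in sequentially. \<forall>k\<in>{..<p}. 1 / (real n powr \<beta> * ln (real n) ^ 6) \<le> \<bar>(f ^^ k) x - xt\<bar>"
    proof (rule eventually_ball_finite, simp, intro ballI)
      fix k
      have "0 < \<bar>(f ^^ k) x - xt\<bar>" using elim by simp
      moreover have "(\<lambda>n. 1 / (real n powr \<beta> * ln (real n) ^ 6)) \<longlonglongrightarrow> 0" using beta by real_asymp
      ultimately have "\<forall>\<^sub>F n in sequentially. 1 / (real n powr \<beta> * ln (real n) ^ 6) < \<bar>(f ^^ k) x - xt\<bar>"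
        by (intro order_tendstoD(2))
      then show "\<forall>\<^sub>F n in sequentially. 1 / (real n powr \<beta> * ln (real n) ^ 6) \<le> \<bar>(f ^^ k) x - xt\<bar>"
        by (rule eventually_mono) simp
    qed
    have "\<forall>\<^sub>F n in sequentially. 2 * p + n1 + 1 \<le> n \<and> 2 \<le> ln (real n)"
      by (intro eventually_conj eventually_ge_at_top eventually_ln_ge)
    then show ?case using late early
    proof eventually_elim
      case (elim n)
      then have n: "p < n" "n1 \<le> n - p" "real n / 2 \<le> real (n - p)" "2 \<le> ln (real n)" by auto
      obtain k where k: "k < n - p" "\<bar>(f ^^ k) y - xt\<bar> \<le> ln (real (n - p)) ^ 6 / real (n - p) powr \<beta>"
        using n1[OF n(2)] by blast
      have "ln (real (n - p)) ^ 6 / real (n - p) powr \<beta> \<le> ln (real n) ^ 6 / (real n / 2) powr \<beta>"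
        using n beta by (intro frac_le power_mono ln_mono powr_mono2) auto
      also have "(real n / 2) powr \<beta> = real n powr \<beta> / 2 powr \<beta>" by (simp add: powr_divide)
      also have "ln (real n) ^ 6 / (real n powr \<beta> / 2 powr \<beta>) = 2 powr \<beta> * ln (real n) ^ 6 / real n powr \<beta>" by simp
      also have "\<dots> \<le> ln (real n) * ln (real n) ^ 6 / real n powr \<beta>"
        using powr_mono[of \<beta> 1 2] beta n by (intro divide_right_mono mult_right_mono) auto
      also have "ln (real n) * ln (real n) ^ 6 = ln (real n) ^ 7" by (simp add: power_numeral_reduce)
      finally have "\<bar>(f ^^ (k + p)) x - xt\<bar> \<le> ln (real n) ^ 7 / real n powr \<beta>"
        using k(2) unfolding shift by linarith
      moreover have "k + p < n" using k(1) by simp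
      ultimately have "\<exists>k<n. \<bar>(f ^^ k) x - xt\<bar> \<le> ln (real n) ^ 7 / real n powr \<beta>" by blast
      moreover have "1 / (real n powr \<beta> * ln (real n) ^ 6) \<le> \<bar>(f ^^ k) x - xt\<bar>" if "k < n" for k
      proof (cases "k < p")
        case True then show ?thesis using elim by simp
      next
        case False
        then have "(f ^^ k) x = (f ^^ (k - p)) y" using shift[of "k - p"] by simp
        then show ?thesis using elim that by simp
      qed
      ultimately show ?case by blast
    qed
  qed
qed

end

theorem theorem2p20:
  fixes X Y :: "real set"
    and M :: "real measure"
    and f :: "real \<Rightarrow> real"
    and \<psi> \<phi> :: "real \<Rightarrow> real"
    and xt h \<alpha> \<beta> :: real
  assumes "X \<in> sets borel"
    and "space M = X" and "sets M = sets (restrict_space borel X)"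
    and "sigma_finite_measure M"
    and "emeasure M X = \<infinity>"
    and "invariant_measure M f"
    and "conservative M f"
    and "ergodic M f"
    and "Y \<subseteq> X"
    and "induced_system M f Y \<beta>"
    and "\<alpha> = 1 / \<beta>"
    and "antimono_on {0..} \<psi>"
    and "\<And>t. 0 \<le> t \<Longrightarrow> 0 \<le> \<psi> t"
    and "\<phi> = (\<lambda>x. \<psi> (dist x xt))"
    and "xt \<in> Y"
    and "has_density_at M h xt" and "0 < h"
  shows "\<exists>c\<^sub>1>0. \<exists>c\<^sub>2>0. AE x in M. \<exists>N. \<forall>n\<ge>N.
           \<psi> (ln (real n) powr c\<^sub>1 / real n powr (1 / \<alpha>)) \<le> max_process f \<phi> n x \<and>
           max_process f \<phi> n x \<le> \<psi> (1 / (real n powr (1 / \<alpha>) * ln (real n) powr c\<^sub>2))"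
proof -
  obtain P where "A1 Y (first_return f Y) P" "A2 (first_return f Y) P" "A3 (first_return f Y) P"
    "A4 Y (first_return f Y) (restrict_space M Y)" "A5 (return_time f Y) P"
    "A6 Y (return_time f Y) (restrict_space M Y) \<beta>"
    using assms(10) unfolding induced_system_def Let_def by blast
  then interpret induced_setting M f Y \<beta> P
    using assms by (intro induced_setting.intro) auto
  have anti: "\<psi> t \<le> \<psi> s" if "0 \<le> s" "s \<le> t" for s t
    using assms(12) that by (auto simp: monotone_on_def)
  have "AE x in M. \<exists>N. \<forall>n\<ge>N.
           \<psi> (ln (real n) powr 7 / real n powr (1 / \<alpha>)) \<le> max_process f \<phi> n x \<and>
           max_process f \<phi> n x \<le> \<psi> (1 / (real n powr (1 / \<alpha>) * ln (real n) powr 6))"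
    using closest_visits[OF assms(16,17,15)]
  proof eventually_elim
    case (elim x)
    have "\<forall>\<^sub>F n in sequentially. 1 \<le> n \<and> 1 \<le> ln (real n)"
      by (intro eventually_conj eventually_ge_at_top eventually_ln_ge)
    with elim have "\<forall>\<^sub>F n in sequentially.
           \<psi> (ln (real n) powr 7 / real n powr (1 / \<alpha>)) \<le> max_process f \<phi> n x \<and>
           max_process f \<phi> n x \<le> \<psi> (1 / (real n powr (1 / \<alpha>) * ln (real n) powr 6))"
    proof eventually_elim
      case (elim n)
      have ln: "ln (real n) powr 7 = ln (real n) ^ 7" "ln (real n) powr 6 = ln (real n) ^ 6"
        using elim by (simp_all flip: powr_realpow)
      have \<alpha>: "1 / \<alpha> = \<beta>" using assms(11) by simp
      have \<phi>: "\<phi> ((f ^^ k) x) = \<psi> \<bar>(f ^^ k) x - xt\<bar>" for k by (simp add: assms(14) dist_real_def)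
      obtain k where k: "k < n" "\<bar>(f ^^ k) x - xt\<bar> \<le> ln (real n) ^ 7 / real n powr \<beta>" using elim by blast
      have "\<psi> (ln (real n) ^ 7 / real n powr \<beta>) \<le> \<phi> ((f ^^ k) x)"
        unfolding \<phi> using k(2) by (intro anti) auto
      also have "\<dots> \<le> max_process f \<phi> n x"
        unfolding max_process_def using k(1) by (intro Max_ge) auto
      finally have lower: "\<psi> (ln (real n) ^ 7 / real n powr \<beta>) \<le> max_process f \<phi> n x" .
      have "max_process f \<phi> n x \<le> \<psi> (1 / (real n powr \<beta> * ln (real n) ^ 6))"
        unfolding max_process_def
      proof (intro Max.boundedI)
        show "(\<lambda>k. \<phi> ((f ^^ k) x)) ` {..<n} \<noteq> {}" using k(1) by auto
        fix v assume "v \<in> (\<lambda>k. \<phi> ((f ^^ k) x)) ` {..<n}"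
        then obtain i where i: "i < n" "v = \<psi> \<bar>(f ^^ i) x - xt\<bar>" by (auto simp: \<phi>)
        have "1 / (real n powr \<beta> * ln (real n) ^ 6) \<le> \<bar>(f ^^ i) x - xt\<bar>" using elim i(1) by blast
        then show "v \<le> \<psi> (1 / (real n powr \<beta> * ln (real n) ^ 6))"
          unfolding i(2) using elim by (intro anti) auto
      qed simp
      then show ?case using lower unfolding \<alpha> ln by blast
    qed
    then show ?case by (simp add: eventually_sequentially)
  qed
  then show ?thesis
    by (intro exI[of _ 7] exI[of _ 6] conjI) simp_all
qed

end
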